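(* Let $1<\beta<2$, $\mu>0$, $T>0$, $I=(a,b)$, and suppose that $U$ is the solution to $${}_{C}D_{0,t}^{\beta}U(x,t)=\mu\,\partial_x^2U(x,t)+f(x,t),\quad (x,t)\in I\times(0,T],$$ with $U(x,0)=\phi_0(x)$, $\partial_tU(x,0)=\psi_0(x)$ for $x\in I$ and $U(a,t)=U_a(t)$, $U(b,t)=U_b(t)$ for $t\in(0,T]$, and that $U\in C^2(C^4(I);[0,T])$. Then the finite difference scheme $$\sum_{k=0}^n\alpha_{n-k}(u_j^{k}-\varphi_j^k)=\mu\tau^{\beta}\sum_{k=0}^n\theta_{n-k}\left(\delta^2_xu_j^k-\delta^2_x\varphi_j^k\right)+\mu\sum_{k=0}^n\alpha_{n-k}\delta_x^2\Phi^k_j+\sum_{k=0}^n\alpha_{n-k}F^k_j$$ ($1\le j\le N-1$, $1\le n\le n_T$), with $u_0^k=U_a(t_k)$, $u_N^k=U_b(t_k)$, $u_j^0=\phi_0(x_j)$, where $\alpha_k=(-1)^k\binom{\beta}{k}$ and $\theta_k=2^{-\beta}(-1)^k\alpha_k$, is consistent of order $O(\tau^2+h^2)$.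
   Context: **Notation.** ${}_{C}D_{0,t}^{\beta}U(x,t)=\frac{1}{\Gamma(2-\beta)}\int_0^t(t-s)^{1-\beta}\partial_s^2U(x,s)\,ds$ is the Caputo derivative and $D^{-\beta}_{0,t}g(t)=\frac{1}{\Gamma(\beta)}\int_0^t(t-s)^{\beta-1}g(s)\,ds$ the fractional integral. The grid is $\tau=T/n_T$, $t_n=n\tau$ ($0\le n\le n_T$), $h=(b-a)/N$, $x_j=a+jh$ ($0\le j\le N$), with $n_T,N$ positive integers, and $\delta_x^2v_j=(v_{j+1}-2v_j+v_{j-1})/h^2$. Further, $$\varphi_j^k=\phi_0(x_j)+\psi_0(x_j)t_k,\quad \Phi_j^k=\frac{\phi_0(x_j)t_k^{\beta}}{\Gamma(\beta+1)}+\frac{\psi_0(x_j)t_k^{\beta+1}}{\Gamma(\beta+2)},\quad F_j^k=\left[D^{-\beta}_{0,t}f(x_j,t)\right]_{t=t_k}.$$ $C^2(C^4(I);[0,T])$ denotes the functions that are twice continuously differentiable in $t\in[0,T]$ with values in the space of $C^4$ functions of $x$ (normed by the maximum of the suprema of the derivatives of order at most $4$, with values and derivatives extended continuously to the endpoints of $I$). **Consistency.** Write $U_j^k=U(x_j,t_k)$ and let $R_j^n$ be the residual of the exact solution in the scheme: $$R_j^n=\sum_{k=0}^n\alpha_{n-k}(U_j^{k}-\varphi_j^k)-\mu\tau^{\beta}\sum_{k=0}^n\theta_{n-k}\left(\delta^2_xU_j^k-\delta^2_x\varphi_j^k\right)-\mu\sum_{k=0}^n\alpha_{n-k}\delta_x^2\Phi^k_j-\sum_{k=0}^n\alpha_{n-k}F^k_j.$$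 The scheme, whose equations divided by $\tau^\beta$ approximate the differential equation, is consistent of order $O(\tau^2+h^2)$ if $\tau^{-\beta}R_j^n=O(\tau^2+h^2)$, i.e. there is a constant $C$ independent of $j,n,\tau,h$ with $|R_j^n|\le C\tau^{\beta}(\tau^2+h^2)$ for all $1\le j\le N-1$, $1\le n\le n_T$. *)

theory Defs
  imports "HOL-Analysis.Analysis"
begin

section \<open>Regularity: \<open>C\<^sup>2\<close> curves in \<open>C\<^sup>4(I)\<close>, \<open>I = (a,b)\<close>\<close>

text \<open>
  The iterated derivatives are taken on the open interval, where \<^const>\<open>deriv\<close> is two-sided. All of
  them extend continuously to \<open>[a,b]\<close>, and the endpoint values of \<open>v\<close> itself are the
  extended ones. Values of \<open>v\<close> outside \<open>[a,b]\<close> are irrelevant here and below.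
\<close>

definition C4_fun :: "real \<Rightarrow> real \<Rightarrow> (real \<Rightarrow> real) \<Rightarrow> bool" where
  "C4_fun a b v \<longleftrightarrow>
     continuous_on {a..b} v \<and>
     (\<forall>i<4. \<forall>x\<in>{a<..<b}. (deriv ^^ i) v field_differentiable at x) \<and>
     (\<forall>i\<le>4. \<exists>g. continuous_on {a..b} g \<and> (\<forall>x\<in>{a<..<b}. g x = (deriv ^^ i) v x))"

definition C4_norm :: "real \<Rightarrow> real \<Rightarrow> (real \<Rightarrow> real) \<Rightarrow> real" where
  "C4_norm a b v = Max ((\<lambda>i. SUP x\<in>{a<..<b}. \<bar>(deriv ^^ i) v x\<bar>) ` {..4})"

text \<open>Derivative at time \<open>t\<close>, relative to \<open>S\<close>, of a curve \<open>s \<mapsto> W s\<close> with respect to the \<open>C\<^sup>4\<close> norm.\<close>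

definition has_C4_derivative ::
  "real \<Rightarrow> real \<Rightarrow> (real \<Rightarrow> real \<Rightarrow> real) \<Rightarrow> (real \<Rightarrow> real) \<Rightarrow> real \<Rightarrow> real set \<Rightarrow> bool" where
  "has_C4_derivative a b W D t S \<longleftrightarrow>
     ((\<lambda>s. C4_norm a b (\<lambda>x. (W s x - W t x) / (s - t) - D x)) \<longlongrightarrow> 0) (at t within S)"

definition C4_continuous_on ::
  "real \<Rightarrow> real \<Rightarrow> real set \<Rightarrow> (real \<Rightarrow> real \<Rightarrow> real) \<Rightarrow> bool" where
  "C4_continuous_on a b S W \<longleftrightarrow>
     (\<forall>t\<in>S. ((\<lambda>s. C4_norm a b (\<lambda>x. W s x - W t x)) \<longlongrightarrow> 0) (at t within S))"

definition C2_C4 :: "real \<Rightarrow> real \<Rightarrow> real \<Rightarrow> (real \<Rightarrow> real \<Rightarrow> real) \<Rightarrow> bool" where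
  "C2_C4 a b T U \<longleftrightarrow>
     (\<exists>W1 W2.
        (\<forall>t\<in>{0..T}. C4_fun a b (\<lambda>x. U x t) \<and> C4_fun a b (W1 t) \<and> C4_fun a b (W2 t)) \<and>
        (\<forall>t\<in>{0..T}. has_C4_derivative a b (\<lambda>s x. U x s) (W1 t) t {0..T}) \<and>
        (\<forall>t\<in>{0..T}. has_C4_derivative a b W1 (W2 t) t {0..T}) \<and>
        C4_continuous_on a b {0..T} W2)"


section \<open>Fractional operators\<close>

text \<open>
  The iterated \<^const>\<open>deriv\<close> below may be meaningless at \<open>s = 0\<close> and \<open>s = t\<close>; these points do not
  affect the integral. Similarly, the fractional integral does not depend on \<open>g 0\<close>.
\<close>

definition caputo :: "real \<Rightarrow> (real \<Rightarrow> real) \<Rightarrow> real \<Rightarrow> real" where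
  "caputo \<beta> v t =
     1 / Gamma (2 - \<beta>) * integral {0..t} (\<lambda>s. (t - s) powr (1 - \<beta>) * (deriv ^^ 2) v s)"

definition frac_int :: "real \<Rightarrow> (real \<Rightarrow> real) \<Rightarrow> real \<Rightarrow> real" where
  "frac_int \<beta> g t = 1 / Gamma \<beta> * integral {0..t} (\<lambda>s. (t - s) powr (\<beta> - 1) * g s)"


section \<open>The initial-boundary value problem\<close>

text \<open>
  The data \<open>\<phi>0\<close>, \<open>\<psi>0\<close> are prescribed on \<open>I\<close>, but the scheme also uses them at the grid points \<open>a\<close> and
  \<open>b\<close>; their continuity on \<open>[a,b]\<close> says that the values there are the continuous extensions.
\<close>

definition wave_solution ::
  "real \<Rightarrow> real \<Rightarrow> real \<Rightarrow> real \<Rightarrow> real \<Rightarrow> (real \<Rightarrow> real \<Rightarrow> real) \<Rightarrow>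
   (real \<Rightarrow> real) \<Rightarrow> (real \<Rightarrow> real) \<Rightarrow> (real \<Rightarrow> real) \<Rightarrow> (real \<Rightarrow> real) \<Rightarrow> (real \<Rightarrow> real \<Rightarrow> real) \<Rightarrow> bool" where
  "wave_solution \<beta> \<mu> a b T f \<phi>0 \<psi>0 Ua Ub U \<longleftrightarrow>
     (\<forall>x\<in>{a<..<b}. \<forall>t\<in>{0<..T}.
        caputo \<beta> (U x) t = \<mu> * (deriv ^^ 2) (\<lambda>y. U y t) x + f x t) \<and>
     (\<forall>x\<in>{a<..<b}. U x 0 = \<phi>0 x) \<and>
     (\<forall>x\<in>{a<..<b}. (U x has_real_derivative \<psi>0 x) (at 0 within {0..T})) \<and>
     continuous_on {a..b} \<phi>0 \<and> continuous_on {a..b} \<psi>0 \<and>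
     (\<forall>t\<in>{0<..T}. U a t = Ua t \<and> U b t = Ub t)"


section \<open>The finite difference scheme\<close>

definition scheme_alpha :: "real \<Rightarrow> nat \<Rightarrow> real" where
  "scheme_alpha \<beta> k = (-1) ^ k * (\<beta> gchoose k)"

definition scheme_theta :: "real \<Rightarrow> nat \<Rightarrow> real" where
  "scheme_theta \<beta> k = 2 powr (- \<beta>) * (-1) ^ k * scheme_alpha \<beta> k"

definition time_step :: "real \<Rightarrow> nat \<Rightarrow> real" where
  "time_step T nT = T / real nT"

definition space_step :: "real \<Rightarrow> real \<Rightarrow> nat \<Rightarrow> real" where
  "space_step a b N = (b - a) / real N"

definition grid_t :: "real \<Rightarrow> nat \<Rightarrow> nat \<Rightarrow> real" where
  "grid_t T nT n = real n * time_step T nT"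

definition grid_x :: "real \<Rightarrow> real \<Rightarrow> nat \<Rightarrow> nat \<Rightarrow> real" where
  "grid_x a b N j = a + real j * space_step a b N"

text \<open>Used only for \<open>j \<ge> 1\<close>, so the subtraction on \<^typ>\<open>nat\<close> does not truncate.\<close>

definition delta2 :: "real \<Rightarrow> (nat \<Rightarrow> real) \<Rightarrow> nat \<Rightarrow> real" where
  "delta2 h v j = (v (j + 1) - 2 * v j + v (j - 1)) / h\<^sup>2"

definition phi_low :: "(real \<Rightarrow> real) \<Rightarrow> (real \<Rightarrow> real) \<Rightarrow> real \<Rightarrow> real \<Rightarrow> real" where
  "phi_low \<phi>0 \<psi>0 x t = \<phi>0 x + \<psi>0 x * t"

definition Phi_up :: "real \<Rightarrow> (real \<Rightarrow> real) \<Rightarrow> (real \<Rightarrow> real) \<Rightarrow> real \<Rightarrow> real \<Rightarrow> real" where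
  "Phi_up \<beta> \<phi>0 \<psi>0 x t =
     \<phi>0 x * t powr \<beta> / Gamma (\<beta> + 1) + \<psi>0 x * t powr (\<beta> + 1) / Gamma (\<beta> + 2)"

text \<open>Both sides of the scheme for a grid function \<open>v j k\<close> (space index first, then time index).\<close>

definition scheme_lhs ::
  "real \<Rightarrow> real \<Rightarrow> real \<Rightarrow> real \<Rightarrow> (real \<Rightarrow> real) \<Rightarrow> (real \<Rightarrow> real) \<Rightarrow> nat \<Rightarrow> nat \<Rightarrow>
   (nat \<Rightarrow> nat \<Rightarrow> real) \<Rightarrow> nat \<Rightarrow> nat \<Rightarrow> real" where
  "scheme_lhs \<beta> a b T \<phi>0 \<psi>0 nT N v j n =
     (\<Sum>k=0..n. scheme_alpha \<beta> (n - k) * (v j k - phi_low \<phi>0 \<psi>0 (grid_x a b N j) (grid_t T nT k)))"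

definition scheme_rhs ::
  "real \<Rightarrow> real \<Rightarrow> real \<Rightarrow> real \<Rightarrow> real \<Rightarrow> (real \<Rightarrow> real \<Rightarrow> real) \<Rightarrow> (real \<Rightarrow> real) \<Rightarrow> (real \<Rightarrow> real) \<Rightarrow>
   nat \<Rightarrow> nat \<Rightarrow> (nat \<Rightarrow> nat \<Rightarrow> real) \<Rightarrow> nat \<Rightarrow> nat \<Rightarrow> real" where
  "scheme_rhs \<beta> \<mu> a b T f \<phi>0 \<psi>0 nT N v j n =
     (let \<tau> = time_step T nT; h = space_step a b N; t = grid_t T nT; x = grid_x a b N in
        \<mu> * \<tau> powr \<beta> *
          (\<Sum>k=0..n. scheme_theta \<beta> (n - k) *
             (delta2 h (\<lambda>i. v i k) j - delta2 h (\<lambda>i. phi_low \<phi>0 \<psi>0 (x i) (t k)) j))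
        + \<mu> * (\<Sum>k=0..n. scheme_alpha \<beta> (n - k) * delta2 h (\<lambda>i. Phi_up \<beta> \<phi>0 \<psi>0 (x i) (t k)) j)
        + (\<Sum>k=0..n. scheme_alpha \<beta> (n - k) * frac_int \<beta> (f (x j)) (t k)))"

text \<open>
  The scheme itself. \<open>Ua\<close>, \<open>Ub\<close> are prescribed on \<open>(0,T]\<close> only, so the values at time level \<open>0\<close>
  come from \<open>\<phi>0\<close>. Its residual, defined next, is the left side minus the right side of the equations
  with the exact solution in place of \<open>u\<close>.
\<close>

definition scheme_solution ::
  "real \<Rightarrow> real \<Rightarrow> real \<Rightarrow> real \<Rightarrow> real \<Rightarrow> (real \<Rightarrow> real \<Rightarrow> real) \<Rightarrow> (real \<Rightarrow> real) \<Rightarrow> (real \<Rightarrow> real) \<Rightarrow>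
   (real \<Rightarrow> real) \<Rightarrow> (real \<Rightarrow> real) \<Rightarrow> nat \<Rightarrow> nat \<Rightarrow> (nat \<Rightarrow> nat \<Rightarrow> real) \<Rightarrow> bool" where
  "scheme_solution \<beta> \<mu> a b T f \<phi>0 \<psi>0 Ua Ub nT N u \<longleftrightarrow>
     (\<forall>j\<in>{1..N-1}. \<forall>n\<in>{1..nT}.
        scheme_lhs \<beta> a b T \<phi>0 \<psi>0 nT N u j n = scheme_rhs \<beta> \<mu> a b T f \<phi>0 \<psi>0 nT N u j n) \<and>
     (\<forall>k\<in>{1..nT}. u 0 k = Ua (grid_t T nT k) \<and> u N k = Ub (grid_t T nT k)) \<and>
     (\<forall>j\<in>{0..N}. u j 0 = \<phi>0 (grid_x a b N j))"

definition residual ::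
  "real \<Rightarrow> real \<Rightarrow> real \<Rightarrow> real \<Rightarrow> real \<Rightarrow> (real \<Rightarrow> real \<Rightarrow> real) \<Rightarrow> (real \<Rightarrow> real) \<Rightarrow> (real \<Rightarrow> real) \<Rightarrow>
   (real \<Rightarrow> real \<Rightarrow> real) \<Rightarrow> nat \<Rightarrow> nat \<Rightarrow> nat \<Rightarrow> nat \<Rightarrow> real" where
  "residual \<beta> \<mu> a b T f \<phi>0 \<psi>0 U nT N j n =
     (let v = (\<lambda>i k. U (grid_x a b N i) (grid_t T nT k)) in
        scheme_lhs \<beta> a b T \<phi>0 \<psi>0 nT N v j n - scheme_rhs \<beta> \<mu> a b T f \<phi>0 \<psi>0 nT N v j n)"

lemma residual_eq:
  fixes U :: "real \<Rightarrow> real \<Rightarrow> real" and a b T :: real and nT N :: nat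
  defines "t \<equiv> grid_t T nT" and "x \<equiv> grid_x a b N"
  shows "residual \<beta> \<mu> a b T f \<phi>0 \<psi>0 U nT N j n =
    (\<Sum>k=0..n. scheme_alpha \<beta> (n - k) * (U (x j) (t k) - phi_low \<phi>0 \<psi>0 (x j) (t k)))
    - \<mu> * time_step T nT powr \<beta> *
        (\<Sum>k=0..n. scheme_theta \<beta> (n - k) *
           (delta2 (space_step a b N) (\<lambda>i. U (x i) (t k)) j
            - delta2 (space_step a b N) (\<lambda>i. phi_low \<phi>0 \<psi>0 (x i) (t k)) j))
    - \<mu> * (\<Sum>k=0..n. scheme_alpha \<beta> (n - k) *
           delta2 (space_step a b N) (\<lambda>i. Phi_up \<beta> \<phi>0 \<psi>0 (x i) (t k)) j)
    - (\<Sum>k=0..n. scheme_alpha \<beta> (n - k) * frac_int \<beta> (f (x j)) (t k))"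
  by (simp add: residual_def scheme_lhs_def scheme_rhs_def t_def x_def Let_def)

text \<open>
  Consistency of order \<open>O(\<tau>\<^sup>2 + h\<^sup>2)\<close>; the factor \<open>\<tau>\<^sup>\<beta>\<close> appears because the equations of the
  scheme approximate the differential equation after division by it.
\<close>

definition scheme_consistent ::
  "real \<Rightarrow> real \<Rightarrow> real \<Rightarrow> real \<Rightarrow> real \<Rightarrow> (real \<Rightarrow> real \<Rightarrow> real) \<Rightarrow> (real \<Rightarrow> real) \<Rightarrow> (real \<Rightarrow> real) \<Rightarrow>
   (real \<Rightarrow> real \<Rightarrow> real) \<Rightarrow> bool" where
  "scheme_consistent \<beta> \<mu> a b T f \<phi>0 \<psi>0 U \<longleftrightarrow>
     (\<exists>C. \<forall>nT>0. \<forall>N>0. \<forall>j\<in>{1..N-1}. \<forall>n\<in>{1..nT}.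
        \<bar>residual \<beta> \<mu> a b T f \<phi>0 \<psi>0 U nT N j n\<bar>
          \<le> C * time_step T nT powr \<beta> * ((time_step T nT)\<^sup>2 + (space_step a b N)\<^sup>2))"

end

theory Submission
  imports Defs
begin

text \<open>
  Multiplied by the generating function \<open>(1 - z)\<^sup>\<beta>\<close> of the \<open>\<alpha>\<^sub>k\<close>, the fractional integral
  \<open>D\<^sup>-\<^sup>\<beta>\<close> should become multiplication by \<open>\<tau>\<^sup>\<beta>\<close> times the generating function
  \<open>((1 + z) / 2)\<^sup>\<beta>\<close> of the \<open>\<theta>\<^sub>k\<close>: this is the fractional trapezoidal rule. The scheme is this
  rule applied to the equation integrated with order \<open>\<beta>\<close>, in which the Taylor polynomial
  \<open>\<phi>\<close> of the solution and its integral \<open>\<Phi>\<close> are treated exactly in time. So the residual has two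
  sources.

  In space, second derivatives are replaced by second differences. Each replacement costs
  \<open>O(h\<^sup>2)\<close> by Taylor's theorem in \<open>C\<^sup>4\<close> (\<open>second_difference_error\<close>), and the weights that
  multiply it add up to \<open>O(\<tau>\<^sup>\<beta>)\<close> (\<open>scheme_theta_abs_sum\<close>,
  \<open>scheme_alpha_power_sum_bounds\<close>).

  In time, the rule is applied to a function that vanishes to second order at \<open>0\<close>, namely the
  fractional integral of order \<open>2\<close> of \<open>w = \<partial>\<^sub>x\<^sup>2 \<partial>\<^sub>t\<^sup>2 U\<close>. Here nothing
  beyond continuity of \<open>w\<close> is available, and the error is an integral of \<open>w\<close> against a Peano kernel.
  By homogeneity the kernel at \<open>s\<close> is \<open>\<tau>\<^sup>\<beta>\<^sup>+\<^sup>1 K((t\<^sub>n - s) / \<tau>)\<close> with one fixed function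
  \<open>K\<close>, whose Laplace transform is
  \<open>s\<^sup>-\<^sup>2 (((1 - e\<^sup>-\<^sup>s) / s)\<^sup>\<beta> - ((1 + e\<^sup>-\<^sup>s) / 2)\<^sup>\<beta>)\<close>. The bound
  \<open>O(\<tau>\<^sup>\<beta>\<^sup>+\<^sup>2)\<close> (\<open>quadrature_error_bound\<close>) is therefore the statement that \<open>K\<close> is
  integrable on \<open>[0, \<infinity>)\<close> (\<open>spline_kernel_decay\<close>). The two powers agree to first order at
  \<open>s = 0\<close>, so no growing part remains; the content is the decay of \<open>K\<close>.

  \<open>K\<close> is the difference of two splines with the common asymptote \<open>r - \<beta> / 2\<close>. For the spline with
  weights \<open>\<theta>\<^sub>k\<close> the deviation from the asymptote is a tail of binomial series at \<open>1\<close>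
  (\<open>trapezoid_spline_approx\<close>). For the spline with weights \<open>\<alpha>\<^sub>k\<close> the deviation is
  \<open>spline_err \<beta>\<close>. It is bounded, by convolution identities for binomial coefficients and the
  logarithmic convexity of the Gamma function (\<open>spline_err_bounded_base\<close>). Boundedness is then
  improved to quadratic decay by a bootstrap that uses no further expansion: the family
  \<open>spline_err c\<close> satisfies a two-term recurrence linking \<open>c\<close> and \<open>c + 1\<close>, and
  \<open>spline_err (c + 1)\<close> is a unit mean of \<open>spline_err c\<close>. Averaging gains one power of \<open>r\<close>
  (\<open>spline_err_gain\<close>), and the recurrence hands this gain back to the index \<open>c\<close>
  (\<open>spline_err_decay_from_next\<close>).
\<close>


section \<open>Signed binomial coefficients\<close>

lemma scheme_alpha_0 [simp]: "scheme_alpha c 0 = 1"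
  by (simp add: scheme_alpha_def)

lemma scheme_alpha_Suc: "real (Suc k) * scheme_alpha c (Suc k) = (real k - c) * scheme_alpha c k"
proof -
  have "real (Suc k) * (c gchoose Suc k) = (c - real k) * (c gchoose k)"
    using gbinomial_mult_1[of c k] by (simp add: algebra_simps)
  then have "(-1) ^ Suc k * (real (Suc k) * (c gchoose Suc k)) = (-1) ^ Suc k * ((c - real k) * (c gchoose k))"
    by simp
  then show ?thesis by (simp add: scheme_alpha_def algebra_simps)
qed

lemma scheme_alpha_plus1:
  "scheme_alpha (c + 1) (Suc k) = scheme_alpha c (Suc k) - scheme_alpha c k"
  unfolding scheme_alpha_def gbinomial_Suc_Suc[of c k] by (simp add: algebra_simps)

text \<open>
  The coefficients of \<open>(1 - z)\<^sup>c\<close> and \<open>(1 - z)\<^sup>d\<close> convolve to those of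
  \<open>(1 - z)\<^sup>c\<^sup>+\<^sup>d\<close>. The exact sums below are instances in which the product is
  \<open>(1 - z)\<^sup>-\<^sup>1\<close> or \<open>(1 - z)\<^sup>-\<^sup>2\<close>, or one factor is \<open>(1 - z)\<^sup>-\<^sup>1\<close>.
\<close>

lemma scheme_alpha_convolution:
  "(\<Sum>k\<le>n. scheme_alpha c (n - k) * scheme_alpha d k) = scheme_alpha (c + d) n"
proof -
  have "scheme_alpha (c + d) n = (-1) ^ n * (\<Sum>k\<le>n. (d gchoose k) * (c gchoose (n - k)))"
    using gbinomial_Vandermonde[of d c n] by (simp add: scheme_alpha_def add.commute atLeast0AtMost)
  also have "\<dots> = (\<Sum>k\<le>n. scheme_alpha c (n - k) * scheme_alpha d k)"
    unfolding sum_distrib_left scheme_alpha_def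
    by (rule sum.cong) (simp_all add: power_add [symmetric] mult_ac)
  finally show ?thesis ..
qed

lemma scheme_alpha_minus1: "scheme_alpha (-1) n = 1"
proof (induction n)
  case (Suc n)
  then have "real (Suc n) * scheme_alpha (-1) (Suc n) = real (Suc n) * 1"
    using scheme_alpha_Suc[of n "-1"] by simp
  then show ?case by (simp del: of_nat_Suc)
qed simp

lemma scheme_alpha_minus2: "scheme_alpha (-2) n = real n + 1"
proof (induction n)
  case (Suc n)
  have "real (Suc n) * scheme_alpha (-2) (Suc n) = real (Suc n) * (real n + 2)"
    using scheme_alpha_Suc[of n "-2"] Suc by (simp add: algebra_simps)
  then have "scheme_alpha (-2) (Suc n) = real n + 2"
    by (simp only: mult_cancel_left) simp
  then show ?case by simp
qed simp

lemma scheme_alpha_nonneg: "c \<le> 0 \<Longrightarrow> 0 \<le> scheme_alpha c n"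
proof (induction n)
  case (Suc n)
  have "0 \<le> real (Suc n) * scheme_alpha c (Suc n)"
    using scheme_alpha_Suc[of n c] Suc by (simp del: of_nat_Suc)
  then show ?case by (simp add: zero_le_mult_iff del: of_nat_Suc)
qed simp

lemma scheme_alpha_nonneg_tail:
  assumes "1 < c" "c < 2" "2 \<le> n"
  shows "0 \<le> scheme_alpha c n"
  using assms(3)
proof (induction n rule: dec_induct)
  case base
  have "2 * scheme_alpha c 2 = - ((1 - c) * c)"
    using scheme_alpha_Suc[of 1 c] scheme_alpha_Suc[of 0 c] by (simp add: numeral_2_eq_2 [symmetric])
  moreover have "(1 - c) * c \<le> 0" using assms by (intro mult_nonpos_nonneg) auto
  ultimately show ?case by simp
next
  case (step n)
  have "0 \<le> real (Suc n) * scheme_alpha c (Suc n)"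
    using scheme_alpha_Suc[of n c] step assms by (simp del: of_nat_Suc)
  then show ?case by (simp add: zero_le_mult_iff del: of_nat_Suc)
qed

text \<open>
  The ratio of consecutive coefficients is \<open>(m - g) / (m + 1)\<close> in absolute value, and Bernoulli's
  inequality bounds it by \<open>(m / (m + 1)) powr (g + 1)\<close>. So the product of the coefficient with
  \<open>m powr (g + 1)\<close> decreases with \<open>m\<close>.
\<close>

lemma gchoose_decay:
  assumes "0 < g" "g < 1"
  shows "\<bar>g gchoose Suc n\<bar> \<le> real (Suc n) powr (- g - 1)"
proof (induction n)
  case 0
  show ?case using assms by simp
next
  case (Suc n)
  define m where "m = real (Suc n)"
  have m: "m \<ge> 1" by (simp add: m_def)
  have "real (Suc (Suc n)) * (g gchoose Suc (Suc n)) = (g - m) * (g gchoose Suc n)"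
    using gbinomial_mult_1[of g "Suc n"] by (simp add: algebra_simps m_def)
  then have "(m + 1) * (g gchoose Suc (Suc n)) = (g - m) * (g gchoose Suc n)"
    by (simp add: m_def add_ac)
  then have "(m + 1) * \<bar>g gchoose Suc (Suc n)\<bar> = \<bar>g - m\<bar> * \<bar>g gchoose Suc n\<bar>"
    using m by (metis abs_mult abs_of_nonneg add_nonneg_nonneg order.trans zero_le_one)
  also have "\<dots> = (m - g) * \<bar>g gchoose Suc n\<bar>" using assms m by simp
  also have "\<dots> \<le> (m - g) * m powr (- g - 1)"
    using Suc assms m by (intro mult_left_mono) (auto simp: m_def)
  finally have 1: "(m + 1) * \<bar>g gchoose Suc (Suc n)\<bar> \<le> (m - g) * m powr (- g - 1)" .
  \<comment> \<open>Bernoulli's inequality for the exponent \<open>g + 1\<close>\<close>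
  have "(m - g) / (m + 1) \<le> (m / (m + 1)) powr (g + 1)"
  proof -
    have conv: "((\<lambda>x. x powr (g + 1)) has_real_derivative (g + 1) * x powr g) (at x)" if "x > 0" for x
      using that by (auto intro!: derivative_eq_intros)
    define x where "x = m / (m + 1)"
    have x: "0 < x" "x < 1" using m by (auto simp: x_def)
    obtain z where z: "x < z" "z < 1" "1 powr (g+1) - x powr (g+1) = (1 - x) * ((g+1) * z powr g)"
      using MVT2[of x 1 "\<lambda>x. x powr (g+1)" "\<lambda>x. (g + 1) * x powr g"] x conv by force
    have "z powr g \<le> 1" using z x assms by (intro powr_le1) auto
    then have "(1 - x) * ((g+1) * z powr g) \<le> (1 - x) * (g + 1)"
      using x assms by (intro mult_left_mono) auto
    then have "x powr (g+1) \<ge> 1 - (1 - x) * (g + 1)" using z(3) by simp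
    also have "1 - (1 - x) * (g + 1) = (m - g) / (m + 1)"
      using m by (simp add: x_def field_simps)
    finally show ?thesis by (simp add: x_def)
  qed
  then have "(m - g) / (m + 1) * m powr (- g - 1) \<le> (m / (m + 1)) powr (g + 1) * m powr (- g - 1)"
    by (rule mult_right_mono) simp
  also have "\<dots> = (m + 1) powr (- g - 1)"
    using m by (simp add: powr_divide powr_minus powr_diff powr_add field_simps)
  finally have "(m - g) * m powr (- g - 1) \<le> (m + 1) * (m + 1) powr (- g - 1)"
    using m by (simp add: field_simps)
  then have "(m + 1) * \<bar>g gchoose Suc (Suc n)\<bar> \<le> (m + 1) * (m + 1) powr (- g - 1)"
    using 1 by linarith
  then have "\<bar>g gchoose Suc (Suc n)\<bar> \<le> (m + 1) powr (- g - 1)" using m by simp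
  then show ?case by (simp add: m_def add_ac)
qed

text \<open>
  The binomial series of \<open>(1 + x) powr c\<close> at the boundary point \<open>x = 1\<close>. The Lagrange remainder is
  the first omitted coefficient times \<open>(1 + \<xi>) powr (c - n)\<close>, a factor at most \<open>1\<close> once
  \<open>c \<le> n\<close>.
\<close>

lemma binomial_sum_remainder:
  fixes c :: real
  assumes "c \<le> real n" "0 < n"
  shows "\<bar>2 powr c - (\<Sum>k<n. c gchoose k)\<bar> \<le> \<bar>c gchoose n\<bar>"
proof -
  define D where "D = (\<lambda>m x. fact m * (c gchoose m) * (1 + x) powr (c - real m))"
  have "D 0 = (\<lambda>x. (1 + x) powr c)" by (simp add: D_def)
  moreover have "\<forall>m t. m < n \<and> 0 \<le> t \<and> t \<le> 1 \<longrightarrow> DERIV (D m) t :> D (Suc m) t"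
  proof (intro allI impI)
    fix m t assume "m < n \<and> 0 \<le> t \<and> t \<le> (1::real)"
    then have t: "1 + t > 0" by simp
    have "fact (Suc m) * (c gchoose Suc m) = fact m * (c gchoose m) * (c - real m)"
      using gbinomial_mult_1[of c m] by (simp add: algebra_simps)
    then have "fact m * (c gchoose m) * ((c - real m) * (1 + t) powr (c - real m - 1)) = D (Suc m) t"
      by (simp add: D_def diff_diff_eq add.commute)
    moreover have "DERIV (\<lambda>x. (1 + x) powr (c - real m)) t :> (c - real m) * (1 + t) powr (c - real m - 1)"
      using t by (auto intro!: derivative_eq_intros)
    ultimately show "DERIV (D m) t :> D (Suc m) t"
      unfolding D_def using DERIV_cmult by metis
  qed
  ultimately obtain t where t: "0 < t" "t < 1"
    "(1 + 1) powr c = (\<Sum>m<n. (D m 0 / fact m) * 1 ^ m) + (D n t / fact n) * 1 ^ n"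
    using Maclaurin[of 1 n D "\<lambda>x. (1 + x) powr c"] assms by auto
  have "2 powr c - (\<Sum>k<n. c gchoose k) = (c gchoose n) * (1 + t) powr (c - real n)"
    using t(3) by (simp add: D_def)
  moreover have "(1 + t) powr (c - real n) \<le> 1"
    using t assms by (smt (verit) powr_less_one powr_zero_eq_one powr_mono)
  ultimately show ?thesis by (simp add: abs_mult mult_left_le)
qed


section \<open>Fractional splines\<close>

text \<open>
  The normalisation by \<open>Gamma (p + 1)\<close> makes differentiation lower the index, and makes
  \<open>trunc_power p\<close> the kernel of the fractional integral of order \<open>p + 1\<close>.
\<close>

definition trunc_power :: "real \<Rightarrow> real \<Rightarrow> real" where
  "trunc_power p x = max 0 x powr p / Gamma (p + 1)"

text \<open>
  The fractional difference \<open>(1 - z)\<^sup>c\<close> applied to a truncated power. Terms with \<open>k \<ge> r\<close>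
  vanish, so that any larger range of summation gives the same value.
\<close>

definition frac_spline :: "real \<Rightarrow> real \<Rightarrow> real \<Rightarrow> real" where
  "frac_spline c p r = (\<Sum>k\<le>nat \<lceil>r\<rceil>. scheme_alpha c k * trunc_power p (r - real k))"

lemma trunc_power_nonpos [simp]: "x \<le> 0 \<Longrightarrow> trunc_power p x = 0"
  by (simp add: trunc_power_def max_def)

lemma frac_spline_eq:
  assumes "r \<le> real N"
  shows "frac_spline c p r = (\<Sum>k\<le>N. scheme_alpha c k * trunc_power p (r - real k))"
  unfolding frac_spline_def
proof (rule sum.mono_neutral_left)
  show "{..nat \<lceil>r\<rceil>} \<subseteq> {..N}" using assms by (auto simp: nat_le_iff ceiling_le_iff)
  show "\<forall>k\<in>{..N} - {..nat \<lceil>r\<rceil>}. scheme_alpha c k * trunc_power p (r - real k) = 0"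
  proof
    fix k assume "k \<in> {..N} - {..nat \<lceil>r\<rceil>}"
    then have "nat \<lceil>r\<rceil> < k" by simp
    then have "r - real k \<le> 0" by linarith
    then show "scheme_alpha c k * trunc_power p (r - real k) = 0" by simp
  qed
qed simp

lemma frac_spline_nat: "frac_spline c p (real n) = (\<Sum>k\<le>n. scheme_alpha c (n - k) * trunc_power p (real k))"
proof -
  have "frac_spline c p (real n) = (\<Sum>k\<le>n. scheme_alpha c k * trunc_power p (real n - real k))"
    by (simp add: frac_spline_eq)
  also have "\<dots> = (\<Sum>k\<le>n. scheme_alpha c (n - k) * trunc_power p (real n - real (n - k)))"
    by (rule sum.reindex_bij_witness[of _ "\<lambda>k. n - k" "\<lambda>k. n - k"]) auto
  also have "\<dots> = (\<Sum>k\<le>n. scheme_alpha c (n - k) * trunc_power p (real k))"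
    by (rule sum.cong) (auto simp: of_nat_diff)
  finally show ?thesis .
qed

lemma Gamma_plus1_pos: "0 < x \<Longrightarrow> Gamma (x + 1) = x * Gamma (x::real)"
  by (rule Gamma_plus1) (auto elim!: nonpos_Ints_cases)

lemma trunc_power_deriv:
  assumes "0 < p"
  shows "(trunc_power (p + 1) has_real_derivative trunc_power p x) (at x)"
proof (cases "x = 0")
  case False
  have G: "Gamma (p + 1 + 1) = (p + 1) * Gamma (p + 1)"
    using assms by (intro Gamma_plus1_pos) auto
  have Gp: "Gamma (p + 1) > 0" using assms by (intro Gamma_real_pos) auto
  show ?thesis
  proof (cases "x > 0")
    case True
    have "((\<lambda>x. x powr (p + 1) / Gamma (p + 1 + 1)) has_real_derivative x powr p / Gamma (p + 1)) (at x)"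
      unfolding G using True less_imp_neq[OF Gp] assms by (auto intro!: derivative_eq_intros)
    moreover have "trunc_power p x = x powr p / Gamma (p + 1)"
      using True by (simp add: trunc_power_def max_def)
    ultimately have "((\<lambda>x. x powr (p + 1) / Gamma (p + 1 + 1)) has_real_derivative trunc_power p x) (at x)"
      by simp
    then show ?thesis
      by (rule has_field_derivative_transform_within_open[where S = "{0<..}"])
         (use True in \<open>auto simp: trunc_power_def max_def\<close>)
  next
    case x: False
    then have "x < 0" using False by simp
    have "((\<lambda>x. 0) has_real_derivative trunc_power p x) (at x)"
      using \<open>x < 0\<close> by simp
    then show ?thesis
      by (rule has_field_derivative_transform_within_open[where S = "{..<0}"])
         (use \<open>x < 0\<close> in auto)
  qed
next
  case True
  have "((\<lambda>h. (trunc_power (p + 1) (0 + h) - trunc_power (p + 1) 0) / h) \<longlongrightarrow> 0) (at 0)"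
  proof (rule Lim_null_comparison)
    show "\<forall>\<^sub>F h in at 0. norm ((trunc_power (p + 1) (0 + h) - trunc_power (p + 1) 0) / h)
        \<le> \<bar>h\<bar> powr p / \<bar>Gamma (p + 1 + 1)\<bar>"
    proof (rule eventually_at_filter[THEN iffD2], rule always_eventually, intro allI impI)
      fix h :: real assume "h \<noteq> 0"
      have "max 0 h powr (p + 1) / \<bar>h\<bar> \<le> \<bar>h\<bar> powr p"
      proof (cases "h > 0")
        case True
        then show ?thesis by (simp add: powr_add)
      qed (simp add: max_def)
      then show "norm ((trunc_power (p + 1) (0 + h) - trunc_power (p + 1) 0) / h)
        \<le> \<bar>h\<bar> powr p / \<bar>Gamma (p + 1 + 1)\<bar>"
        using divide_right_mono[of "max 0 h powr (p + 1) / \<bar>h\<bar>" "\<bar>h\<bar> powr p" "\<bar>Gamma (p + 1 + 1)\<bar>"]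
        by (simp add: trunc_power_def abs_mult mult_ac)
    qed
    have "((\<lambda>h::real. \<bar>h\<bar> powr p / \<bar>Gamma (p + 1 + 1)\<bar>) \<longlongrightarrow> \<bar>0\<bar> powr p / \<bar>Gamma (p + 1 + 1)\<bar>) (at 0)"
      using assms less_imp_neq[OF Gamma_real_pos[of "p + 1 + 1"]] by (intro tendsto_powr' tendsto_intros) auto
    then show "((\<lambda>h::real. \<bar>h\<bar> powr p / \<bar>Gamma (p + 1 + 1)\<bar>) \<longlongrightarrow> 0) (at 0)"
      by (simp only: abs_zero powr_0 div_0)
  qed
  then show ?thesis using True by (simp add: DERIV_def)
qed

lemma frac_spline_deriv:
  assumes "0 < p"
  shows "(frac_spline c (p + 1) has_real_derivative frac_spline c p r) (at r)"
proof -
  define N where "N = nat \<lceil>r\<rceil> + 1"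
  have N: "r < real N" unfolding N_def by linarith
  have "((\<lambda>r. \<Sum>k\<le>N. scheme_alpha c k * trunc_power (p + 1) (r - real k)) has_real_derivative
        (\<Sum>k\<le>N. scheme_alpha c k * trunc_power p (r - real k))) (at r)"
  proof (rule DERIV_sum)
    fix k
    have "((\<lambda>r. trunc_power (p + 1) (r - real k)) has_real_derivative trunc_power p (r - real k) * 1) (at r)"
      by (rule DERIV_chain2[OF trunc_power_deriv[OF assms]]) (auto intro!: derivative_eq_intros)
    then show "((\<lambda>r. scheme_alpha c k * trunc_power (p + 1) (r - real k)) has_real_derivative
        scheme_alpha c k * trunc_power p (r - real k)) (at r)"
      using DERIV_cmult by fastforce
  qed
  then show ?thesis
    unfolding frac_spline_eq[OF less_imp_le[OF N], symmetric]
    by (rule has_field_derivative_transform_within_open[where S = "{..<real N}"])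
       (use N in \<open>auto simp: frac_spline_eq[of _ N]\<close>)
qed

text \<open>
  Since \<open>(1 - z)\<^sup>c\<^sup>+\<^sup>1 = (1 - z)\<^sup>c (1 - z)\<close>, raising the index of the
  difference applies one ordinary backward difference.
\<close>

lemma frac_spline_plus1: "frac_spline (c + 1) p r = frac_spline c p r - frac_spline c p (r - 1)"
proof -
  define N where "N = nat \<lceil>r\<rceil>"
  have N: "r \<le> real N" "r \<le> real (Suc N)" "r - 1 \<le> real N" unfolding N_def by linarith+
  let ?t = "\<lambda>k. trunc_power p (r - real k)"
  have "frac_spline (c + 1) p r = ?t 0 + (\<Sum>k\<le>N. scheme_alpha (c + 1) (Suc k) * ?t (Suc k))"
    by (simp add: frac_spline_eq[OF N(2)] sum.atMost_Suc_shift del: sum.atMost_Suc)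
  also have "\<dots> = (?t 0 + (\<Sum>k\<le>N. scheme_alpha c (Suc k) * ?t (Suc k)))
                   - (\<Sum>k\<le>N. scheme_alpha c k * ?t (Suc k))"
    unfolding scheme_alpha_plus1 left_diff_distrib sum_subtractf by simp
  also have "?t 0 + (\<Sum>k\<le>N. scheme_alpha c (Suc k) * ?t (Suc k)) = frac_spline c p r"
    by (simp add: frac_spline_eq[OF N(2)] sum.atMost_Suc_shift del: sum.atMost_Suc)
  also have "(\<Sum>k\<le>N. scheme_alpha c k * ?t (Suc k)) = frac_spline c p (r - 1)"
    by (simp add: frac_spline_eq[OF N(3)] algebra_simps)
  finally show ?thesis .
qed

text \<open>
  The Laplace transform \<open>X\<close> of \<open>frac_spline c (c + 1)\<close> is \<open>(1 - e\<^sup>-\<^sup>s)\<^sup>c s\<^sup>-\<^sup>c\<^sup>-\<^sup>2\<close>. Its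
  logarithmic derivative is rational in \<open>s\<close> and \<open>e\<^sup>-\<^sup>s\<close>, and the resulting first-order equation for
  \<open>X\<close> is this recurrence in the variable \<open>r\<close>. The proof compares the coefficients of the truncated
  powers.
\<close>

lemma frac_spline_recurrence:
  assumes "0 < c"
  shows "r * frac_spline c (c + 1) r =
    (r - 1 - c) * frac_spline c (c + 1) (r - 1) + (c + 2) * frac_spline (c + 1) (c + 2) r"
proof -
  define N where "N = nat \<lceil>r\<rceil>"
  have N: "r \<le> real (Suc N)" "r - 1 \<le> real N" unfolding N_def by linarith+
  let ?t = "\<lambda>k. trunc_power (c + 1) (r - real k)" and ?u = "\<lambda>k. trunc_power (c + 2) (r - real k)"
  have G: "Gamma (c + 2 + 1) = (c + 2) * Gamma (c + 1 + 1)"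
    using assms Gamma_plus1_pos[of "c + 2"] by (simp add: add_ac)
  have u: "(c + 2) * ?u k = (r - real k) * ?t k" for k
  proof (cases "r - real k > 0")
    case True
    then have "(r - real k) powr (c + 2) = (r - real k) * (r - real k) powr (c + 1)"
      using powr_add[of "r - real k" 1 "c + 1"] by (simp add: add_ac)
    then show ?thesis using True assms unfolding trunc_power_def G by (simp add: max_def)
  qed simp
  have E1: "frac_spline c (c + 1) r = ?t 0 + (\<Sum>k\<le>N. scheme_alpha c (Suc k) * ?t (Suc k))"
    by (simp add: frac_spline_eq[OF N(1)] sum.atMost_Suc_shift del: sum.atMost_Suc)
  have E2: "frac_spline c (c + 1) (r - 1) = (\<Sum>k\<le>N. scheme_alpha c k * ?t (Suc k))"
    by (simp add: frac_spline_eq[OF N(2)] algebra_simps)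
  have E3: "frac_spline (c + 1) (c + 2) r = ?u 0 + (\<Sum>k\<le>N. scheme_alpha (c + 1) (Suc k) * ?u (Suc k))"
    by (simp add: frac_spline_eq[OF N(1)] sum.atMost_Suc_shift del: sum.atMost_Suc)
  have "r * (scheme_alpha c (Suc k) * ?t (Suc k)) = (r - 1 - c) * (scheme_alpha c k * ?t (Suc k))
     + (c + 2) * (scheme_alpha (c + 1) (Suc k) * ?u (Suc k))" (is "?L = ?R") for k
  proof -
    have a: "real (Suc k) * scheme_alpha c (Suc k) * ?t (Suc k) = (real k - c) * scheme_alpha c k * ?t (Suc k)"
      using scheme_alpha_Suc[of k c] by simp
    have "?R = (r - 1 - c) * (scheme_alpha c k * ?t (Suc k))
        + scheme_alpha (c + 1) (Suc k) * ((r - real (Suc k)) * ?t (Suc k))"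
      unfolding u[symmetric] by (simp add: mult_ac)
    also have "\<dots> = ?L"
      using a unfolding scheme_alpha_plus1 by (simp add: algebra_simps)
    finally show ?thesis ..
  qed
  then have "r * (\<Sum>k\<le>N. scheme_alpha c (Suc k) * ?t (Suc k)) =
     (r - 1 - c) * (\<Sum>k\<le>N. scheme_alpha c k * ?t (Suc k)) +
     (c + 2) * (\<Sum>k\<le>N. scheme_alpha (c + 1) (Suc k) * ?u (Suc k))"
    by (simp add: sum_distrib_left sum.distrib[symmetric])
  moreover have "r * ?t 0 = (c + 2) * ?u 0" using u[of 0] by simp
  ultimately show ?thesis unfolding E1 E2 E3 by (simp add: algebra_simps)
qed


section \<open>Asymptotics of fractional splines\<close>

text \<open>
  The polynomial \<open>r - c / 2\<close> is the principal part of the inverse Laplace transform of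
  \<open>(1 - e\<^sup>-\<^sup>s)\<^sup>c s\<^sup>-\<^sup>c\<^sup>-\<^sup>2\<close>, whose only pole on the imaginary axis is the double pole at \<open>0\<close>.
\<close>

definition spline_err :: "real \<Rightarrow> real \<Rightarrow> real" where
  "spline_err c r = frac_spline c (c + 1) r - r + c / 2"

text \<open>
  The polynomial \<open>r - c / 2\<close> satisfies the recurrence of the spline exactly, so the error inherits
  it.
\<close>

lemma spline_err_recurrence:
  assumes "0 < c"
  shows "r * spline_err c r = (r - 1 - c) * spline_err c (r - 1) + (c + 2) * spline_err (c + 1) r"
  using frac_spline_recurrence[OF assms, of r] unfolding spline_err_def
  by (simp add: field_simps)

lemma spline_err_deriv:
  assumes "0 < c"
  shows "(spline_err (c + 1) has_real_derivative spline_err c r - spline_err c (r - 1)) (at r)"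
proof -
  have "(frac_spline (c + 1) (c + 1 + 1) has_real_derivative
          frac_spline c (c + 1) r - frac_spline c (c + 1) (r - 1)) (at r)"
    using frac_spline_deriv[of "c + 1" "c + 1" r] assms by (simp add: frac_spline_plus1)
  then have "((\<lambda>r. frac_spline (c + 1) (c + 1 + 1) r - r + (c + 1) / 2) has_real_derivative
          frac_spline c (c + 1) r - frac_spline c (c + 1) (r - 1) - 1 + 0) (at r)"
    by (intro DERIV_add DERIV_diff DERIV_ident DERIV_const)
  then show ?thesis by (simp add: spline_err_def[abs_def] algebra_simps)
qed

text \<open>
  The error for \<open>c + 1\<close> is the mean of the error for \<open>c\<close> over the unit interval \<open>(r - 1, r)\<close>, as
  \<open>(1 - e\<^sup>-\<^sup>s) / s\<close> is the transform of the indicator of \<open>[0, 1]\<close>. Only the mean value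
  theorem for an antiderivative is needed.
\<close>

lemma spline_err_mean_value:
  assumes "0 < c"
  obtains x where "r - 1 < x" "x < r" "spline_err (c + 1) r = spline_err c x"
proof -
  define H where "H = (\<lambda>x. frac_spline c (c + 1 + 1) x - x\<^sup>2 / 2 + c * x / 2)"
  have "DERIV H x :> spline_err c x" for x
  proof -
    have "DERIV H x :> frac_spline c (c + 1) x - 2 * x / 2 + c * 1 / 2"
      unfolding H_def using frac_spline_deriv[of "c + 1" c x] assms
      by (intro DERIV_add DERIV_diff DERIV_cdivide DERIV_cmult DERIV_ident) (auto intro!: derivative_eq_intros)
    then show ?thesis by (simp add: spline_err_def)
  qed
  then obtain x where x: "r - 1 < x" "x < r" "H r - H (r - 1) = (r - (r - 1)) * spline_err c x"
    using MVT2[of "r - 1" r H "spline_err c"] by auto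
  have "H r - H (r - 1) = spline_err (c + 1) r"
    unfolding H_def spline_err_def frac_spline_plus1
    by (simp add: field_simps power2_eq_square)
  with x that show ?thesis by simp
qed

lemma Gamma_log_convex_ineq:
  fixes x y t :: real
  assumes "0 < x" "0 < y" "0 \<le> t" "t \<le> 1"
  shows "Gamma ((1 - t) * x + t * y) \<le> Gamma x powr (1 - t) * Gamma y powr t"
proof -
  have pos: "0 < (1 - t) * x + t * y"
    using assms by (cases "t = 0") (auto intro!: add_nonneg_pos)
  have "ln (Gamma ((1 - t) * x + t * y)) \<le> (1 - t) * ln (Gamma x) + t * ln (Gamma y)"
    using convex_onD[OF log_convex_Gamma_real, of t x y] assms by simp
  then have "exp (ln (Gamma ((1 - t) * x + t * y))) \<le> exp ((1 - t) * ln (Gamma x) + t * ln (Gamma y))"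
    by simp
  then show ?thesis
    using assms pos less_imp_neq[OF Gamma_real_pos[of x]] less_imp_neq[OF Gamma_real_pos[of y]]
    by (simp add: powr_def exp_add)
qed

text \<open>
  This estimate and the next one are Wendel's bounds for ratios of Gamma values; both express the
  logarithmic convexity of \<open>Gamma\<close>.
\<close>

lemma Gamma_ratio_upper:
  assumes "0 \<le> g" "g \<le> 1"
  shows "Gamma (real k + 1 + g) \<le> fact k * (real k + 1) powr g"
proof -
  have "Gamma ((1 - g) * (real k + 1) + g * (real k + 2)) \<le> Gamma (real k + 1) powr (1 - g) * Gamma (real k + 2) powr g"
    using assms by (intro Gamma_log_convex_ineq) auto
  also have "Gamma (real k + 1) = fact k" using Gamma_fact[of k] by (simp add: add_ac)
  also have "Gamma (real k + 2) = (real k + 1) * fact k"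
    using Gamma_fact[of "Suc k", where 'a = real] by (simp add: add_ac)
  also have "fact k powr (1 - g) * ((real k + 1) * fact k) powr g = (fact k powr (1 - g) * fact k powr g) * (real k + 1) powr g"
    by (simp add: powr_mult)
  also have "fact k powr (1 - g) * fact k powr g = (fact k :: real)"
    by (simp add: powr_add[symmetric])
  finally show ?thesis by (simp add: algebra_simps)
qed

lemma Gamma_ratio_lower:
  assumes "0 < g" "g \<le> 1"
  shows "fact k * (real k + g) powr g \<le> Gamma (real k + 1 + g)"
proof -
  have pos: "0 < real k + g" using assms by simp
  define A where "A = Gamma (real k + g)"
  have A: "A > 0" unfolding A_def using pos by (rule Gamma_real_pos)
  have B: "Gamma (real k + g + 1) = (real k + g) * A"
    unfolding A_def using pos by (rule Gamma_plus1_pos)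
  have "Gamma ((1 - (1 - g)) * (real k + g) + (1 - g) * (real k + g + 1))
      \<le> A powr (1 - (1 - g)) * Gamma (real k + g + 1) powr (1 - g)"
    unfolding A_def using assms pos by (intro Gamma_log_convex_ineq) auto
  also have "(1 - (1 - g)) * (real k + g) + (1 - g) * (real k + g + 1) = real k + 1"
    by (simp add: algebra_simps)
  also have "Gamma (real k + 1) = fact k" using Gamma_fact[of k] by (simp add: add_ac)
  also have "A powr (1 - (1 - g)) * Gamma (real k + g + 1) powr (1 - g) = (A powr g * A powr (1 - g)) * (real k + g) powr (1 - g)"
    unfolding B using pos A by (simp add: powr_mult)
  also have "A powr g * A powr (1 - g) = A" using A by (simp add: powr_add[symmetric])
  finally have "fact k * (real k + g) powr g \<le> A * ((real k + g) powr (1 - g) * (real k + g) powr g)"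
    using mult_right_mono[of "fact k" "A * (real k + g) powr (1 - g)" "(real k + g) powr g"]
    by (simp add: mult_ac)
  also have "(real k + g) powr (1 - g) * (real k + g) powr g = real k + g"
    using pos by (simp add: powr_add[symmetric])
  finally show ?thesis using B by (simp add: algebra_simps)
qed

text \<open>
  The coefficients of \<open>(1 - z)\<^sup>-\<^sup>c\<close>, which grow like \<open>k powr (c - 1) / Gamma c\<close>.
\<close>

lemma scheme_alpha_uminus_Gamma:
  assumes "0 < c"
  shows "scheme_alpha (- c) k = Gamma (real k + c) / (Gamma c * fact k)"
proof -
  have "scheme_alpha (- c) k = pochhammer c k / fact k"
    by (simp add: scheme_alpha_def gbinomial_pochhammer power_mult_distrib[symmetric])
  also have "pochhammer c k = Gamma (c + real k) / Gamma c"
    using assms by (intro pochhammer_Gamma) (auto elim!: nonpos_Ints_cases)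
  finally show ?thesis by (simp add: add_ac)
qed

text \<open>
  The difference of two truncated powers is a value of the power of exponent \<open>g\<close> near \<open>k\<close>, and
  Wendel's bounds place \<open>Gamma (g + 1)\<close> times the coefficient of \<open>(1 - z)\<^sup>-\<^sup>g\<^sup>-\<^sup>1\<close> between
  two such powers. The discrepancy is therefore of relative size \<open>1 / k\<close>, and it is measured by the
  coefficients of \<open>(1 - z)\<^sup>-\<^sup>g\<close> because these can be summed exactly against
  \<open>scheme_alpha (g - 1)\<close>.
\<close>

lemma trunc_power_difference_approx:
  assumes g: "0 < g" "g < 1" and s: "0 \<le> s" "s \<le> 1"
  shows "\<bar>trunc_power (g + 1) (real k - s) - trunc_power (g + 1) (real k - s - 1) - scheme_alpha (- g - 1) k\<bar>
    \<le> 3 / g * scheme_alpha (- g) k"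
proof -
  obtain x where x: "real k - s - 1 < x" "x < real k - s"
    "trunc_power (g + 1) (real k - s) - trunc_power (g + 1) (real k - s - 1)
      = (real k - s - (real k - s - 1)) * trunc_power g x"
    using MVT2[of "real k - s - 1" "real k - s" "trunc_power (g + 1)" "trunc_power g"]
      trunc_power_deriv[OF g(1)] by auto
  define Gg where "Gg = Gamma (g + 1)"
  have Gg: "Gg > 0" unfolding Gg_def using g by (intro Gamma_real_pos) auto
  have Gg': "Gg = g * Gamma g" unfolding Gg_def using g by (intro Gamma_plus1_pos) auto
  define y where "y = max 0 x powr g"
  define z where "z = Gamma (real k + 1 + g) / fact k"
  have "- g - 1 = - (g + 1)" by simp
  then have a1: "scheme_alpha (- g - 1) k = z / Gg"
    using scheme_alpha_uminus_Gamma[of "g + 1" k] g by (simp only: Gg_def z_def) (simp add: add_ac)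
  have "Gamma (real k + g + 1) = (real k + g) * Gamma (real k + g)"
    using g by (intro Gamma_plus1_pos) auto
  then have a2: "scheme_alpha (- g) k = g * z / ((real k + g) * Gg)"
    using g scheme_alpha_uminus_Gamma[of g k] by (simp add: Gg' z_def add_ac)
  have z: "(real k + g) powr g \<le> z" "z \<le> (real k + 1) powr g"
    using Gamma_ratio_lower[of g k] Gamma_ratio_upper[of g k] g by (simp_all add: z_def field_simps)
  have "y \<le> (real k + g) powr g"
    unfolding y_def using x g s by (intro powr_mono2) auto
  then have yz: "y \<le> z" using z by simp
  have "z - y \<le> 3 * (real k + 1) powr (g - 1)"
  proof -
    \<comment> \<open>As \<open>w\<close> lies in \<open>[0, 1]\<close>, \<open>w powr g\<close> is at least \<open>w\<close>; for \<open>k \<le> 2\<close> both vanish.\<close>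
    define w where "w = max 0 (real k - 2) / (real k + 1)"
    have "1 - 3 / (real k + 1) = (real k - 2) / (real k + 1)" by (simp add: field_simps)
    also have "\<dots> \<le> w" unfolding w_def by (intro divide_right_mono) auto
    finally have w: "0 \<le> w" "w \<le> 1" "w \<ge> 1 - 3 / (real k + 1)" by (auto simp: w_def)
    have "w powr 1 \<le> w powr g" using w g by (intro powr_mono') auto
    then have "w \<le> w powr g" using w by simp
    then have "(real k + 1) powr g * (1 - 3 / (real k + 1)) \<le> (real k + 1) powr g * w powr g"
      using w by (intro mult_left_mono) auto
    also have "\<dots> = max 0 (real k - 2) powr g"
      using w by (simp add: powr_mult[symmetric]) (simp add: w_def)
    also have "\<dots> \<le> y" unfolding y_def using x g s by (intro powr_mono2) auto
    finally have "(real k + 1) powr g - 3 * ((real k + 1) powr g / (real k + 1)) \<le> y"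
      by (simp add: algebra_simps)
    also have "(real k + 1) powr g / (real k + 1) = (real k + 1) powr (g - 1)"
      by (simp add: powr_diff)
    finally show ?thesis using z by simp
  qed
  also have "\<dots> \<le> 3 * (real k + g) powr (g - 1)"
    using g by (intro mult_left_mono powr_mono2') auto
  also have "\<dots> = 3 * (real k + g) powr g / (real k + g)"
    using g by (simp add: powr_diff)
  also have "\<dots> \<le> 3 * z / (real k + g)"
    using z g by (intro divide_right_mono mult_left_mono) auto
  finally have zy: "z - y \<le> 3 * z / (real k + g)" .
  have "\<bar>y / Gg - z / Gg\<bar> = (z - y) / Gg" using yz Gg by (simp add: diff_divide_distrib[symmetric] abs_div_pos)
  also have "\<dots> \<le> 3 * z / (real k + g) / Gg" using zy Gg by (intro divide_right_mono) auto
  also have "\<dots> = 3 / g * scheme_alpha (- g) k" using g by (simp add: a2)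
  finally show ?thesis using x(3) by (simp add: a1 trunc_power_def y_def Gg_def)
qed

text \<open>
  For \<open>0 < g < 1\<close> the spline is the convolution of the nonnegative sequence
  \<open>scheme_alpha (g - 1)\<close> with first differences of truncated powers. Replacing these by the
  coefficients of \<open>(1 - z)\<^sup>-\<^sup>g\<^sup>-\<^sup>1\<close> gives exactly \<open>n + 1\<close>, and the error of the replacement
  is at most \<open>3 / g\<close> times a coefficient of \<open>(1 - z)\<^sup>-\<^sup>1\<close>, which is \<open>1\<close>.
\<close>

lemma spline_err_bounded_base:
  assumes g: "0 < g" "g < 1" and "0 \<le> r"
  shows "\<bar>spline_err g r\<bar> \<le> 3 / g + 3"
proof -
  define n where "n = nat \<lceil>r\<rceil>"
  \<comment> \<open>Writing \<open>r = n - s\<close> with \<open>s\<close> in \<open>[0, 1]\<close> turns all arguments into integers minus \<open>s\<close>.\<close>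
  define s where "s = real n - r"
  have s: "0 \<le> s" "s \<le> 1" and rn: "r \<le> real n" "r - 1 \<le> real n"
    using assms unfolding s_def n_def by linarith+
  define D where "D = (\<lambda>k. trunc_power (g + 1) (real k - s) - trunc_power (g + 1) (real k - s - 1))"
  have "frac_spline g (g + 1) r = frac_spline (g - 1) (g + 1) r - frac_spline (g - 1) (g + 1) (r - 1)"
    using frac_spline_plus1[of "g - 1"] by simp
  also have "\<dots> = (\<Sum>k\<le>n. scheme_alpha (g - 1) k *
      (trunc_power (g + 1) (r - real k) - trunc_power (g + 1) (r - 1 - real k)))"
    unfolding frac_spline_eq[OF rn(1)] frac_spline_eq[OF rn(2)]
    by (simp add: sum_subtractf[symmetric] right_diff_distrib)
  also have "\<dots> = (\<Sum>k\<le>n. scheme_alpha (g - 1) (n - k) * D k)"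
    by (rule sum.reindex_bij_witness[of _ "\<lambda>k. n - k" "\<lambda>k. n - k"])
       (auto simp: D_def s_def of_nat_diff algebra_simps)
  finally have F: "frac_spline g (g + 1) r = (\<Sum>k\<le>n. scheme_alpha (g - 1) (n - k) * D k)" .
  have n1: "(\<Sum>k\<le>n. scheme_alpha (g - 1) (n - k) * scheme_alpha (- g - 1) k) = real n + 1"
    using scheme_alpha_convolution[of "g - 1" n "- g - 1"] scheme_alpha_minus2 by simp
  have n2: "(\<Sum>k\<le>n. scheme_alpha (g - 1) (n - k) * scheme_alpha (- g) k) = 1"
    using scheme_alpha_convolution[of "g - 1" n "- g"] scheme_alpha_minus1 by simp
  have "\<bar>frac_spline g (g + 1) r - (real n + 1)\<bar>
      = \<bar>\<Sum>k\<le>n. scheme_alpha (g - 1) (n - k) * (D k - scheme_alpha (- g - 1) k)\<bar>"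
    unfolding F n1[symmetric] by (simp add: sum_subtractf[symmetric] right_diff_distrib)
  also have "\<dots> \<le> (\<Sum>k\<le>n. \<bar>scheme_alpha (g - 1) (n - k) * (D k - scheme_alpha (- g - 1) k)\<bar>)"
    by (rule sum_abs)
  also have "\<dots> \<le> (\<Sum>k\<le>n. scheme_alpha (g - 1) (n - k) * (3 / g * scheme_alpha (- g) k))"
  proof (rule sum_mono)
    fix k
    show "\<bar>scheme_alpha (g - 1) (n - k) * (D k - scheme_alpha (- g - 1) k)\<bar>
      \<le> scheme_alpha (g - 1) (n - k) * (3 / g * scheme_alpha (- g) k)"
    proof -
      have "0 \<le> scheme_alpha (g - 1) (n - k)" using g by (intro scheme_alpha_nonneg) auto
      moreover have "\<bar>D k - scheme_alpha (- g - 1) k\<bar> \<le> 3 / g * scheme_alpha (- g) k"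
        unfolding D_def by (rule trunc_power_difference_approx[OF g s])
      ultimately show ?thesis unfolding abs_mult by (simp only: abs_of_nonneg mult_left_mono)
    qed
  qed
  also have "\<dots> = 3 / g * (\<Sum>k\<le>n. scheme_alpha (g - 1) (n - k) * scheme_alpha (- g) k)"
    by (simp add: sum_distrib_left mult_ac)
  finally have "\<bar>frac_spline g (g + 1) r - (real n + 1)\<bar> \<le> 3 / g" by (simp add: n2)
  then show ?thesis using s g unfolding spline_err_def s_def by linarith
qed

lemma spline_err_bounded_step:
  assumes "0 < c" "\<And>r. R \<le> r \<Longrightarrow> \<bar>spline_err c r\<bar> \<le> M" "R + 1 \<le> r"
  shows "\<bar>spline_err (c + 1) r\<bar> \<le> M"
proof -
  obtain x where "r - 1 < x" "spline_err (c + 1) r = spline_err c x"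
    using spline_err_mean_value[OF assms(1)] by blast
  then show ?thesis using assms(2)[of x] assms(3) by simp
qed

lemma inverse_power_telescope:
  fixes r :: real
  assumes "1 < r" "0 < q"
  shows "1 / r ^ (q + 1) \<le> 1 / (r - 1) ^ q - 1 / r ^ q"
proof -
  have "1 + 1 / r \<le> r / (r - 1)" using assms by (simp add: field_simps)
  also have "\<dots> \<le> (r / (r - 1)) ^ q" using assms by (intro self_le_power) (auto simp: field_simps)
  finally have "(1 + 1 / r) / r ^ q \<le> (r / (r - 1)) ^ q / r ^ q"
    using assms by (intro divide_right_mono) auto
  also have "\<dots> = 1 / (r - 1) ^ q" using assms by (simp add: power_divide)
  finally show ?thesis using assms by (simp add: field_simps)
qed

text \<open>
  Averaging over a unit interval gains a factor \<open>1 / r\<close>. Write \<open>J\<close> for the error with index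
  \<open>c + 1\<close>. Its derivative is \<open>O(1 / r ^ (p + 1))\<close> by the recurrence for \<open>c\<close>, so the error with
  index \<open>c + 2\<close>, a mean of \<open>J\<close>, differs from \<open>J (r - 1)\<close> by that order. Inserted in the
  recurrence for \<open>c + 1\<close> this gives \<open>r * J r = (r + 1) * J (r - 1) + O(1 / r ^ (p + 1))\<close>. Hence
  the increments of \<open>J r / (r + 1)\<close> are summable, and as this quotient tends to \<open>0\<close>, it is bounded
  by the tail of the sum of its increments.
\<close>

lemma spline_err_gain:
  assumes c: "0 < c" and R: "1 \<le> R"
    and M: "\<And>r. R \<le> r \<Longrightarrow> \<bar>spline_err c r\<bar> \<le> M / r ^ p"
  shows "\<exists>C. \<forall>r\<ge>R + 4. \<bar>spline_err (c + 1) r\<bar> \<le> C / r ^ (p + 1)"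
proof -
  define J where "J = spline_err (c + 1)"
  have M0: "0 \<le> M"
    using M[of R] R by (smt (verit) divide_neg_pos zero_less_power)
  have J: "\<bar>J r\<bar> \<le> M / (r - 1) ^ p" if "R + 1 \<le> r" for r
  proof -
    obtain x where x: "r - 1 < x" "x < r" "J r = spline_err c x"
      unfolding J_def using spline_err_mean_value[OF c] by blast
    then have "\<bar>J r\<bar> \<le> M / x ^ p" using M[of x] that by simp
    also have "\<dots> \<le> M / (r - 1) ^ p"
      using x that R M0 by (intro divide_left_mono power_mono mult_pos_pos) auto
    finally show ?thesis .
  qed
  have J': "\<bar>spline_err c x - spline_err c (x - 1)\<bar> \<le> (2 * c + 3) * M / (x - 1) ^ (p + 1)"
    if x: "R + 1 \<le> x" for x
  proof -
    have "x * (spline_err c x - spline_err c (x - 1)) = - (1 + c) * spline_err c (x - 1) + (c + 2) * J x"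
      using spline_err_recurrence[OF c, of x] unfolding J_def by (simp add: algebra_simps)
    moreover have "x * \<bar>spline_err c x - spline_err c (x - 1)\<bar> = \<bar>x * (spline_err c x - spline_err c (x - 1))\<bar>"
      using x R by (simp add: abs_mult)
    ultimately have "x * \<bar>spline_err c x - spline_err c (x - 1)\<bar> = \<bar>- (1 + c) * spline_err c (x - 1) + (c + 2) * J x\<bar>"
      by (simp only:)
    also have "\<dots> \<le> (1 + c) * \<bar>spline_err c (x - 1)\<bar> + (c + 2) * \<bar>J x\<bar>"
      using c abs_triangle_ineq[of "- (1 + c) * spline_err c (x - 1)" "(c + 2) * J x"]
      by (simp add: abs_mult add.commute)
    also have "\<dots> \<le> (1 + c) * (M / (x - 1) ^ p) + (c + 2) * (M / (x - 1) ^ p)"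
      using c M[of "x - 1"] J[OF x] x by (intro add_mono mult_left_mono) auto
    also have "\<dots> = (2 * c + 3) * M / (x - 1) ^ p" by (simp add: algebra_simps add_divide_distrib)
    finally have "\<bar>spline_err c x - spline_err c (x - 1)\<bar> \<le> (2 * c + 3) * M / (x - 1) ^ p / x"
      using x R by (simp add: field_simps)
    also have "\<dots> \<le> (2 * c + 3) * M / (x - 1) ^ p / (x - 1)"
      using x R M0 c by (intro divide_left_mono divide_nonneg_pos mult_nonneg_nonneg mult_pos_pos) auto
    finally show ?thesis by (simp add: mult_ac)
  qed
  \<comment> \<open>The power of two converts \<open>r - 2\<close> into \<open>r\<close>: \<open>r - 2 \<ge> r / 2\<close> as \<open>r \<ge> 4\<close>.\<close>
  define K where "K = (c + 3) * (2 * c + 3) * M * 2 ^ (p + 1)"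
  have K0: "0 \<le> K" using c M0 by (simp add: K_def)
  have step: "\<bar>J r / (r + 1) - J (r - 1) / r\<bar> \<le> K * (1 / (r - 1) ^ (p + 2) - 1 / r ^ (p + 2))"
    if r: "R + 4 \<le> r" for r
  proof -
    obtain x where x: "r - 1 < x" "x < r" "spline_err (c + 1 + 1) r = J x"
      unfolding J_def using spline_err_mean_value[of "c + 1" r] c by auto
    obtain y where y: "r - 1 < y" "y < x" "J x - J (r - 1) = (x - (r - 1)) * (spline_err c y - spline_err c (y - 1))"
      using MVT2[of "r - 1" x J "\<lambda>y. spline_err c y - spline_err c (y - 1)"] x spline_err_deriv[OF c]
      unfolding J_def by auto
    have "\<bar>J x - J (r - 1)\<bar> \<le> 1 * \<bar>spline_err c y - spline_err c (y - 1)\<bar>"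
      unfolding y(3) abs_mult using x by (intro mult_right_mono) auto
    also have "\<dots> \<le> (2 * c + 3) * M / (y - 1) ^ (p + 1)" using J'[of y] y r by simp
    also have "\<dots> \<le> (2 * c + 3) * M / (r / 2) ^ (p + 1)"
      using y r R c M0 by (intro divide_left_mono power_mono mult_pos_pos) auto
    finally have e: "\<bar>J x - J (r - 1)\<bar> \<le> (2 * c + 3) * M * 2 ^ (p + 1) / r ^ (p + 1)"
      by (simp add: power_divide)
    have "r * J r = (r - 2 - c) * J (r - 1) + (c + 3) * J x"
      using spline_err_recurrence[of "c + 1" r] c x(3) by (simp add: J_def algebra_simps)
    then have "r * J r - (r + 1) * J (r - 1) = (c + 3) * (J x - J (r - 1))"
      by (simp add: algebra_simps)
    then have "\<bar>r * J r - (r + 1) * J (r - 1)\<bar> \<le> K / r ^ (p + 1)"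
      using e c mult_left_mono[OF e, of "c + 3"] by (simp add: abs_mult K_def mult_ac)
    then have "\<bar>r * J r - (r + 1) * J (r - 1)\<bar> / (r * (r + 1)) \<le> K / r ^ (p + 1) / (r * (r + 1))"
      using r R by (intro divide_right_mono) auto
    also have "\<dots> \<le> K / r ^ (p + 1) / (r * r)"
      using r R K0 by (intro divide_left_mono mult_left_mono) auto
    also have "\<dots> = K * (1 / r ^ (p + 2 + 1))" by (simp add: power_add)
    also have "\<dots> \<le> K * (1 / (r - 1) ^ (p + 2) - 1 / r ^ (p + 2))"
      using r R K0 by (intro mult_left_mono inverse_power_telescope) auto
    also have "\<bar>r * J r - (r + 1) * J (r - 1)\<bar> / (r * (r + 1)) = \<bar>J r / (r + 1) - J (r - 1) / r\<bar>"
    proof -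
      have "J r / (r + 1) - J (r - 1) / r = (r * J r - (r + 1) * J (r - 1)) / (r * (r + 1))"
        using r R by (simp add: field_simps)
      moreover have "0 < r * (r + 1)" using r R by (intro mult_pos_pos) auto
      ultimately show ?thesis by simp
    qed
    finally show ?thesis .
  qed
  have "\<bar>J r\<bar> \<le> 2 * K / r ^ (p + 1)" if r: "R + 4 \<le> r" for r
  proof -
    have tele: "\<bar>J (r + real n) / (r + real n + 1) - J r / (r + 1)\<bar> \<le> K * (1 / r ^ (p + 2) - 1 / (r + real n) ^ (p + 2))" for n
    proof (induction n)
      case (Suc n)
      have "\<bar>J (r + real (Suc n)) / (r + real (Suc n) + 1) - J (r + real n) / (r + real n + 1)\<bar>
          \<le> K * (1 / (r + real n) ^ (p + 2) - 1 / (r + real (Suc n)) ^ (p + 2))"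
        using step[of "r + real (Suc n)"] r by (simp add: algebra_simps)
      with Suc show ?case by (simp add: algebra_simps)
    qed simp
    have bd: "\<bar>J r / (r + 1)\<bar> \<le> K / r ^ (p + 2) + M / (real n + 1)" for n
    proof -
      have "K * (1 / r ^ (p + 2) - 1 / (r + real n) ^ (p + 2)) \<le> K / r ^ (p + 2)"
        using K0 r R by (simp add: right_diff_distrib)
      moreover have "\<bar>J (r + real n) / (r + real n + 1)\<bar> \<le> M / (real n + 1)"
      proof -
        have "\<bar>J (r + real n)\<bar> \<le> M / (r + real n - 1) ^ p" using J[of "r + real n"] r by simp
        also have "\<dots> \<le> M / 1" using r R M0 by (intro divide_left_mono) auto
        finally have "\<bar>J (r + real n)\<bar> / (r + real n + 1) \<le> M / (r + real n + 1)"
          using r R by (intro divide_right_mono) auto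
        also have "\<dots> \<le> M / (real n + 1)" using r R M0 by (intro divide_left_mono) auto
        finally show ?thesis using r R by simp
      qed
      ultimately show ?thesis using tele[of n] by linarith
    qed
    have "(\<lambda>n. K / r ^ (p + 2) + M / (real n + 1)) \<longlonglongrightarrow> K / r ^ (p + 2) + 0"
      by (intro tendsto_add tendsto_const) real_asymp
    then have "\<bar>J r / (r + 1)\<bar> \<le> K / r ^ (p + 2)"
      using bd by (intro LIMSEQ_le_const) auto
    then have "\<bar>J r\<bar> \<le> (r + 1) * (K / r ^ (p + 2))"
      using r R by (simp add: pos_divide_le_eq mult.commute)
    also have "\<dots> \<le> (2 * r) * (K / r ^ (p + 2))" using r R K0 by (intro mult_right_mono) auto
    also have "\<dots> = 2 * K / r ^ (p + 1)" using r R by simp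
    finally show ?thesis .
  qed
  then show ?thesis unfolding J_def by blast
qed

text \<open>
  In the recurrence the previous value carries the factor \<open>(r - 1 - c) / r\<close>, which alone would give
  decay of order \<open>1 + c > 2\<close>. A source term of order \<open>q \<le> 2\<close> is therefore passed on unchanged, by
  induction over unit steps.
\<close>

lemma spline_err_decay_from_next:
  assumes c: "1 < c" and q: "q = 1 \<or> q = 2" and R: "c + 2 \<le> R"
    and M: "\<And>r. R \<le> r \<Longrightarrow> \<bar>spline_err c r\<bar> \<le> M"
    and C: "\<And>r. R \<le> r \<Longrightarrow> \<bar>spline_err (c + 1) r\<bar> \<le> C / r ^ q"
  shows "\<exists>K. \<forall>r\<ge>R. \<bar>spline_err c r\<bar> \<le> K / r ^ q"
proof -
  have M0: "0 \<le> M" using M[of R] by simp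
  \<comment> \<open>The first entry covers the starting interval \<open>[R, R + 1]\<close>, the second absorbs the source term.\<close>
  define K where "K = max (M * (R + 1) ^ q) ((c + 2) * C / (c - 1))"
  have K0: "0 \<le> K" unfolding K_def using M0 R c by (simp add: le_max_iff_disj)
  have KC: "(c + 2) * C \<le> K * (c - 1)"
  proof -
    have "(c + 2) * C / (c - 1) \<le> K" by (simp add: K_def)
    then show ?thesis using c by (simp add: pos_divide_le_eq)
  qed
  \<comment> \<open>The margin \<open>c - 1\<close> is the excess of the damping order \<open>1 + c\<close> over \<open>q = 2\<close>.\<close>
  have key: "(r - 1 - c) / (r * (r - 1) ^ q) + (c - 1) / r ^ (q + 1) \<le> 1 / r ^ q" if r: "R \<le> r" for r
  proof -
    have r0: "r > 1" using r R c by simp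
    from q show ?thesis
    proof
      assume "q = 1"
      have "(c - 1) / r\<^sup>2 \<le> c / (r * (r - 1))"
        using r0 c by (intro frac_le) (auto simp: power2_eq_square)
      also have "\<dots> = 1 / r - (r - 1 - c) / (r * (r - 1))"
        using r0 by (simp add: field_simps)
      finally show ?thesis using \<open>q = 1\<close> by (simp add: power2_eq_square)
    next
      assume "q = 2"
      have "(c - 1) / r ^ 3 \<le> ((c - 1) * r) / (r\<^sup>2 * (r - 1)\<^sup>2)"
      proof -
        have "(c - 1) / r ^ 3 = ((c - 1) * r) / (r\<^sup>2 * r\<^sup>2)"
          using r0 by (simp add: power2_eq_square power3_eq_cube)
        also have "\<dots> \<le> ((c - 1) * r) / (r\<^sup>2 * (r - 1)\<^sup>2)"
          using r0 c by (intro divide_left_mono mult_left_mono power_mono) auto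
        finally show ?thesis .
      qed
      also have "\<dots> \<le> ((c - 1) * r + 1) / (r\<^sup>2 * (r - 1)\<^sup>2)"
        by (intro divide_right_mono) auto
      also have "\<dots> = 1 / r\<^sup>2 - (r - 1 - c) / (r * (r - 1)\<^sup>2)"
        using r0 by (simp add: divide_simps) (simp add: power2_eq_square algebra_simps)
      finally show ?thesis using \<open>q = 2\<close> by simp
    qed
  qed
  have main: "R + real n \<le> r \<Longrightarrow> r \<le> R + real n + 1 \<Longrightarrow> \<bar>spline_err c r\<bar> \<le> K / r ^ q" for n r
  proof (induction n arbitrary: r)
    case 0
    then have r: "R \<le> r" "r \<le> R + 1" by auto
    have "M * r ^ q \<le> M * (R + 1) ^ q"
      using r R c M0 by (intro mult_left_mono power_mono) auto
    also have "\<dots> \<le> K" by (simp add: K_def)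
    finally have "M \<le> K / r ^ q" using r R c by (simp add: field_simps)
    then show ?case using M[OF r(1)] by simp
  next
    case (Suc n)
    then have r: "R + 1 \<le> r" by simp
    then have r0: "r > c + 2" using R by simp
    have IH: "\<bar>spline_err c (r - 1)\<bar> \<le> K / (r - 1) ^ q" using Suc by simp
    have "r * \<bar>spline_err c r\<bar> = \<bar>r * spline_err c r\<bar>"
      using c r0 by (simp add: abs_mult)
    also have "r * spline_err c r = (r - 1 - c) * spline_err c (r - 1) + (c + 2) * spline_err (c + 1) r"
      using c by (intro spline_err_recurrence) simp
    also have "\<bar>(r - 1 - c) * spline_err c (r - 1) + (c + 2) * spline_err (c + 1) r\<bar>
        \<le> (r - 1 - c) * \<bar>spline_err c (r - 1)\<bar> + (c + 2) * \<bar>spline_err (c + 1) r\<bar>"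
      using c r0 abs_triangle_ineq[of "(r - 1 - c) * spline_err c (r - 1)" "(c + 2) * spline_err (c + 1) r"]
      by (simp add: abs_mult)
    also have "\<dots> \<le> (r - 1 - c) * (K / (r - 1) ^ q) + (c + 2) * (C / r ^ q)"
      using c r0 IH C[of r] r by (intro add_mono mult_left_mono) auto
    also have "\<dots> = (r - 1 - c) * (K / (r - 1) ^ q) + ((c + 2) * C) / r ^ q" by simp
    also have "\<dots> \<le> (r - 1 - c) * (K / (r - 1) ^ q) + (K * (c - 1)) / r ^ q"
      using KC c r0 by (intro add_left_mono divide_right_mono) auto
    also have "\<dots> = r * K * ((r - 1 - c) / (r * (r - 1) ^ q) + (c - 1) / r ^ (q + 1))"
      using r0 c by (simp add: field_simps)
    also have "\<dots> \<le> r * K * (1 / r ^ q)"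
      using key[of r] r r0 K0 c by (intro mult_left_mono) auto
    finally have "r * \<bar>spline_err c r\<bar> \<le> r * (K / r ^ q)" by simp
    then show ?case using r0 c by (simp only: mult_le_cancel_left_pos)
  qed
  have "\<bar>spline_err c r\<bar> \<le> K / r ^ q" if "R \<le> r" for r
    using main[of "nat \<lfloor>r - R\<rfloor>" r] that by linarith
  then show ?thesis by blast
qed

text \<open>
  Two rounds of the preceding lemmas, starting from boundedness. A third round would fail, since the
  recurrence damps only with order \<open>1 + c < 3\<close>.
\<close>

lemma spline_err_quadratic_decay:
  assumes c: "1 < c" "c < 2"
  obtains K R where "1 \<le> R" "\<And>r. R \<le> r \<Longrightarrow> \<bar>spline_err c r\<bar> \<le> K / r\<^sup>2"
proof -
  define M where "M = 3 / (c - 1) + 3"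
  have M: "\<bar>spline_err c r\<bar> \<le> M" if "1 \<le> r" for r
    using spline_err_bounded_step[of "c - 1" 0 M r] spline_err_bounded_base[of "c - 1"] c that
    by (simp add: M_def)
  obtain C1 where C1: "\<And>r. 5 \<le> r \<Longrightarrow> \<bar>spline_err (c + 1) r\<bar> \<le> C1 / r ^ 1"
    using spline_err_gain[of c 1 M 0] M c by auto
  obtain K1 where K1: "\<And>r. 5 \<le> r \<Longrightarrow> \<bar>spline_err c r\<bar> \<le> K1 / r ^ 1"
    using spline_err_decay_from_next[of c 1 5 M C1] M C1 c by auto
  obtain C2 where C2: "\<And>r. 9 \<le> r \<Longrightarrow> \<bar>spline_err (c + 1) r\<bar> \<le> C2 / r ^ 2"
    using spline_err_gain[of c 5 K1 1] K1 c by (auto simp: numeral_2_eq_2)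
  obtain K2 where "\<And>r. 9 \<le> r \<Longrightarrow> \<bar>spline_err c r\<bar> \<le> K2 / r ^ 2"
    using spline_err_decay_from_next[of c 2 9 M C2] M C2 c by auto
  then show ?thesis using that[of 9 K2] by simp
qed

lemma spline_err_decay:
  assumes c: "1 < c" "c < 2"
  shows "\<exists>K. \<forall>r\<ge>0. \<bar>spline_err c r\<bar> \<le> K * (1 + r) powr (- c)"
proof -
  obtain K R where KR: "1 \<le> R" "\<And>r. R \<le> r \<Longrightarrow> \<bar>spline_err c r\<bar> \<le> K / r\<^sup>2"
    using spline_err_quadratic_decay[OF c] by blast
  have K0: "0 \<le> K" using KR(2)[of R] KR(1) by (smt (verit) divide_neg_pos zero_less_power)
  have "continuous_on {0..R} (spline_err (c - 1 + 1))"
    using spline_err_deriv[of "c - 1"] c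
    by (intro continuous_at_imp_continuous_on ballI DERIV_isCont) auto
  then have "bounded (spline_err c ` {0..R})"
    by (intro compact_imp_bounded compact_continuous_image) auto
  then obtain B where "\<forall>r\<in>{0..R}. \<bar>spline_err c r\<bar> \<le> B"
    unfolding bounded_iff by auto
  then have B: "\<bar>spline_err c r\<bar> \<le> B" if "0 \<le> r" "r \<le> R" for r
    using that by simp
  have B0: "0 \<le> B" using B[of 0] KR by simp
  define L where "L = max (B * (1 + R) powr c) (4 * K)"
  have "\<bar>spline_err c r\<bar> \<le> L * (1 + r) powr (- c)" if r: "0 \<le> r" for r
  proof (cases "r \<le> R")
    case True
    have "B = B * (1 + r) powr c * (1 + r) powr (- c)"
      using r by (simp add: powr_minus)
    also have "\<dots> \<le> L * (1 + r) powr (- c)"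
    proof (rule mult_right_mono)
      have "B * (1 + r) powr c \<le> B * (1 + R) powr c"
        using True r c B0 by (intro mult_left_mono powr_mono2) auto
      then show "B * (1 + r) powr c \<le> L" by (simp add: L_def)
    qed simp
    finally show ?thesis using B[OF r True] by simp
  next
    case False
    then have rR: "R \<le> r" "1 \<le> r" using KR by auto
    have "\<bar>spline_err c r\<bar> \<le> K / r\<^sup>2" using KR rR by simp
    also have "\<dots> \<le> K / ((1 + r) / 2)\<^sup>2"
      using rR K0 by (intro divide_left_mono power_mono) auto
    also have "\<dots> = 4 * K * (1 + r) powr (- 2)"
      using rR by (simp add: power_divide powr_minus field_simps)
    also have "\<dots> \<le> L * (1 + r) powr (- c)"
      using rR c K0 by (intro mult_mono powr_mono) (auto simp: L_def)
    finally show ?thesis .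
  qed
  then show ?thesis by blast
qed


section \<open>The spline of the trapezoidal weights\<close>

definition trapezoid_spline :: "real \<Rightarrow> real \<Rightarrow> real" where
  "trapezoid_spline c r = (\<Sum>k\<le>nat \<lceil>r\<rceil>. scheme_theta c k * max 0 (r - real k))"

lemma trapezoid_spline_eq:
  assumes "r \<le> real N"
  shows "trapezoid_spline c r = (\<Sum>k\<le>N. scheme_theta c k * max 0 (r - real k))"
  unfolding trapezoid_spline_def
proof (rule sum.mono_neutral_left)
  show "{..nat \<lceil>r\<rceil>} \<subseteq> {..N}" using assms by (auto simp: nat_le_iff ceiling_le_iff)
  show "\<forall>k\<in>{..N} - {..nat \<lceil>r\<rceil>}. scheme_theta c k * max 0 (r - real k) = 0"
  proof
    fix k assume "k \<in> {..N} - {..nat \<lceil>r\<rceil>}"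
    then have "nat \<lceil>r\<rceil> < k" by simp
    then have "r - real k \<le> 0" by linarith
    then show "scheme_theta c k * max 0 (r - real k) = 0" by simp
  qed
qed simp

lemma scheme_theta_eq: "scheme_theta c k = 2 powr (- c) * (c gchoose k)"
  by (simp add: scheme_theta_def scheme_alpha_def power_mult_distrib[symmetric])

text \<open>
  If the sums defining the spline ran over all \<open>k\<close>, the value would be exactly \<open>r - c / 2\<close>: the
  weights sum to \<open>1\<close> and their first moment is \<open>c / 2\<close>. Both tails are remainders of
  binomial series, for the exponents \<open>c\<close> and \<open>c - 1\<close>, and the coefficients of the latter decay like
  \<open>n powr (- c)\<close>.
\<close>

lemma trapezoid_spline_approx:
  assumes c: "1 < c" "c < 2"
  shows "\<exists>K. \<forall>r\<ge>0. \<bar>trapezoid_spline c r - r + c / 2\<bar> \<le> K * (1 + r) powr (- c)"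
proof -
  define K where "K = max (2 * 2 powr c) (4 * 3 powr c)"
  have "\<bar>trapezoid_spline c r - r + c / 2\<bar> \<le> K * (1 + r) powr (- c)" if r: "0 \<le> r" for r
  \<comment> \<open>The remainder estimate for the exponent \<open>c\<close> needs at least two terms, as \<open>c > 1\<close>; hence the case \<open>r < 1\<close>.\<close>
  proof (cases "r < 1")
    case True
    have "trapezoid_spline c r = 2 powr (- c) * r"
      using True r by (subst trapezoid_spline_eq[of r 1]) (auto simp: scheme_theta_eq)
    moreover have "2 powr (- c) * r \<le> 1 * 1"
      using True r c by (intro mult_mono) (auto simp: powr_minus inverse_le_1_iff ge_one_powr_ge_zero)
    moreover have "0 \<le> 2 powr (- c) * r" using r by simp
    ultimately have "\<bar>trapezoid_spline c r - r + c / 2\<bar> \<le> 2" using True r c by linarith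
    also have "\<dots> = 2 * 2 powr c * 2 powr (- c)" by (simp add: powr_minus)
    also have "\<dots> \<le> K * (1 + r) powr (- c)"
      using True r c by (intro mult_mono powr_mono2') (auto simp: K_def le_max_iff_disj)
    finally show ?thesis .
  next
    case False
    define n where "n = nat \<lfloor>r\<rfloor>"
    have n: "1 \<le> n" "real n \<le> r" "r \<le> real (Suc n)" using False unfolding n_def by linarith+
    define b where "b = 2 powr (- c)"
    have b: "0 < b" "b \<le> 1" using c by (auto simp: b_def powr_minus inverse_le_1_iff ge_one_powr_ge_zero)
    have bc: "b * 2 powr c = 1" "b * (c * 2 powr (c - 1)) = c / 2"
      by (auto simp: b_def powr_minus powr_diff)
    define S0 where "S0 = (\<Sum>k<Suc n. c gchoose k)"
    define S1 where "S1 = (\<Sum>k<n. (c - 1) gchoose k)"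
    have "trapezoid_spline c r = (\<Sum>k<Suc n. scheme_theta c k * (r - real k))"
    proof -
      have "trapezoid_spline c r = (\<Sum>k\<le>n. scheme_theta c k * max 0 (r - real k))"
        using n by (subst trapezoid_spline_eq[of r "Suc n"]) auto
      also have "\<dots> = (\<Sum>k\<le>n. scheme_theta c k * (r - real k))"
        using n by (intro sum.cong) auto
      finally show ?thesis by (simp add: lessThan_Suc_atMost)
    qed
    also have "\<dots> = b * (r * S0) - b * (\<Sum>k<Suc n. real k * (c gchoose k))"
      unfolding S0_def scheme_theta_eq b_def[symmetric]
      by (simp only: sum_distrib_left sum_subtractf[symmetric]) (simp add: algebra_simps)
    also have "(\<Sum>k<Suc n. real k * (c gchoose k)) = c * S1"
      unfolding sum.lessThan_Suc_shift S1_def sum_distrib_left gbinomial_absorption by simp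
    finally have trap: "trapezoid_spline c r = b * (r * S0) - b * (c * S1)" .
    have Q: "trapezoid_spline c r - r + c / 2
        = - (b * (r * (2 powr c - S0))) + b * (c * (2 powr (c - 1) - S1))"
    proof -
      have "b * (r * 2 powr c) = r" using bc(1) by (metis mult.left_commute mult.right_neutral)
      moreover have "- (b * (r * (2 powr c - S0))) + b * (c * (2 powr (c - 1) - S1))
          = - (b * (r * 2 powr c)) + b * (r * S0) + b * (c * 2 powr (c - 1)) - b * (c * S1)"
        by (simp only: right_diff_distrib)
      ultimately show ?thesis using bc(2) trap by linarith
    qed
    define d where "d = \<bar>(c - 1) gchoose n\<bar>"
    have e0: "real (Suc n) * \<bar>2 powr c - S0\<bar> \<le> c * d"
    proof -
      have "real (Suc n) * \<bar>2 powr c - S0\<bar> \<le> real (Suc n) * \<bar>c gchoose Suc n\<bar>"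
        unfolding S0_def using n c by (intro mult_left_mono binomial_sum_remainder) auto
      also have "\<dots> = \<bar>real (Suc n) * (c gchoose Suc n)\<bar>" by (simp add: abs_mult)
      also have "\<dots> = c * d" unfolding gbinomial_absorption d_def using c by (simp add: abs_mult)
      finally show ?thesis .
    qed
    have e1: "\<bar>2 powr (c - 1) - S1\<bar> \<le> d"
      unfolding S1_def d_def using n c by (intro binomial_sum_remainder) auto
    have "r * \<bar>2 powr c - S0\<bar> \<le> real (Suc n) * \<bar>2 powr c - S0\<bar>"
      using n by (intro mult_right_mono) auto
    with e0 have e0': "\<bar>r * (2 powr c - S0)\<bar> \<le> c * d" using r by (simp add: abs_mult)
    have e1': "\<bar>c * (2 powr (c - 1) - S1)\<bar> \<le> c * d" using e1 c by (simp add: abs_mult)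
    have "\<bar>trapezoid_spline c r - r + c / 2\<bar> = b * \<bar>c * (2 powr (c - 1) - S1) - r * (2 powr c - S0)\<bar>"
    proof -
      have "trapezoid_spline c r - r + c / 2 = b * (c * (2 powr (c - 1) - S1) - r * (2 powr c - S0))"
        unfolding Q by (simp only: right_diff_distrib)
      then show ?thesis using b by (simp only: abs_mult)
    qed
    also have "\<dots> \<le> 1 * (c * d + c * d)"
      using b e0' e1' by (intro mult_mono) auto
    also have "\<dots> \<le> 4 * d" using c by (simp add: d_def mult_right_mono)
    also have "d \<le> real n powr (- c)"
      using gchoose_decay[of "c - 1" "n - 1"] c n by (simp add: d_def)
    also have "\<dots> \<le> ((1 + r) / 3) powr (- c)"
      using n c r by (intro powr_mono2') auto
    also have "\<dots> = 3 powr c * (1 + r) powr (- c)"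
      using r by (simp add: powr_divide powr_minus field_simps)
    finally have "\<bar>trapezoid_spline c r - r + c / 2\<bar> \<le> (4 * 3 powr c) * (1 + r) powr (- c)" by simp
    also have "\<dots> \<le> K * (1 + r) powr (- c)"
      by (intro mult_right_mono) (auto simp: K_def)
    finally show ?thesis .
  qed
  then show ?thesis by blast
qed

text \<open>
  Both splines share the asymptote \<open>r - c / 2\<close>. This coincidence is the second order of the scheme:
  \<open>((1 - e\<^sup>-\<^sup>s) / s)\<^sup>c\<close> and \<open>((1 + e\<^sup>-\<^sup>s) / 2)\<^sup>c\<close> agree at \<open>s = 0\<close> up to
  terms in \<open>s\<^sup>2\<close>. As \<open>c > 1\<close>, the bound is integrable over \<open>[0, \<infinity>)\<close>.
\<close>

lemma spline_kernel_decay: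
  assumes c: "1 < c" "c < 2"
  shows "\<exists>K. \<forall>r\<ge>0. \<bar>frac_spline c (c + 1) r - trapezoid_spline c r\<bar> \<le> K * (1 + r) powr (- c)"
proof -
  obtain K1 where K1: "\<forall>r\<ge>0. \<bar>spline_err c r\<bar> \<le> K1 * (1 + r) powr (- c)"
    using spline_err_decay[OF c] by blast
  obtain K2 where K2: "\<forall>r\<ge>0. \<bar>trapezoid_spline c r - r + c / 2\<bar> \<le> K2 * (1 + r) powr (- c)"
    using trapezoid_spline_approx[OF c] by blast
  have "\<bar>frac_spline c (c + 1) r - trapezoid_spline c r\<bar> \<le> (K1 + K2) * (1 + r) powr (- c)" if "0 \<le> r" for r
  proof -
    have "\<bar>frac_spline c (c + 1) r - trapezoid_spline c r\<bar> \<le> \<bar>spline_err c r\<bar> + \<bar>trapezoid_spline c r - r + c / 2\<bar>"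
      unfolding spline_err_def by linarith
    also have "\<dots> \<le> K1 * (1 + r) powr (- c) + K2 * (1 + r) powr (- c)"
      using K1 K2 that by (intro add_mono) auto
    finally show ?thesis by (simp add: distrib_right)
  qed
  then show ?thesis by blast
qed


section \<open>Fractional integrals\<close>

text \<open>
  Euler's Beta integral moved from \<open>[0, 1]\<close> to \<open>[u, t]\<close>.
\<close>

lemma kernel_product_has_integral:
  fixes p q u t :: real
  assumes "0 < p" "0 < q" "u < t"
  shows "((\<lambda>s. (t - s) powr (p - 1) * (s - u) powr (q - 1)) has_integral
           Beta p q * (t - u) powr (p + q - 1)) {u..t}"
proof -
  define L where "L = t - u"
  have L: "0 < L" using assms by (simp add: L_def)
  have beta: "((\<lambda>x. x powr (q - 1) * (1 - x) powr (p - 1)) has_integral Beta q p) (cbox 0 1)"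
    using has_integral_Beta_real[OF assms(2,1)] by simp
  have "((\<lambda>s. (1 / L * s + (- u / L)) powr (q - 1) * (1 - (1 / L * s + (- u / L))) powr (p - 1))
      has_integral (1 / \<bar>1 / L\<bar>) *\<^sub>R Beta q p) ((\<lambda>x. (1 / (1 / L)) *\<^sub>R x + - ((1 / (1 / L)) *\<^sub>R (- u / L))) ` cbox 0 1)"
    using has_integral_affinity[OF beta, of "1 / L" "- u / L"] L by simp
  moreover have "(\<lambda>x. (1 / (1 / L)) *\<^sub>R x + - ((1 / (1 / L)) *\<^sub>R (- u / L))) ` cbox 0 1 = {u..t}"
  proof -
    have "(\<lambda>x. (1 / (1 / L)) *\<^sub>R x + - ((1 / (1 / L)) *\<^sub>R (- u / L))) = (\<lambda>x. L * x + u)"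
      using L by (auto simp: field_simps)
    then show ?thesis using L by (simp add: image_affinity_atLeastAtMost L_def)
  qed
  ultimately have "((\<lambda>s. (1 / L * s + (- u / L)) powr (q - 1) * (1 - (1 / L * s + (- u / L))) powr (p - 1))
      has_integral L * Beta q p) {u..t}" using L by simp
  then have "((\<lambda>s. L powr (p + q - 2) * ((1 / L * s + (- u / L)) powr (q - 1) * (1 - (1 / L * s + (- u / L))) powr (p - 1)))
      has_integral L powr (p + q - 2) * (L * Beta q p)) {u..t}"
    by (rule has_integral_mult_right)
  note scaled = this
  have "L powr (p + q - 2) * (L * Beta q p) = Beta p q * (t - u) powr (p + q - 1)"
  proof -
    have "L powr (p + q - 2) * L = L powr (p + q - 1)"
      using L powr_add[of L "p + q - 2" 1] by simp
    then show ?thesis by (simp add: Beta_commute L_def)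
  qed
  note scaled = scaled[unfolded this]
  have "L powr (p + q - 2) * ((1 / L * s + (- u / L)) powr (q - 1) * (1 - (1 / L * s + (- u / L))) powr (p - 1))
     = (t - s) powr (p - 1) * (s - u) powr (q - 1)" if "s \<in> {u..t}" for s
  proof -
    have e1: "1 / L * s + (- u / L) = (s - u) / L" using L by (simp add: field_simps)
    have e2: "1 - (s - u) / L = (t - s) / L" using L by (simp add: L_def field_simps)
    have "L powr (p + q - 2) = L powr (q - 1) * L powr (p - 1)"
      by (simp add: powr_add[symmetric] add.commute)
    then show ?thesis unfolding e1 e2 using that L by (simp add: powr_divide)
  qed
  then show ?thesis by (rule has_integral_eq[OF _ scaled])
qed

lemma kernel_has_integral:
  fixes p t :: real
  assumes "0 < p" "0 \<le> t"
  shows "((\<lambda>s. (t - s) powr (p - 1)) has_integral t powr p / p) {0..t}"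
proof (cases "t = 0")
  case False
  then have "((\<lambda>s. (t - s) powr (p - 1) * (s - 0) powr (1 - 1)) has_integral Beta p 1 * (t - 0) powr (p + 1 - 1)) {0..t}"
    using assms by (intro kernel_product_has_integral) auto
  moreover have "Beta p 1 = 1 / p"
    using assms Gamma_plus1_pos[of p] less_imp_neq[OF Gamma_real_pos[of p]]
    by (simp add: Beta_def field_simps)
  ultimately have "((\<lambda>s. (t - s) powr (p - 1) * (s - 0) powr (1 - 1)) has_integral t powr p / p) {0..t}"
    by simp
  then show ?thesis
    by (rule has_integral_spike_finite[where S = "{0}", rotated 2]) auto
next
  case True
  then show ?thesis by (simp add: has_integral_refl)
qed

lemma frac_int_one:
  assumes "0 < p" "0 \<le> t"
  shows "frac_int p (\<lambda>_. 1) t = t powr p / Gamma (p + 1)"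
  using kernel_has_integral[OF assms] assms
  by (simp add: frac_int_def integral_unique Gamma_plus1_pos mult.commute)

lemma lborel_integrable_nonneg:
  fixes f :: "real \<Rightarrow> real"
  assumes "f \<in> borel_measurable borel" "\<And>x. 0 \<le> f x" "(f has_integral I) UNIV"
  shows "integrable lborel f" "integral\<^sup>L lborel f = I"
proof -
  have "(\<integral>\<^sup>+x. ennreal (f x) \<partial>lborel) = ennreal I"
    using assms by (rule nn_integral_has_integral_lborel)
  then show int: "integrable lborel f"
    using assms by (intro integrableI_nonneg) auto
  show "integral\<^sup>L lborel f = I"
    using has_integral_unique[OF has_integral_integral_lborel[OF int] assms(3)] .
qed

text \<open>
  Fubini's theorem on the triangle \<open>0 \<le> u \<le> s \<le> t\<close>: the inner integral over \<open>s\<close> is a Beta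
  integral, and \<open>Beta p q / (Gamma p * Gamma q) = 1 / Gamma (p + q)\<close>. Integrability is part of the
  conclusion because the kernels are singular for orders below \<open>1\<close>.
\<close>

lemma frac_int_semigroup:
  fixes p q t :: real and w :: "real \<Rightarrow> real"
  assumes p: "0 < p" and q: "0 < q" and t: "0 \<le> t" and w: "continuous_on {0..t} w"
  shows "frac_int p (frac_int q w) t = frac_int (p + q) w t"
    and "(\<lambda>s. (t - s) powr (p - 1) * frac_int q w s) integrable_on {0..t}"
proof -
  \<comment> \<open>Everything is extended by zero to the line, where the product measure and Fubini's theorem are available.\<close>
  define k where "k = (\<lambda>u s. if 0 \<le> u \<and> u \<le> s \<and> s \<le> t then (t - s) powr (p - 1) * (s - u) powr (q - 1) else 0)"
  define v where "v = (\<lambda>u. indicator {0..t} u *\<^sub>R w u)"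
  have v_meas [measurable]: "v \<in> borel_measurable borel"
    unfolding v_def using w by (intro borel_measurable_continuous_on_indicator) auto
  have k_meas [measurable]: "(\<lambda>z. k (fst z) (snd z)) \<in> borel_measurable (lborel \<Otimes>\<^sub>M lborel)"
    unfolding k_def by measurable
  have k_meas1 [measurable]: "(\<lambda>s. k u s) \<in> borel_measurable borel" for u
    unfolding k_def by measurable
  have k_meas2 [measurable]: "(\<lambda>u. k u s) \<in> borel_measurable borel" for s
    unfolding k_def by measurable
  obtain M where M: "\<And>u. \<bar>v u\<bar> \<le> M" and M0: "0 \<le> M"
  proof -
    have "bounded (w ` {0..t})" using w by (intro compact_imp_bounded compact_continuous_image) auto
    then obtain M where M: "\<forall>u\<in>{0..t}. \<bar>w u\<bar> \<le> M" unfolding bounded_iff by auto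
    have "0 \<le> M" using bspec[OF M, of 0] t by simp
    then have "\<bar>v u\<bar> \<le> M" for u using M by (auto simp: v_def indicator_def)
    then show ?thesis using that \<open>0 \<le> M\<close> by blast
  qed
  have k0: "0 \<le> k u s" for u s by (simp add: k_def)
  define B where "B = Beta p q"
  \<comment> \<open>\<open>H\<close> is the integral of the kernel over \<open>s\<close>; below, \<open>g\<close> is the integral over \<open>u\<close>, including \<open>w\<close>.\<close>
  define H where "H = (\<lambda>u. if 0 \<le> u \<and> u \<le> t then B * (t - u) powr (p + q - 1) else 0)"
  have "((k u) has_integral H u) UNIV" for u
  proof (cases "0 \<le> u \<and> u < t")
    case True
    have "((\<lambda>s. (t - s) powr (p - 1) * (s - u) powr (q - 1)) has_integral H u) {u..t}"
      unfolding B_def H_def using True p q by (auto intro: kernel_product_has_integral)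
    then have "((\<lambda>s. if s \<in> {u..t} then (t - s) powr (p - 1) * (s - u) powr (q - 1) else 0) has_integral H u) UNIV"
      by (simp only: has_integral_restrict_UNIV)
    moreover have "k u = (\<lambda>s. if s \<in> {u..t} then (t - s) powr (p - 1) * (s - u) powr (q - 1) else 0)"
      using True by (auto simp: k_def fun_eq_iff)
    ultimately show ?thesis by simp
  next
    case False
    then have "k u = (\<lambda>s. 0)" "H u = 0" by (auto simp: k_def H_def fun_eq_iff)
    then show ?thesis by simp
  qed
  note inner = lborel_integrable_nonneg[OF k_meas1 k0 this]
  have "(H has_integral B * (t powr (p + q) / (p + q))) UNIV"
  proof -
    have "((\<lambda>u. B * (t - u) powr (p + q - 1)) has_integral B * (t powr (p + q) / (p + q))) {0..t}"
      using p q t by (intro has_integral_mult_right kernel_has_integral) auto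
    then have "((\<lambda>u. if u \<in> {0..t} then B * (t - u) powr (p + q - 1) else 0) has_integral B * (t powr (p + q) / (p + q))) UNIV"
      by (simp only: has_integral_restrict_UNIV)
    then show ?thesis by (simp add: H_def)
  qed
  moreover have "H \<in> borel_measurable borel" unfolding H_def by measurable
  moreover have "0 \<le> B"
    using p q Gamma_real_pos[of p] Gamma_real_pos[of q] Gamma_real_pos[of "p + q"] by (simp add: B_def Beta_def)
  then have H0: "0 \<le> H u" for u by (simp add: H_def)
  ultimately have H_int: "integrable lborel H"
    by (intro lborel_integrable_nonneg(1)) auto
  define f where "f = (\<lambda>u s. k u s * v u)"
  have f_int1: "integrable lborel (f u)" "integral\<^sup>L lborel (f u) = H u * v u" for u
    unfolding f_def using inner[of u] by auto
  have f_int: "integrable (lborel \<Otimes>\<^sub>M lborel) (case_prod f)"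
  proof (rule lborel_pair.Fubini_integrable)
    show "case_prod f \<in> borel_measurable (lborel \<Otimes>\<^sub>M lborel)"
      unfolding f_def case_prod_unfold by measurable
    have "(\<lambda>u. \<integral>s. norm (case_prod f (u, s)) \<partial>lborel) = (\<lambda>u. H u * \<bar>v u\<bar>)"
      using inner k0 by (simp add: f_def abs_mult)
    moreover have "integrable lborel (\<lambda>u. H u * \<bar>v u\<bar>)"
    proof (rule Bochner_Integration.integrable_bound[of _ "\<lambda>u. M * H u"])
      show "integrable lborel (\<lambda>u. M * H u)" using H_int by simp
      show "(\<lambda>u. H u * \<bar>v u\<bar>) \<in> borel_measurable lborel" unfolding H_def by measurable
      show "AE u in lborel. norm (H u * \<bar>v u\<bar>) \<le> norm (M * H u)"
      proof (rule AE_I2)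
        fix u
        show "norm (H u * \<bar>v u\<bar>) \<le> norm (M * H u)"
          using mult_right_mono[OF M H0] M0 H0[of u] by (simp add: abs_mult mult.commute)
      qed
    qed
    ultimately show "integrable lborel (\<lambda>u. \<integral>s. norm (case_prod f (u, s)) \<partial>lborel)" by simp
  qed (use f_int1 in simp)
  define g where "g = (\<lambda>s. if s \<in> {0..t} then Gamma q * ((t - s) powr (p - 1) * frac_int q w s) else 0)"
  have Gq: "Gamma q > 0" using q by (rule Gamma_real_pos)
  have G0: "Gamma p \<noteq> 0" "Gamma q \<noteq> 0" "Gamma (p + q) \<noteq> 0"
    using p q by (simp_all add: Gamma_real_pos less_imp_neq[symmetric])
  have g: "(\<integral>u. f u s \<partial>lborel) = g s" for s
  proof (cases "s \<in> {0..t}")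
    case True
    have "((\<lambda>u. if u \<in> {0..s} then (s - u) powr (q - 1) else 0) has_integral s powr q / q) UNIV"
      unfolding has_integral_restrict_UNIV using True q by (intro kernel_has_integral) auto
    then have "integrable lborel (\<lambda>u. if u \<in> {0..s} then (s - u) powr (q - 1) else 0)"
      by (intro lborel_integrable_nonneg(1)) auto
    then have b: "integrable lborel (\<lambda>u. (M * (t - s) powr (p - 1)) * (if u \<in> {0..s} then (s - u) powr (q - 1) else 0))"
      by simp
    have "integrable lborel (\<lambda>u. f u s)"
    proof (rule Bochner_Integration.integrable_bound[OF b])
      show "(\<lambda>u. f u s) \<in> borel_measurable lborel" unfolding f_def by measurable
      show "AE u in lborel. norm (f u s) \<le> norm ((M * (t - s) powr (p - 1)) * (if u \<in> {0..s} then (s - u) powr (q - 1) else 0))"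
      proof (rule AE_I2)
        fix u
        have "k u s * \<bar>v u\<bar> \<le> k u s * M" using M k0 by (intro mult_left_mono) auto
        then show "norm (f u s) \<le> norm ((M * (t - s) powr (p - 1)) * (if u \<in> {0..s} then (s - u) powr (q - 1) else 0))"
          using M0 k0[of u s] by (auto simp: f_def abs_mult k_def mult_ac)
      qed
    qed
    then have "(\<integral>u. f u s \<partial>lborel) = integral UNIV (\<lambda>u. f u s)" by (simp add: integral_lborel)
    also have "\<dots> = integral UNIV (\<lambda>u. if u \<in> {0..s} then (t - s) powr (p - 1) * ((s - u) powr (q - 1) * w u) else 0)"
      using True by (intro integral_cong) (auto simp: f_def k_def v_def)
    also have "\<dots> = (t - s) powr (p - 1) * integral {0..s} (\<lambda>u. (s - u) powr (q - 1) * w u)"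
      by (simp only: integral_restrict_UNIV integral_mult_right)
    finally show ?thesis using True Gq by (simp add: g_def frac_int_def)
  next
    case False
    then have "(\<lambda>u. f u s) = (\<lambda>u. 0)" by (auto simp: f_def k_def fun_eq_iff)
    then show ?thesis using False by (auto simp: g_def)
  qed
  have g_int: "integrable lborel g"
    using lborel_pair.integrable_snd[OF f_int] g by simp
  have "integral\<^sup>L lborel g = (\<integral>u. H u * v u \<partial>lborel)"
    using lborel_pair.Fubini_integral[OF f_int] f_int1(2) g by simp
  moreover have "integrable lborel (\<lambda>u. H u * v u)"
    using lborel_pair.integrable_fst[OF f_int] f_int1(2) by simp
  ultimately have "integral UNIV g = integral UNIV (\<lambda>u. H u * v u)"
    using g_int by (simp add: integral_lborel)
  moreover have "(\<lambda>u. H u * v u) = (\<lambda>u. if u \<in> {0..t} then B * ((t - u) powr (p + q - 1) * w u) else 0)"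
    by (auto simp: H_def v_def fun_eq_iff)
  ultimately have "integral {0..t} (\<lambda>s. Gamma q * ((t - s) powr (p - 1) * frac_int q w s))
     = integral {0..t} (\<lambda>u. B * ((t - u) powr (p + q - 1) * w u))"
    unfolding g_def by (simp only: integral_restrict_UNIV)
  then have "Gamma q * integral {0..t} (\<lambda>s. (t - s) powr (p - 1) * frac_int q w s)
     = B * integral {0..t} (\<lambda>u. (t - u) powr (p + q - 1) * w u)"
    by (simp only: integral_mult_right)
  then have "Gamma q * (frac_int p (frac_int q w) t * Gamma p) = B * (frac_int (p + q) w t * Gamma (p + q))"
    using G0 by (simp add: frac_int_def)
  then show "frac_int p (frac_int q w) t = frac_int (p + q) w t"
    using G0 by (simp add: B_def Beta_def)
  have "(\<lambda>s. Gamma q * ((t - s) powr (p - 1) * frac_int q w s)) integrable_on {0..t}"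
    using integrable_on_lborel[OF g_int] unfolding g_def by (simp only: integrable_restrict_UNIV)
  then have "(\<lambda>s. 1 / Gamma q * (Gamma q * ((t - s) powr (p - 1) * frac_int q w s))) integrable_on {0..t}"
    by (rule integrable_on_mult_right)
  then show "(\<lambda>s. (t - s) powr (p - 1) * frac_int q w s) integrable_on {0..t}"
    using Gq by simp
qed

lemma frac_int_one_one: "0 \<le> t \<Longrightarrow> frac_int 1 (\<lambda>_. 1) t = t"
  using frac_int_one[of 1 t] by (simp add: Gamma_numeral)

lemma frac_int_cong:
  assumes "\<And>s. 0 < s \<Longrightarrow> s < t \<Longrightarrow> g s = h s"
  shows "frac_int p g t = frac_int p h t"
proof -
  have "integral {0..t} (\<lambda>s. (t - s) powr (p - 1) * g s) = integral {0..t} (\<lambda>s. (t - s) powr (p - 1) * h s)"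
    by (rule integral_spike[of "{0, t}"]) (use assms in auto)
  then show ?thesis by (simp add: frac_int_def)
qed

lemma taylor_frac_int:
  fixes u :: "real \<Rightarrow> real"
  assumes u: "\<And>s. s \<in> {0..T} \<Longrightarrow> (u has_real_derivative u1 s) (at s within {0..T})"
    and u1: "\<And>s. s \<in> {0..T} \<Longrightarrow> (u1 has_real_derivative w s) (at s within {0..T})"
    and t: "0 \<le> t" "t \<le> T"
  shows "u t = u 0 + u1 0 * t + frac_int 2 w t"
proof -
  have "((\<lambda>s. (t - s) * w s) has_integral ((t - t) * u1 t + u t) - ((t - 0) * u1 0 + u 0)) {0..t}"
  proof (rule fundamental_theorem_of_calculus[OF t(1)])
    fix s assume s: "s \<in> {0..t}"
    have d: "(u has_real_derivative u1 s) (at s within {0..t})" "(u1 has_real_derivative w s) (at s within {0..t})"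
      using DERIV_subset[OF u] DERIV_subset[OF u1] s t by auto
    have "((\<lambda>s. (t - s) * u1 s + u s) has_real_derivative (t - s) * w s) (at s within {0..t})"
      using d by (auto intro!: derivative_eq_intros)
    then show "((\<lambda>s. (t - s) * u1 s + u s) has_vector_derivative (t - s) * w s) (at s within {0..t})"
      by (simp add: has_real_derivative_iff_has_vector_derivative)
  qed
  then have "integral {0..t} (\<lambda>s. (t - s) * w s) = u t - t * u1 0 - u 0"
    by (simp add: integral_unique)
  moreover have "integral {0..t} (\<lambda>s. (t - s) * w s) = integral {0..t} (\<lambda>s. (t - s) powr (2 - 1) * w s)"
    by (rule integral_cong) auto
  ultimately show ?thesis by (simp add: frac_int_def Gamma_numeral)
qed

text \<open>
  The polynomial part is \<open>c0\<close> times the constant \<open>1\<close> plus \<open>c1\<close> times the first-order integral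
  of \<open>1\<close>, so that the semigroup property integrates all three terms.
\<close>

lemma frac_int_taylor:
  assumes p: "0 < p" and t: "0 \<le> t" and w: "continuous_on {0..t} w"
    and y: "\<And>s. 0 \<le> s \<Longrightarrow> s \<le> t \<Longrightarrow> y s = c0 + c1 * s + frac_int 2 w s"
  shows "frac_int p y t = c0 * t powr p / Gamma (p + 1) + c1 * t powr (p + 1) / Gamma (p + 2) + frac_int (p + 2) w t"
    and "(\<lambda>s. (t - s) powr (p - 1) * y s) integrable_on {0..t}"
proof -
  let ?k = "\<lambda>s. (t - s) powr (p - 1)"
  have i0: "(\<lambda>s. ?k s * 1) integrable_on {0..t}"
    using kernel_has_integral[OF p t] by (auto simp: integrable_on_def)
  have i1: "(\<lambda>s. ?k s * frac_int 1 (\<lambda>_. 1) s) integrable_on {0..t}"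
    using p t by (intro frac_int_semigroup) auto
  have i2: "(\<lambda>s. ?k s * frac_int 2 w s) integrable_on {0..t}"
    using p t w by (intro frac_int_semigroup) auto
  let ?y = "\<lambda>s. c0 * (?k s * 1) + c1 * (?k s * frac_int 1 (\<lambda>_. 1) s) + ?k s * frac_int 2 w s"
  have ey: "?k s * y s = ?y s" if "s \<in> {0..t}" for s
    using y[of s] that by (simp add: frac_int_one_one algebra_simps)
  have iy: "?y integrable_on {0..t}"
    using i0 i1 i2 by (intro integrable_add integrable_on_mult_right)
  then show "(\<lambda>s. ?k s * y s) integrable_on {0..t}"
    using integrable_cong[of "{0..t}" "\<lambda>s. ?k s * y s" ?y] ey by blast
  have "integral {0..t} (\<lambda>s. ?k s * y s) = integral {0..t} ?y"
    by (rule integral_cong) (rule ey)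
  also have "\<dots> = c0 * integral {0..t} (\<lambda>s. ?k s * 1) + c1 * integral {0..t} (\<lambda>s. ?k s * frac_int 1 (\<lambda>_. 1) s)
      + integral {0..t} (\<lambda>s. ?k s * frac_int 2 w s)"
    using i0 i1 i2 by (simp only: Henstock_Kurzweil_Integration.integral_add integrable_add integrable_on_mult_right integral_mult_right)
  finally have "frac_int p y t = c0 * frac_int p (\<lambda>_. 1) t + c1 * frac_int p (frac_int 1 (\<lambda>_. 1)) t + frac_int p (frac_int 2 w) t"
    by (simp add: frac_int_def algebra_simps)
  also have "frac_int p (frac_int 1 (\<lambda>_. 1)) t = frac_int (p + 1) (\<lambda>_. 1) t"
    using p t by (intro frac_int_semigroup) auto
  also have "frac_int p (frac_int 2 w) t = frac_int (p + 2) w t"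
    using p t w by (intro frac_int_semigroup) auto
  also have "frac_int p (\<lambda>_. 1) t = t powr p / Gamma (p + 1)"
    using p t by (rule frac_int_one)
  also have "frac_int (p + 1) (\<lambda>_. 1) t = t powr (p + 1) / Gamma (p + 2)"
    using p t frac_int_one[of "p + 1" t] by (simp add: add_ac)
  finally show "frac_int p y t = c0 * t powr p / Gamma (p + 1) + c1 * t powr (p + 1) / Gamma (p + 2) + frac_int (p + 2) w t"
    by simp
qed


section \<open>Functions and curves in \<open>C\<^sup>4\<close>\<close>

lemma C4_fun_derivative:
  assumes "C4_fun a b v" "i < 4" "x \<in> {a<..<b}"
  shows "((deriv ^^ i) v has_real_derivative (deriv ^^ Suc i) v x) (at x)"
  using assms by (auto simp: C4_fun_def intro!: field_differentiable_derivI)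

lemma C4_fun_continuous: "C4_fun a b v \<Longrightarrow> continuous_on {a..b} v"
  by (simp add: C4_fun_def)

text \<open>
  The operator \<open>deriv\<close> is linear only where derivatives exist, and one step of the iteration
  needs the identity on a neighbourhood; the open interval supplies it.
\<close>

lemma higher_deriv_linear:
  assumes u: "C4_fun a b u" and v: "C4_fun a b v" and i: "i \<le> 4" and x: "x \<in> {a<..<b}"
  shows "(deriv ^^ i) (\<lambda>y. c * u y + d * v y) x = c * (deriv ^^ i) u x + d * (deriv ^^ i) v x"
  using i x
proof (induction i arbitrary: x)
  case (Suc i)
  have "((\<lambda>y. c * (deriv ^^ i) u y + d * (deriv ^^ i) v y) has_real_derivative
      c * (deriv ^^ Suc i) u x + d * (deriv ^^ Suc i) v x) (at x)"
    using Suc.prems by (intro DERIV_add DERIV_cmult C4_fun_derivative[OF u] C4_fun_derivative[OF v]) auto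
  then have "((deriv ^^ i) (\<lambda>y. c * u y + d * v y) has_real_derivative
      c * (deriv ^^ Suc i) u x + d * (deriv ^^ Suc i) v x) (at x)"
    by (rule has_field_derivative_transform_within_open[where S = "{a<..<b}"])
       (use Suc in auto)
  then show ?case using DERIV_imp_deriv by fastforce
qed simp

lemma C4_fun_linear:
  assumes u: "C4_fun a b u" and v: "C4_fun a b v"
  shows "C4_fun a b (\<lambda>y. c * u y + d * v y)"
  unfolding C4_fun_def
proof (intro conjI allI impI ballI)
  show "continuous_on {a..b} (\<lambda>y. c * u y + d * v y)"
    using u v by (intro continuous_intros C4_fun_continuous)
next
  fix i x assume i: "i < (4::nat)" and x: "x \<in> {a<..<b}"
  have "((\<lambda>y. c * (deriv ^^ i) u y + d * (deriv ^^ i) v y) has_real_derivative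
      c * (deriv ^^ Suc i) u x + d * (deriv ^^ Suc i) v x) (at x)"
    using i x by (intro DERIV_add DERIV_cmult C4_fun_derivative[OF u] C4_fun_derivative[OF v]) auto
  then have "((deriv ^^ i) (\<lambda>y. c * u y + d * v y) has_real_derivative
      c * (deriv ^^ Suc i) u x + d * (deriv ^^ Suc i) v x) (at x)"
    by (rule has_field_derivative_transform_within_open[where S = "{a<..<b}"])
       (use i x higher_deriv_linear[OF u v] in auto)
  then show "(deriv ^^ i) (\<lambda>y. c * u y + d * v y) field_differentiable at x"
    by (auto simp: field_differentiable_def)
next
  fix i assume i: "i \<le> (4::nat)"
  obtain g where g: "continuous_on {a..b} g" "\<And>x. x \<in> {a<..<b} \<Longrightarrow> g x = (deriv ^^ i) u x"
    using u i by (auto simp: C4_fun_def)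
  obtain h where h: "continuous_on {a..b} h" "\<And>x. x \<in> {a<..<b} \<Longrightarrow> h x = (deriv ^^ i) v x"
    using v i by (auto simp: C4_fun_def)
  show "\<exists>g. continuous_on {a..b} g \<and> (\<forall>x\<in>{a<..<b}. g x = (deriv ^^ i) (\<lambda>y. c * u y + d * v y) x)"
    using g h higher_deriv_linear[OF u v i]
    by (intro exI[of _ "\<lambda>y. c * g y + d * h y"]) (auto intro!: continuous_intros)
qed

text \<open>
  Continuous extensions to the compact interval make the suprema in the \<open>C\<^sup>4\<close> norm genuine: a
  supremum of an unbounded set of reals would be an arbitrary number.
\<close>

lemma C4_fun_bdd:
  assumes "C4_fun a b v" "i \<le> 4"
  shows "bdd_above ((\<lambda>x. \<bar>(deriv ^^ i) v x\<bar>) ` {a<..<b})"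
proof -
  obtain g where g: "continuous_on {a..b} g" "\<And>x. x \<in> {a<..<b} \<Longrightarrow> g x = (deriv ^^ i) v x"
    using assms by (auto simp: C4_fun_def)
  have "bounded (g ` {a..b})" using g(1) by (intro compact_imp_bounded compact_continuous_image) auto
  then obtain M where "\<forall>x\<in>{a..b}. \<bar>g x\<bar> \<le> M" unfolding bounded_iff by auto
  then show ?thesis using g(2) by (intro bdd_aboveI2[where M = M]) (metis atLeastAtMost_iff greaterThanLessThan_iff less_imp_le)
qed

lemma deriv_le_C4_norm:
  assumes "C4_fun a b v" "i \<le> 4" "x \<in> {a<..<b}"
  shows "\<bar>(deriv ^^ i) v x\<bar> \<le> C4_norm a b v"
proof -
  have "\<bar>(deriv ^^ i) v x\<bar> \<le> (SUP x\<in>{a<..<b}. \<bar>(deriv ^^ i) v x\<bar>)"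
    using assms by (intro cSUP_upper C4_fun_bdd)
  also have "\<dots> \<le> C4_norm a b v"
    unfolding C4_norm_def using assms by (intro Max_ge) auto
  finally show ?thesis .
qed

lemma C4_norm_le:
  assumes "a < b" "\<And>i x. i \<le> 4 \<Longrightarrow> x \<in> {a<..<b} \<Longrightarrow> \<bar>(deriv ^^ i) v x\<bar> \<le> M"
  shows "C4_norm a b v \<le> M"
  unfolding C4_norm_def using assms by (auto intro!: cSUP_least)

lemma C4_norm_triangle:
  assumes ab: "a < b" and u: "C4_fun a b u" and v: "C4_fun a b v"
  shows "C4_norm a b u \<le> C4_norm a b v + C4_norm a b (\<lambda>x. u x - v x)"
proof (rule C4_norm_le[OF ab])
  fix i x assume i: "i \<le> (4::nat)" and x: "x \<in> {a<..<b}"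
  have eq: "(\<lambda>x. u x - v x) = (\<lambda>x. 1 * u x + (-1) * v x)" by simp
  have "(deriv ^^ i) (\<lambda>x. u x - v x) x = (deriv ^^ i) u x - (deriv ^^ i) v x"
    unfolding eq higher_deriv_linear[OF u v i x] by simp
  moreover have "C4_fun a b (\<lambda>x. u x - v x)" unfolding eq by (rule C4_fun_linear[OF u v])
  ultimately show "\<bar>(deriv ^^ i) u x\<bar> \<le> C4_norm a b v + C4_norm a b (\<lambda>x. u x - v x)"
    using deriv_le_C4_norm[OF v i x] deriv_le_C4_norm[of a b "\<lambda>x. u x - v x" i x] i x by simp
qed

lemma C4_norm_minus_commute:
  assumes u: "C4_fun a b u" and v: "C4_fun a b v"
  shows "C4_norm a b (\<lambda>x. u x - v x) = C4_norm a b (\<lambda>x. v x - u x)"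
proof -
  have "\<bar>(deriv ^^ i) (\<lambda>x. u x - v x) x\<bar> = \<bar>(deriv ^^ i) (\<lambda>x. v x - u x) x\<bar>"
    if "i \<le> 4" "x \<in> {a<..<b}" for i x
    using higher_deriv_linear[OF u v that, of 1 "-1"] higher_deriv_linear[OF v u that, of 1 "-1"] by simp
  then show ?thesis unfolding C4_norm_def
    by (intro arg_cong[where f = Max] image_cong SUP_cong) auto
qed

text \<open>
  The norm is a continuous function of time on a compact interval.
\<close>

lemma C4_continuous_deriv_bound:
  assumes ab: "a < b" and W: "\<And>t. t \<in> {0..T} \<Longrightarrow> C4_fun a b (W t)" and cont: "C4_continuous_on a b {0..T} W"
  shows "\<exists>M. \<forall>t\<in>{0..T}. \<forall>i\<le>4. \<forall>x\<in>{a<..<b}. \<bar>(deriv ^^ i) (W t) x\<bar> \<le> M"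
proof -
  have "continuous_on {0..T} (\<lambda>t. C4_norm a b (W t))"
    unfolding continuous_on_def
  proof
    fix t assume t: "t \<in> {0..T}"
    have "((\<lambda>s. C4_norm a b (W s) - C4_norm a b (W t)) \<longlongrightarrow> 0) (at t within {0..T})"
    proof (rule Lim_null_comparison)
      show "\<forall>\<^sub>F s in at t within {0..T}. norm (C4_norm a b (W s) - C4_norm a b (W t)) \<le> C4_norm a b (\<lambda>x. W s x - W t x)"
        unfolding eventually_at_filter
      proof (rule always_eventually, intro allI impI)
        fix s assume s: "s \<noteq> t" "s \<in> {0..T}"
        show "norm (C4_norm a b (W s) - C4_norm a b (W t)) \<le> C4_norm a b (\<lambda>x. W s x - W t x)"
          using C4_norm_triangle[OF ab W[OF s(2)] W[OF t]] C4_norm_triangle[OF ab W[OF t] W[OF s(2)]]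
            C4_norm_minus_commute[OF W[OF s(2)] W[OF t]] by simp
      qed
      show "((\<lambda>s. C4_norm a b (\<lambda>x. W s x - W t x)) \<longlongrightarrow> 0) (at t within {0..T})"
        using cont t by (simp add: C4_continuous_on_def)
    qed
    then show "((\<lambda>t. C4_norm a b (W t)) \<longlongrightarrow> C4_norm a b (W t)) (at t within {0..T})"
      by (simp add: LIM_zero_iff)
  qed
  then have "bounded ((\<lambda>t. C4_norm a b (W t)) ` {0..T})"
    by (intro compact_imp_bounded compact_continuous_image) auto
  then obtain M where M: "\<forall>t\<in>{0..T}. \<bar>C4_norm a b (W t)\<bar> \<le> M" unfolding bounded_iff by auto
  have "\<bar>(deriv ^^ i) (W t) x\<bar> \<le> M" if "t \<in> {0..T}" "i \<le> 4" "x \<in> {a<..<b}" for t i x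
    using deriv_le_C4_norm[OF W[OF that(1)] that(2,3)] bspec[OF M that(1)] by linarith
  then show ?thesis by blast
qed

lemma C4_continuous_deriv_continuous:
  assumes W: "\<And>t. t \<in> S \<Longrightarrow> C4_fun a b (W t)" and cont: "C4_continuous_on a b S W"
    and i: "i \<le> 4" and x: "x \<in> {a<..<b}"
  shows "continuous_on S (\<lambda>t. (deriv ^^ i) (W t) x)"
  unfolding continuous_on_def
proof
  fix t assume t: "t \<in> S"
  have "((\<lambda>s. (deriv ^^ i) (W s) x - (deriv ^^ i) (W t) x) \<longlongrightarrow> 0) (at t within S)"
  proof (rule Lim_null_comparison)
    show "\<forall>\<^sub>F s in at t within S. norm ((deriv ^^ i) (W s) x - (deriv ^^ i) (W t) x) \<le> C4_norm a b (\<lambda>x. W s x - W t x)"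
      unfolding eventually_at_filter
    proof (rule always_eventually, intro allI impI)
      fix s assume s: "s \<noteq> t" "s \<in> S"
      show "norm ((deriv ^^ i) (W s) x - (deriv ^^ i) (W t) x) \<le> C4_norm a b (\<lambda>x. W s x - W t x)"
      proof -
        have eq: "(\<lambda>x. W s x - W t x) = (\<lambda>x. 1 * W s x + (-1) * W t x)" by simp
        have "(deriv ^^ i) (\<lambda>x. W s x - W t x) x = (deriv ^^ i) (W s) x - (deriv ^^ i) (W t) x"
          unfolding eq higher_deriv_linear[OF W[OF s(2)] W[OF t] i x] by simp
        moreover have "C4_fun a b (\<lambda>x. W s x - W t x)"
          unfolding eq by (rule C4_fun_linear[OF W[OF s(2)] W[OF t]])
        ultimately show ?thesis
          using deriv_le_C4_norm[of a b "\<lambda>x. W s x - W t x" i x] i x unfolding real_norm_def by argo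
      qed
    qed
    show "((\<lambda>s. C4_norm a b (\<lambda>x. W s x - W t x)) \<longlongrightarrow> 0) (at t within S)"
      using cont t by (simp add: C4_continuous_on_def)
  qed
  then show "((\<lambda>t. (deriv ^^ i) (W t) x) \<longlongrightarrow> (deriv ^^ i) (W t) x) (at t within S)"
    by (simp add: LIM_zero_iff)
qed

text \<open>
  Evaluation of a spatial derivative at a point is bounded by the \<open>C\<^sup>4\<close> norm and hence commutes
  with the derivative of a curve.
\<close>

lemma has_C4_derivative_pointwise:
  assumes W: "\<And>s. s \<in> S \<Longrightarrow> C4_fun a b (W s)" and D: "C4_fun a b D" and t: "t \<in> S"
    and der: "has_C4_derivative a b W D t S" and i: "i \<le> 4" and x: "x \<in> {a<..<b}"
  shows "((\<lambda>s. (deriv ^^ i) (W s) x) has_real_derivative (deriv ^^ i) D x) (at t within S)"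
proof -
  have "((\<lambda>s. ((deriv ^^ i) (W s) x - (deriv ^^ i) (W t) x) / (s - t) - (deriv ^^ i) D x) \<longlongrightarrow> 0) (at t within S)"
  proof (rule Lim_null_comparison)
    show "\<forall>\<^sub>F s in at t within S. norm (((deriv ^^ i) (W s) x - (deriv ^^ i) (W t) x) / (s - t) - (deriv ^^ i) D x)
      \<le> C4_norm a b (\<lambda>x. (W s x - W t x) / (s - t) - D x)"
      unfolding eventually_at_filter
    proof (rule always_eventually, intro allI impI)
      fix s assume s: "s \<noteq> t" "s \<in> S"
      define c where "c = 1 / (s - t)"
      let ?v = "\<lambda>y. - c * W t y + (-1) * D y"
      have eq: "(\<lambda>x. (W s x - W t x) / (s - t) - D x) = (\<lambda>y. c * W s y + 1 * ?v y)"
        unfolding c_def by (rule ext) (simp add: diff_divide_distrib)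
      have v: "C4_fun a b ?v" by (rule C4_fun_linear[OF W[OF t] D])
      have "(deriv ^^ i) (\<lambda>x. (W s x - W t x) / (s - t) - D x) x
          = ((deriv ^^ i) (W s) x - (deriv ^^ i) (W t) x) / (s - t) - (deriv ^^ i) D x"
        unfolding eq higher_deriv_linear[OF W[OF s(2)] v i x] higher_deriv_linear[OF W[OF t] D i x]
        unfolding c_def by (simp add: diff_divide_distrib)
      moreover have "C4_fun a b (\<lambda>x. (W s x - W t x) / (s - t) - D x)"
        unfolding eq by (rule C4_fun_linear[OF W[OF s(2)] v])
      ultimately show "norm (((deriv ^^ i) (W s) x - (deriv ^^ i) (W t) x) / (s - t) - (deriv ^^ i) D x)
      \<le> C4_norm a b (\<lambda>x. (W s x - W t x) / (s - t) - D x)"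
        using deriv_le_C4_norm[of a b "\<lambda>x. (W s x - W t x) / (s - t) - D x" i x] i x
        unfolding real_norm_def by argo
    qed
    show "((\<lambda>s. C4_norm a b (\<lambda>x. (W s x - W t x) / (s - t) - D x)) \<longlongrightarrow> 0) (at t within S)"
      using der by (simp add: has_C4_derivative_def)
  qed
  then show ?thesis by (simp add: has_field_derivative_iff LIM_zero_iff)
qed

text \<open>
  Taylor's theorem applies to \<open>v (x + e) + v (x - e)\<close> for \<open>e < h\<close>, where both points are interior.
  The endpoints of the interval are reached by continuity, since the derivatives of \<open>v\<close> are available
  on the open interval only.
\<close>

lemma second_difference_error:
  assumes v: "C4_fun a b v" and M: "\<And>y. y \<in> {a<..<b} \<Longrightarrow> \<bar>(deriv ^^ 4) v y\<bar> \<le> M"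
    and h: "0 < h" "a \<le> x - h" "x + h \<le> b"
  shows "\<bar>(v (x + h) - 2 * v x + v (x - h)) / h\<^sup>2 - (deriv ^^ 2) v x\<bar> \<le> M / 12 * h\<^sup>2"
proof -
  define d where "d = (\<lambda>m. (deriv ^^ m) v)"
  have d0: "d 0 = v" by (simp add: d_def)
  have d_der: "(d m has_real_derivative d (Suc m) y) (at y)" if "m < 4" "y \<in> {a<..<b}" for m y
    unfolding d_def by (rule C4_fun_derivative[OF v that])
  have d4: "\<bar>d 4 y\<bar> \<le> M" if "y \<in> {a<..<b}" for y
    unfolding d_def by (rule M[OF that])
  define E where "E = (\<lambda>e. v (x + e) - 2 * v x + v (x - e) - e\<^sup>2 * d 2 x)"
  have int: "\<bar>E e\<bar> \<le> M / 12 * e ^ 4" if e: "0 < e" "e < h" for e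
  proof -
    \<comment> \<open>The derivatives of the symmetric sum; the odd ones vanish at \<open>0\<close>.\<close>
    define D where "D = (\<lambda>m s. d m (x + s) + (-1) ^ m * d m (x - s))"
    have "D 0 = (\<lambda>s. v (x + s) + v (x - s))" by (simp add: D_def d0)
    moreover have "\<forall>m s. m < 4 \<and> 0 \<le> s \<and> s \<le> e \<longrightarrow> DERIV (D m) s :> D (Suc m) s"
    proof (intro allI impI)
      fix m :: nat and s :: real assume ms: "m < 4 \<and> 0 \<le> s \<and> s \<le> e"
      then have x: "x + s \<in> {a<..<b}" "x - s \<in> {a<..<b}" using e h by auto
      have "((\<lambda>s. d m (x + s)) has_real_derivative d (Suc m) (x + s) * 1) (at s)"
        using ms x by (intro DERIV_chain2[OF d_der]) (auto intro!: derivative_eq_intros)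
      moreover have "((\<lambda>s. d m (x - s)) has_real_derivative d (Suc m) (x - s) * (-1)) (at s)"
        using ms x by (intro DERIV_chain2[OF d_der]) (auto intro!: derivative_eq_intros)
      ultimately have "((\<lambda>s. d m (x + s) + (-1) ^ m * d m (x - s)) has_real_derivative
         d (Suc m) (x + s) * 1 + (-1) ^ m * (d (Suc m) (x - s) * (-1))) (at s)"
        by (intro DERIV_add DERIV_cmult)
      then show "DERIV (D m) s :> D (Suc m) s" by (simp add: D_def)
    qed
    ultimately obtain s where s: "0 < s" "s < e"
      "v (x + e) + v (x - e) = (\<Sum>m<4. D m 0 / fact m * e ^ m) + D 4 s / fact 4 * e ^ 4"
      using Maclaurin[of e 4 D "\<lambda>s. v (x + s) + v (x - s)"] e by auto
    have "(\<Sum>m<4. D m 0 / fact m * e ^ m) = 2 * v x + e\<^sup>2 * d 2 x"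
    proof -
      have "{..<4::nat} = {0, 1, 2, 3}" by auto
      then show ?thesis by (simp add: D_def d0 fact_numeral)
    qed
    then have "E e = D 4 s / 24 * e ^ 4"
      using s(3) by (simp add: E_def fact_numeral)
    then have "\<bar>E e\<bar> = \<bar>D 4 s / 24\<bar> * e ^ 4"
      using e by (simp only: abs_mult) simp
    moreover have "\<bar>D 4 s\<bar> \<le> 2 * M"
      using d4[of "x + s"] d4[of "x - s"] s e h unfolding D_def by simp
    then have "\<bar>D 4 s / 24\<bar> * e ^ 4 \<le> M / 12 * e ^ 4"
      by (intro mult_right_mono) auto
    ultimately show ?thesis by linarith
  qed
  have cont: "continuous_on {0..h} (\<lambda>e. \<bar>E e\<bar> - M / 12 * e ^ 4)"
  proof -
    have "continuous_on {0..h} (\<lambda>e. v (x + e))"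
      using h by (intro continuous_on_compose2[OF C4_fun_continuous[OF v]] continuous_intros) auto
    moreover have "continuous_on {0..h} (\<lambda>e. v (x - e))"
      using h by (intro continuous_on_compose2[OF C4_fun_continuous[OF v]] continuous_intros) auto
    ultimately show ?thesis unfolding E_def by (intro continuous_intros)
  qed
  have "\<bar>E h\<bar> - M / 12 * h ^ 4 \<le> 0"
  proof -
    have "continuous_on (closure {0<..<h}) (\<lambda>e. \<bar>E e\<bar> - M / 12 * e ^ 4)" "h \<in> closure {0<..<h}"
      using cont h by simp_all
    then show ?thesis by (rule continuous_le_on_closure) (use int in auto)
  qed
  then have "\<bar>E h\<bar> / h\<^sup>2 \<le> M / 12 * h ^ 4 / h\<^sup>2"
    by (intro divide_right_mono) auto
  also have "\<dots> = M / 12 * h\<^sup>2" using h by (simp add: power_diff[of h 2 4, simplified] power2_eq_square power4_eq_xxxx)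
  also have "\<bar>E h\<bar> / h\<^sup>2 = \<bar>(v (x + h) - 2 * v x + v (x - h)) / h\<^sup>2 - d 2 x\<bar>"
  proof -
    have "E h / h\<^sup>2 = (v (x + h) - 2 * v x + v (x - h)) / h\<^sup>2 - d 2 x"
      using h by (simp add: E_def diff_divide_distrib add_divide_distrib)
    then show ?thesis by (metis abs_divide abs_power2)
  qed
  finally show ?thesis by (simp add: d_def)
qed

lemma continuous_agree_on_Icc:
  fixes f g :: "real \<Rightarrow> real"
  assumes "continuous_on {a..b} f" "continuous_on {a..b} g" "a < b"
    and "\<And>x. x \<in> {a<..<b} \<Longrightarrow> f x = g x" and x: "x \<in> {a..b}"
  shows "f x = g x"
proof -
  have "continuous_on (closure {a<..<b}) (\<lambda>x. f x - g x)"
    using assms by (auto intro!: continuous_intros)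
  then have "f x - g x = 0"
    by (rule continuous_constant_on_closure) (use assms in auto)
  then show ?thesis by simp
qed


section \<open>Quadrature error and weighted sums\<close>

lemma trunc_power_continuous: "0 < p \<Longrightarrow> continuous_on S f \<Longrightarrow> continuous_on S (\<lambda>x. trunc_power p (f x))"
  unfolding trunc_power_def
  using less_imp_neq[OF Gamma_real_pos[of "p + 1"]]
  by (intro continuous_intros continuous_on_powr') auto

lemma trunc_power_mult: "0 < c \<Longrightarrow> trunc_power p (c * x) = c powr p * trunc_power p x"
  by (simp add: trunc_power_def max_def powr_mult zero_le_mult_iff)

lemma trunc_power_one: "trunc_power 1 x = max 0 x"
  by (simp add: trunc_power_def Gamma_numeral max_def)

lemma frac_int_trunc_power:
  assumes p: "0 < p" and t: "0 \<le> t" "t \<le> L" and w: "continuous_on {0..L} w"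
  shows "((\<lambda>s. trunc_power p (t - s) * w s) has_integral frac_int (p + 1) w t) {0..L}"
proof -
  let ?f = "\<lambda>s. trunc_power p (t - s) * w s"
  have w': "continuous_on {0..t} w" using w t by (auto intro: continuous_on_subset)
  have "?f integrable_on {0..t}"
    using p w' by (intro integrable_continuous_real continuous_intros trunc_power_continuous)
  then have "(?f has_integral integral {0..t} ?f) {0..t}" by (rule integrable_integral)
  then have "((\<lambda>s. if s \<in> {0..t} then ?f s else 0) has_integral integral {0..t} ?f) {0..L}"
    using t by (subst has_integral_restrict) auto
  then have "(?f has_integral integral {0..t} ?f) {0..L}"
    by (rule has_integral_eq[rotated]) auto
  moreover have "integral {0..t} ?f = frac_int (p + 1) w t"
  proof -
    have "integral {0..t} ?f = integral {0..t} (\<lambda>s. 1 / Gamma (p + 1) * ((t - s) powr (p + 1 - 1) * w s))"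
      by (rule integral_cong) (simp add: trunc_power_def)
    then show ?thesis by (simp only: frac_int_def integral_mult_right)
  qed
  ultimately show ?thesis by simp
qed

text \<open>
  The error is an integral against a Peano kernel: both fractional integrals of \<open>w\<close> are integrals
  against truncated powers, and summing them over the grid turns these into the two splines at
  \<open>(t\<^sub>n - s) / \<tau>\<close>. The kernel is thus \<open>\<tau> powr (c + 1)\<close> times the difference of the
  splines, and its integral contributes one further factor \<open>\<tau>\<close> because that difference is integrable
  uniformly in \<open>n\<close>.
\<close>

lemma quadrature_error_bound:
  assumes c: "1 < c" "c < 2"
  shows "\<exists>C\<ge>0. \<forall>\<tau> n M w. 0 < \<tau> \<longrightarrow> continuous_on {0..real n * \<tau>} w \<longrightarrow>
     (\<forall>s\<in>{0..real n * \<tau>}. \<bar>w s\<bar> \<le> M) \<longrightarrow>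
     \<bar>(\<Sum>k\<le>n. scheme_alpha c (n - k) * frac_int (c + 2) w (real k * \<tau>))
       - \<tau> powr c * (\<Sum>k\<le>n. scheme_theta c (n - k) * frac_int 2 w (real k * \<tau>))\<bar>
     \<le> C * M * \<tau> powr (c + 2)"
proof -
  obtain K where K: "\<And>r. 0 \<le> r \<Longrightarrow> \<bar>frac_spline c (c + 1) r - trapezoid_spline c r\<bar> \<le> K * (1 + r) powr (- c)"
    using spline_kernel_decay[OF c] by blast
  have K0: "0 \<le> K" using K[of 0] by simp
  have "\<bar>(\<Sum>k\<le>n. scheme_alpha c (n - k) * frac_int (c + 2) w (real k * \<tau>))
       - \<tau> powr c * (\<Sum>k\<le>n. scheme_theta c (n - k) * frac_int 2 w (real k * \<tau>))\<bar>
     \<le> K / (c - 1) * M * \<tau> powr (c + 2)"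
    if \<tau>: "0 < \<tau>" and w: "continuous_on {0..real n * \<tau>} w" and M: "\<forall>s\<in>{0..real n * \<tau>}. \<bar>w s\<bar> \<le> M"
    for \<tau> n M w
  proof -
    define L where "L = real n * \<tau>"
    have L0: "0 \<le> L" using \<tau> by (simp add: L_def)
    have M0: "0 \<le> M" using bspec[OF M, of 0] \<tau> by simp
    \<comment> \<open>In the variable \<open>R s\<close> the grid points are the integers up to \<open>n\<close>.\<close>
    define R where "R = (\<lambda>s. (L - s) / \<tau>)"
    have node: "real k * \<tau> - s = \<tau> * (R s - real (n - k))" if "k \<le> n" for k s
    proof -
      have "\<tau> * R s = L - s" using \<tau> by (simp add: R_def)
      then show ?thesis using that by (simp add: L_def of_nat_diff right_diff_distrib algebra_simps)
    qed
    have tk: "0 \<le> real k * \<tau>" "real k * \<tau> \<le> L" if "k \<le> n" for k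
      using that \<tau> by (auto simp: L_def)
    let ?E = "(\<Sum>k\<le>n. scheme_alpha c (n - k) * frac_int (c + 2) w (real k * \<tau>))
       - \<tau> powr c * (\<Sum>k\<le>n. scheme_theta c (n - k) * frac_int 2 w (real k * \<tau>))"
    let ?f = "\<lambda>s. (\<Sum>k\<le>n. scheme_alpha c (n - k) * (trunc_power (c + 1) (real k * \<tau> - s) * w s))
       - \<tau> powr c * (\<Sum>k\<le>n. scheme_theta c (n - k) * (trunc_power 1 (real k * \<tau> - s) * w s))"
    have f: "(?f has_integral ?E) {0..L}"
    proof (intro has_integral_diff has_integral_sum has_integral_mult_right)
      fix k assume "k \<in> {..n}"
      then show "((\<lambda>s. trunc_power (c + 1) (real k * \<tau> - s) * w s) has_integral frac_int (c + 2) w (real k * \<tau>)) {0..L}"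
        "((\<lambda>s. trunc_power 1 (real k * \<tau> - s) * w s) has_integral frac_int 2 w (real k * \<tau>)) {0..L}"
        using frac_int_trunc_power[of "c + 1" "real k * \<tau>" L w] frac_int_trunc_power[of 1 "real k * \<tau>" L w]
          tk[of k] w c by (simp_all add: L_def add_ac)
    qed auto
    have max_mult: "max 0 (\<tau> * z) = \<tau> * max 0 z" for z
      using \<tau> by (simp add: max_def zero_le_mult_iff)
    have f_eq: "?f s = \<tau> powr (c + 1) * (frac_spline c (c + 1) (R s) - trapezoid_spline c (R s)) * w s"
      if s: "s \<in> {0..L}" for s
    proof -
      have Rn: "R s \<le> real n" using s \<tau> by (simp add: R_def L_def field_simps)
      have "(\<Sum>k\<le>n. scheme_alpha c (n - k) * (trunc_power (c + 1) (real k * \<tau> - s) * w s))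
          = (\<Sum>k\<le>n. scheme_alpha c (n - k) * (\<tau> powr (c + 1) * trunc_power (c + 1) (R s - real (n - k)) * w s))"
        using \<tau> by (intro sum.cong refl) (simp add: node trunc_power_mult del: of_nat_diff)
      also have "\<dots> = (\<Sum>k\<le>n. scheme_alpha c k * (\<tau> powr (c + 1) * trunc_power (c + 1) (R s - real k) * w s))"
        by (rule sum.reindex_bij_witness[of _ "\<lambda>k. n - k" "\<lambda>k. n - k"]) auto
      also have "\<dots> = \<tau> powr (c + 1) * frac_spline c (c + 1) (R s) * w s"
        unfolding frac_spline_eq[OF Rn] by (simp add: sum_distrib_left sum_distrib_right mult_ac)
      finally have 1: "(\<Sum>k\<le>n. scheme_alpha c (n - k) * (trunc_power (c + 1) (real k * \<tau> - s) * w s))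
          = \<tau> powr (c + 1) * frac_spline c (c + 1) (R s) * w s" .
      have "(\<Sum>k\<le>n. scheme_theta c (n - k) * (trunc_power 1 (real k * \<tau> - s) * w s))
          = (\<Sum>k\<le>n. scheme_theta c (n - k) * (\<tau> * max 0 (R s - real (n - k)) * w s))"
        using \<tau> by (intro sum.cong refl) (simp add: node trunc_power_one max_mult del: of_nat_diff)
      also have "\<dots> = (\<Sum>k\<le>n. scheme_theta c k * (\<tau> * max 0 (R s - real k) * w s))"
        by (rule sum.reindex_bij_witness[of _ "\<lambda>k. n - k" "\<lambda>k. n - k"]) auto
      also have "\<dots> = \<tau> * trapezoid_spline c (R s) * w s"
        unfolding trapezoid_spline_eq[OF Rn] by (simp add: sum_distrib_left sum_distrib_right mult_ac)
      finally have 2: "(\<Sum>k\<le>n. scheme_theta c (n - k) * (trunc_power 1 (real k * \<tau> - s) * w s))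
          = \<tau> * trapezoid_spline c (R s) * w s" .
      have "\<tau> powr (c + 1) = \<tau> powr c * \<tau>" using \<tau> by (simp add: powr_add)
      then show ?thesis unfolding 1 2 by (simp add: algebra_simps)
    qed
    have g: "((\<lambda>s. (1 + R s) powr (- c)) has_integral
        \<tau> / (c - 1) * (1 + R L) powr (1 - c) - \<tau> / (c - 1) * (1 + R 0) powr (1 - c)) {0..L}"
    proof (rule fundamental_theorem_of_calculus[OF L0])
      fix s assume s: "s \<in> {0..L}"
      have "1 + R s > 0" using s \<tau> by (simp add: R_def add_pos_nonneg)
      moreover have "((\<lambda>s. 1 + R s) has_real_derivative - 1 / \<tau>) (at s within {0..L})"
        unfolding R_def using \<tau> by (auto intro!: derivative_eq_intros)
      ultimately have "((\<lambda>s. \<tau> / (c - 1) * (1 + R s) powr (1 - c)) has_real_derivative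
          \<tau> / (c - 1) * ((1 - c) * (1 + R s) powr (1 - c - 1) * (- 1 / \<tau>))) (at s within {0..L})"
        by (intro DERIV_cmult DERIV_chain2[OF has_real_derivative_powr])
      moreover have "\<tau> / (c - 1) * ((1 - c) * (1 + R s) powr (1 - c - 1) * (- 1 / \<tau>)) = (1 + R s) powr (- c)"
      proof -
        have "\<tau> / (c - 1) * ((1 - c) * (- 1 / \<tau>)) = 1" using \<tau> c by (simp add: field_simps)
        moreover have "\<tau> / (c - 1) * ((1 - c) * (1 + R s) powr (1 - c - 1) * (- 1 / \<tau>))
            = \<tau> / (c - 1) * ((1 - c) * (- 1 / \<tau>)) * (1 + R s) powr (1 - c - 1)"
          by (simp only: mult_ac)
        ultimately show ?thesis by simp
      qed
      ultimately show "((\<lambda>s. \<tau> / (c - 1) * (1 + R s) powr (1 - c)) has_vector_derivative (1 + R s) powr (- c)) (at s within {0..L})"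
        by (simp only: has_real_derivative_iff_has_vector_derivative)
    qed
    have g_le: "integral {0..L} (\<lambda>s. (1 + R s) powr (- c)) \<le> \<tau> / (c - 1)"
    proof -
      have "0 \<le> \<tau> / (c - 1) * (1 + R 0) powr (1 - c)" using \<tau> c by simp
      then show ?thesis using integral_unique[OF g] by (simp add: R_def)
    qed
    have "\<bar>?E\<bar> = norm (integral {0..L} ?f)"
      using f by (simp add: integral_unique)
    also have "\<dots> \<le> integral {0..L} (\<lambda>s. \<tau> powr (c + 1) * K * M * (1 + R s) powr (- c))"
    proof (rule integral_norm_bound_integral)
      show "?f integrable_on {0..L}" using f by (auto simp: integrable_on_def)
      show "(\<lambda>s. \<tau> powr (c + 1) * K * M * (1 + R s) powr (- c)) integrable_on {0..L}"
        using g by (intro integrable_on_mult_right) (auto simp: integrable_on_def)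
      fix s assume s: "s \<in> {0..L}"
      have "0 \<le> R s" using s \<tau> by (simp add: R_def)
      have "norm (?f s) = \<tau> powr (c + 1) * (\<bar>frac_spline c (c + 1) (R s) - trapezoid_spline c (R s)\<bar> * \<bar>w s\<bar>)"
        unfolding f_eq[OF s] by (simp add: abs_mult mult_ac)
      also have "\<dots> \<le> \<tau> powr (c + 1) * ((K * (1 + R s) powr (- c)) * M)"
        using K[OF \<open>0 \<le> R s\<close>] M s K0 by (intro mult_left_mono mult_mono) (auto simp: L_def)
      finally show "norm (?f s) \<le> \<tau> powr (c + 1) * K * M * (1 + R s) powr (- c)"
        by (simp add: mult_ac)
    qed
    also have "\<dots> = \<tau> powr (c + 1) * K * M * integral {0..L} (\<lambda>s. (1 + R s) powr (- c))"
      by (simp only: integral_mult_right)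
    also have "\<dots> \<le> \<tau> powr (c + 1) * K * M * (\<tau> / (c - 1))"
      using g_le K0 M0 by (intro mult_left_mono) auto
    also have "\<dots> = K / (c - 1) * M * (\<tau> powr (c + 1) * \<tau>)" by simp
    also have "\<tau> powr (c + 1) * \<tau> = \<tau> powr (c + 2)"
      using \<tau> powr_add[of \<tau> "c + 1" 1] by (simp add: add_ac)
    finally show ?thesis .
  qed
  then show ?thesis using K0 c by (intro exI[of _ "K / (c - 1)"]) auto
qed

text \<open>
  Up to the factor \<open>2 powr (- c)\<close> the weights are \<open>scheme_alpha c\<close> in absolute value, and only
  \<open>scheme_alpha c 1 = - c\<close> is negative. So the sum is a signed sum, which is a coefficient of
  \<open>(1 - z)\<^sup>c\<^sup>-\<^sup>1\<close>, plus a correction for \<open>k = 1\<close>.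
\<close>

lemma scheme_theta_abs_sum:
  assumes c: "1 < c" "c < 2"
  shows "(\<Sum>k\<le>n. \<bar>scheme_theta c k\<bar>) \<le> 2 * c + 1"
proof -
  have "(\<Sum>k\<le>n. \<bar>scheme_theta c k\<bar>) \<le> (\<Sum>k\<le>n. scheme_alpha c k + (if k = 1 then 2 * c else 0))"
  proof (rule sum_mono)
    fix k
    have "\<bar>scheme_theta c k\<bar> = 2 powr (- c) * \<bar>scheme_alpha c k\<bar>"
      by (simp add: scheme_theta_def abs_mult power_abs)
    also have "\<dots> \<le> 1 * \<bar>scheme_alpha c k\<bar>"
      using c by (intro mult_right_mono) (auto simp: powr_minus inverse_le_1_iff ge_one_powr_ge_zero)
    also have "1 * \<bar>scheme_alpha c k\<bar> \<le> scheme_alpha c k + (if k = 1 then 2 * c else 0)"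
    proof -
      consider "k = 0" | "k = 1" | "2 \<le> k" by linarith
      then show ?thesis
      proof cases
        case 2
        then show ?thesis using scheme_alpha_Suc[of 0 c] c by simp
      next
        case 3
        then show ?thesis using scheme_alpha_nonneg_tail[OF c] by simp
      qed simp
    qed
    finally show "\<bar>scheme_theta c k\<bar> \<le> scheme_alpha c k + (if k = 1 then 2 * c else 0)" .
  qed
  also have "\<dots> = (\<Sum>k\<le>n. scheme_alpha (-1) (n - k) * scheme_alpha c k) + (\<Sum>k\<le>n. if k = 1 then 2 * c else 0)"
    by (simp add: sum.distrib scheme_alpha_minus1)
  also have "(\<Sum>k\<le>n. scheme_alpha (-1) (n - k) * scheme_alpha c k) = scheme_alpha (c - 1) n"
    using scheme_alpha_convolution[of "-1" n c] by simp
  also have "\<dots> \<le> 1"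
  proof (cases n)
    case (Suc m)
    have "\<bar>(c - 1) gchoose Suc m\<bar> \<le> real (Suc m) powr (- (c - 1) - 1)"
      using c by (intro gchoose_decay) auto
    also have "\<dots> \<le> real (Suc m) powr 0" using c by (intro powr_mono) auto
    finally have "\<bar>scheme_alpha (c - 1) n\<bar> \<le> 1"
      by (simp add: Suc scheme_alpha_def abs_mult power_abs)
    then show ?thesis by simp
  qed simp
  also have "(\<Sum>k\<le>n. if k = 1 then 2 * c else 0) \<le> 2 * c" using c by simp
  finally show ?thesis by simp
qed

text \<open>
  These sums are values of fractional splines at integers. The first spline is a backward
  difference of \<open>frac_spline (c - 1) c\<close>, the second grows linearly.
\<close>

lemma scheme_alpha_power_sum_bounds:
  assumes c: "1 < c" "c < 2"
  shows "\<exists>C\<ge>0. \<forall>\<tau> n. 0 < \<tau> \<longrightarrow> 1 \<le> n \<longrightarrow>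
     \<bar>\<Sum>k\<le>n. scheme_alpha c (n - k) * ((real k * \<tau>) powr c / Gamma (c + 1))\<bar> \<le> C * \<tau> powr c \<and>
     \<bar>\<Sum>k\<le>n. scheme_alpha c (n - k) * ((real k * \<tau>) powr (c + 1) / Gamma (c + 2))\<bar>
       \<le> C * \<tau> powr c * (real n * \<tau> + \<tau>)"
proof -
  define B where "B = 3 / (c - 1) + 3"
  have B0: "3 \<le> B" using c by (simp add: B_def)
  define g where "g = c - 1"
  have g: "0 < g" "g < 1" "g + 1 = c" using c by (auto simp: g_def)
  have e0: "\<bar>spline_err g r\<bar> \<le> B" if "0 \<le> r" for r
    using spline_err_bounded_base[OF g(1,2) that] by (simp add: B_def g_def)
  have e1: "\<bar>spline_err c r\<bar> \<le> B" if "1 \<le> r" for r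
    using spline_err_bounded_step[of g 0 B r] e0 g that by simp
  have scale: "(\<Sum>k\<le>n. scheme_alpha c (n - k) * ((real k * \<tau>) powr p / Gamma (p + 1))) = \<tau> powr p * frac_spline c p (real n)"
    if "0 < \<tau>" for \<tau> n p
    unfolding frac_spline_nat sum_distrib_left using that
    by (intro sum.cong refl) (simp add: trunc_power_def powr_mult)
  have "\<bar>frac_spline c c (real n)\<bar> \<le> 2 * B + 1" if "1 \<le> n" for n :: nat
  proof -
    have "frac_spline (g + 1) (g + 1) (real n) = spline_err g (real n) - spline_err g (real n - 1) + 1"
      unfolding frac_spline_plus1 spline_err_def by simp
    moreover have "\<bar>spline_err g (real n)\<bar> \<le> B" "\<bar>spline_err g (real n - 1)\<bar> \<le> B"
      using e0 that by auto
    ultimately show ?thesis using g by simp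
  qed
  note b1 = this
  have b2: "\<bar>frac_spline c (c + 1) (real n)\<bar> \<le> (2 * B + 1) * (real n + 1)" if "1 \<le> n" for n :: nat
  proof -
    have "\<bar>frac_spline c (c + 1) (real n)\<bar> \<le> B + real n + c / 2"
      using e1[of "real n"] that c unfolding spline_err_def by linarith
    also have "\<dots> \<le> (2 * B + 1) * 1 + (2 * B + 1) * real n"
      using B0 c mult_right_mono[of 1 "2 * B + 1" "real n"] by simp
    finally show ?thesis by (simp add: algebra_simps)
  qed
  show ?thesis
  proof (intro exI[of _ "2 * B + 1"] conjI allI impI)
    show "0 \<le> 2 * B + 1" using B0 by simp
    fix \<tau> :: real and n :: nat assume \<tau>: "0 < \<tau>" and n: "1 \<le> n"
    show "\<bar>\<Sum>k\<le>n. scheme_alpha c (n - k) * ((real k * \<tau>) powr c / Gamma (c + 1))\<bar> \<le> (2 * B + 1) * \<tau> powr c"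
      unfolding scale[OF \<tau>] using mult_left_mono[OF b1[OF n], of "\<tau> powr c"] by (simp add: abs_mult mult.commute)
    have "\<bar>\<Sum>k\<le>n. scheme_alpha c (n - k) * ((real k * \<tau>) powr (c + 1) / Gamma (c + 1 + 1))\<bar>
       = \<tau> powr (c + 1) * \<bar>frac_spline c (c + 1) (real n)\<bar>"
      unfolding scale[OF \<tau>] by (simp add: abs_mult)
    also have "\<dots> \<le> \<tau> powr (c + 1) * ((2 * B + 1) * (real n + 1))"
      using b2[OF n] by (intro mult_left_mono) auto
    also have "\<tau> powr (c + 1) = \<tau> powr c * \<tau>" using \<tau> by (simp add: powr_add)
    finally show "\<bar>\<Sum>k\<le>n. scheme_alpha c (n - k) * ((real k * \<tau>) powr (c + 1) / Gamma (c + 2))\<bar>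
       \<le> (2 * B + 1) * \<tau> powr c * (real n * \<tau> + \<tau>)"
      by (simp add: algebra_simps)
  qed
qed


section \<open>The exact solution\<close>

lemma within_Icc_bound:
  fixes f :: "real \<Rightarrow> real"
  assumes "\<And>s. s \<in> {0..T} \<Longrightarrow> (f has_real_derivative f' s) (at s within {0..T})"
    and "\<And>s. s \<in> {0..T} \<Longrightarrow> \<bar>f' s\<bar> \<le> B" and t: "t \<in> {0..T}"
  shows "\<bar>f t\<bar> \<le> \<bar>f 0\<bar> + B * T"
proof -
  have B: "0 \<le> B" using assms(2)[OF t] by simp
  have "norm (f t - f 0) \<le> B * norm (t - 0)"
    using assms by (intro field_differentiable_bound[of "{0..T}" f f' B]) auto
  also have "\<dots> \<le> B * T" using t B by (intro mult_left_mono) auto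
  finally show ?thesis by simp
qed

text \<open>
  What the regularity of \<open>U\<close> provides at a fixed point of space, with one bound \<open>M\<close> for everything.
  The bounds on the fourth derivatives of \<open>U\<close> and \<open>W1\<close> come from that of \<open>W2\<close> by integrating
  twice in time.
\<close>

lemma C2_C4_pointwise:
  assumes ab: "a < b" and T: "0 < T" and U: "C2_C4 a b T U"
  obtains W1 W2 M where
    "\<And>t. t \<in> {0..T} \<Longrightarrow> C4_fun a b (\<lambda>x. U x t)" "C4_fun a b (W1 0)"
    "\<And>i x t. i \<le> 4 \<Longrightarrow> x \<in> {a<..<b} \<Longrightarrow> t \<in> {0..T} \<Longrightarrow>
       ((\<lambda>s. (deriv ^^ i) (\<lambda>x. U x s) x) has_real_derivative (deriv ^^ i) (W1 t) x) (at t within {0..T})"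
    "\<And>i x t. i \<le> 4 \<Longrightarrow> x \<in> {a<..<b} \<Longrightarrow> t \<in> {0..T} \<Longrightarrow>
       ((\<lambda>s. (deriv ^^ i) (W1 s) x) has_real_derivative (deriv ^^ i) (W2 t) x) (at t within {0..T})"
    "\<And>i x. i \<le> 4 \<Longrightarrow> x \<in> {a<..<b} \<Longrightarrow> continuous_on {0..T} (\<lambda>t. (deriv ^^ i) (W2 t) x)"
    "\<And>i x t. i \<le> 4 \<Longrightarrow> x \<in> {a<..<b} \<Longrightarrow> t \<in> {0..T} \<Longrightarrow> \<bar>(deriv ^^ i) (W2 t) x\<bar> \<le> M"
    "\<And>x t. x \<in> {a<..<b} \<Longrightarrow> t \<in> {0..T} \<Longrightarrow> \<bar>(deriv ^^ 4) (\<lambda>y. U y t) x\<bar> \<le> M"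
    "\<And>x. x \<in> {a<..<b} \<Longrightarrow> \<bar>(deriv ^^ 4) (W1 0) x\<bar> \<le> M"
proof -
  obtain W1 W2 where W:
    "\<And>t. t \<in> {0..T} \<Longrightarrow> C4_fun a b (\<lambda>x. U x t)"
    "\<And>t. t \<in> {0..T} \<Longrightarrow> C4_fun a b (W1 t)" "\<And>t. t \<in> {0..T} \<Longrightarrow> C4_fun a b (W2 t)"
    and d1: "\<And>t. t \<in> {0..T} \<Longrightarrow> has_C4_derivative a b (\<lambda>s x. U x s) (W1 t) t {0..T}"
    and d2: "\<And>t. t \<in> {0..T} \<Longrightarrow> has_C4_derivative a b W1 (W2 t) t {0..T}"
    and cont: "C4_continuous_on a b {0..T} W2"
    using U unfolding C2_C4_def by blast
  have 0: "(0::real) \<in> {0..T}" using T by simp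
  have D1: "((\<lambda>s. (deriv ^^ i) (\<lambda>x. U x s) x) has_real_derivative (deriv ^^ i) (W1 t) x) (at t within {0..T})"
    if "i \<le> 4" "x \<in> {a<..<b}" "t \<in> {0..T}" for i x t
    using W that d1 by (intro has_C4_derivative_pointwise[where W = "\<lambda>s x. U x s"]) auto
  have D2: "((\<lambda>s. (deriv ^^ i) (W1 s) x) has_real_derivative (deriv ^^ i) (W2 t) x) (at t within {0..T})"
    if "i \<le> 4" "x \<in> {a<..<b}" "t \<in> {0..T}" for i x t
    using W that d2 by (intro has_C4_derivative_pointwise) auto
  have C: "continuous_on {0..T} (\<lambda>t. (deriv ^^ i) (W2 t) x)" if "i \<le> 4" "x \<in> {a<..<b}" for i x
    using W(3) cont that by (intro C4_continuous_deriv_continuous) auto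
  obtain M2 where M2: "\<forall>t\<in>{0..T}. \<forall>i\<le>4. \<forall>x\<in>{a<..<b}. \<bar>(deriv ^^ i) (W2 t) x\<bar> \<le> M2"
    using C4_continuous_deriv_bound[OF ab W(3) cont] by blast
  define M1 where "M1 = C4_norm a b (W1 0) + M2 * T"
  have M1: "\<bar>(deriv ^^ 4) (W1 t) x\<bar> \<le> M1" if "x \<in> {a<..<b}" "t \<in> {0..T}" for x t
  proof -
    have "\<bar>(deriv ^^ 4) (W1 t) x\<bar> \<le> \<bar>(deriv ^^ 4) (W1 0) x\<bar> + M2 * T"
      using that M2 D2 by (intro within_Icc_bound[where f = "\<lambda>s. (deriv ^^ 4) (W1 s) x" and f' = "\<lambda>s. (deriv ^^ 4) (W2 s) x"]) auto
    then show ?thesis using deriv_le_C4_norm[OF W(2)[OF 0], of 4 x] that(1) by (simp add: M1_def)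
  qed
  define M0 where "M0 = C4_norm a b (\<lambda>x. U x 0) + M1 * T"
  have M0: "\<bar>(deriv ^^ 4) (\<lambda>y. U y t) x\<bar> \<le> M0" if "x \<in> {a<..<b}" "t \<in> {0..T}" for x t
  proof -
    have "\<bar>(deriv ^^ 4) (\<lambda>y. U y t) x\<bar> \<le> \<bar>(deriv ^^ 4) (\<lambda>y. U y 0) x\<bar> + M1 * T"
      using that M1 D1 by (intro within_Icc_bound[where f = "\<lambda>s. (deriv ^^ 4) (\<lambda>y. U y s) x" and f' = "\<lambda>s. (deriv ^^ 4) (W1 s) x"]) auto
    then show ?thesis using deriv_le_C4_norm[OF W(1)[OF 0], of 4 x] that(1) by (simp add: M0_def)
  qed
  define M where "M = max M0 (max M1 M2)"
  have "M0 \<le> M" "M1 \<le> M" "M2 \<le> M" by (auto simp: M_def)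
  show ?thesis
  proof (rule that[of W1 W2 M])
    show "\<bar>(deriv ^^ i) (W2 t) x\<bar> \<le> M" if "i \<le> 4" "x \<in> {a<..<b}" "t \<in> {0..T}" for i x t
    proof -
      have "\<bar>(deriv ^^ i) (W2 t) x\<bar> \<le> M2" using M2 that by simp
      then show ?thesis using \<open>M2 \<le> M\<close> by linarith
    qed
    show "\<bar>(deriv ^^ 4) (\<lambda>y. U y t) x\<bar> \<le> M" if "x \<in> {a<..<b}" "t \<in> {0..T}" for x t
      using M0[OF that] \<open>M0 \<le> M\<close> by linarith
    show "\<bar>(deriv ^^ 4) (W1 0) x\<bar> \<le> M" if "x \<in> {a<..<b}" for x
      using M1[OF that 0] \<open>M1 \<le> M\<close> by linarith
  qed (fact W(1) W(2)[OF 0] D1 D2 C)+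
qed

text \<open>
  The iterated \<open>deriv\<close> in the Caputo derivative is two-sided; it agrees with the one-sided second
  derivative \<open>w\<close> inside the interval, which is enough for the integral.
\<close>

lemma caputo_eq_frac_int:
  assumes u: "\<And>s. s \<in> {0..T} \<Longrightarrow> (u has_real_derivative u1 s) (at s within {0..T})"
    and u1: "\<And>s. s \<in> {0..T} \<Longrightarrow> (u1 has_real_derivative w s) (at s within {0..T})"
    and t: "t \<le> T"
  shows "caputo \<beta> u t = frac_int (2 - \<beta>) w t"
proof -
  have du: "(u has_real_derivative u1 s) (at s)" "(u1 has_real_derivative w s) (at s)" if "s \<in> {0<..<T}" for s
  proof -
    have s: "s \<in> {0..T}" and "at s within {0..T} = at s"
      using that by (auto intro!: at_within_interior)
    then show "(u has_real_derivative u1 s) (at s)" "(u1 has_real_derivative w s) (at s)"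
      using u[OF s] u1[OF s] by (simp_all only:)
  qed
  have "caputo \<beta> u t = frac_int (2 - \<beta>) ((deriv ^^ 2) u) t"
    by (simp add: caputo_def frac_int_def)
  also have "\<dots> = frac_int (2 - \<beta>) w t"
  proof (rule frac_int_cong)
    fix s assume s: "0 < s" "s < t"
    then have s': "s \<in> {0<..<T}" using t by simp
    have eq: "u1 r = deriv u r" if "r \<in> {0<..<T}" for r
      using DERIV_imp_deriv[OF du(1)[OF that]] by simp
    have "(deriv u has_real_derivative w s) (at s)"
      by (rule has_field_derivative_transform_within_open[OF du(2)[OF s'] _ s' eq]) simp_all
    then have "deriv (deriv u) s = w s" by (rule DERIV_imp_deriv)
    then show "(deriv ^^ 2) u s = w s" by (simp add: numeral_2_eq_2)
  qed
  finally show ?thesis .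
qed

text \<open>
  Integrating the equation with order \<open>\<beta>\<close>: the Caputo term becomes a fractional integral of order
  \<open>\<beta> + (2 - \<beta>) = 2\<close> of the second time derivative, that is, the Taylor remainder of \<open>u\<close>. The
  Taylor polynomial of \<open>y\<close> is integrated separately because the scheme treats it exactly.
\<close>

lemma frac_int_source:
  assumes \<beta>: "1 < \<beta>" "\<beta> < 2" and t: "t \<in> {0..T}"
    and eq: "\<And>s. s \<in> {0<..T} \<Longrightarrow> caputo \<beta> u s = \<mu> * y s + f s"
    and u: "\<And>s. s \<in> {0..T} \<Longrightarrow> (u has_real_derivative u1 s) (at s within {0..T})"
      "\<And>s. s \<in> {0..T} \<Longrightarrow> (u1 has_real_derivative wu s) (at s within {0..T})"
      "continuous_on {0..T} wu"
    and y: "\<And>s. s \<in> {0..T} \<Longrightarrow> (y has_real_derivative y1 s) (at s within {0..T})"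
      "\<And>s. s \<in> {0..T} \<Longrightarrow> (y1 has_real_derivative wy s) (at s within {0..T})"
      "continuous_on {0..T} wy"
  shows "frac_int \<beta> f t = u t - u 0 - u1 0 * t
    - \<mu> * (y 0 * t powr \<beta> / Gamma (\<beta> + 1) + y1 0 * t powr (\<beta> + 1) / Gamma (\<beta> + 2) + frac_int (\<beta> + 2) wy t)"
proof -
  have t0: "0 \<le> t" "t \<le> T" using t by auto
  have cont: "continuous_on {0..t} wu" "continuous_on {0..t} wy"
    using u(3) y(3) t0 by (auto intro: continuous_on_subset)
  have ytay: "y s = y 0 + y1 0 * s + frac_int 2 wy s" if "0 \<le> s" "s \<le> t" for s
    by (rule taylor_frac_int[OF y(1,2)]) (use that t0 in auto)
  note Y = frac_int_taylor[of \<beta> t wy y "y 0" "y1 0", OF _ t0(1) cont(2) ytay]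
  have "frac_int \<beta> f t = frac_int \<beta> (\<lambda>s. frac_int (2 - \<beta>) wu s - \<mu> * y s) t"
  proof (rule frac_int_cong)
    fix s assume s: "0 < s" "s < t"
    then have "caputo \<beta> u s = frac_int (2 - \<beta>) wu s"
      using t0 by (intro caputo_eq_frac_int[OF u(1,2)]) auto
    then show "f s = frac_int (2 - \<beta>) wu s - \<mu> * y s" using eq[of s] s t0 by simp
  qed
  also have "\<dots> = frac_int \<beta> (frac_int (2 - \<beta>) wu) t - \<mu> * frac_int \<beta> y t"
  proof -
    have i1: "(\<lambda>s. (t - s) powr (\<beta> - 1) * frac_int (2 - \<beta>) wu s) integrable_on {0..t}"
      by (rule frac_int_semigroup(2)) (use \<beta> t0 cont in simp_all)
    have i2: "(\<lambda>s. (t - s) powr (\<beta> - 1) * y s) integrable_on {0..t}"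
      using Y(2) \<beta> by simp
    have "integral {0..t} (\<lambda>s. (t - s) powr (\<beta> - 1) * (frac_int (2 - \<beta>) wu s - \<mu> * y s))
        = integral {0..t} (\<lambda>s. (t - s) powr (\<beta> - 1) * frac_int (2 - \<beta>) wu s - \<mu> * ((t - s) powr (\<beta> - 1) * y s))"
      by (rule integral_cong) (simp add: algebra_simps)
    also have "\<dots> = integral {0..t} (\<lambda>s. (t - s) powr (\<beta> - 1) * frac_int (2 - \<beta>) wu s)
        - \<mu> * integral {0..t} (\<lambda>s. (t - s) powr (\<beta> - 1) * y s)"
      using i1 i2 by (simp only: Henstock_Kurzweil_Integration.integral_diff integrable_on_mult_right integral_mult_right)
    finally show ?thesis unfolding frac_int_def[of \<beta>] by (simp add: right_diff_distrib)
  qed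
  also have "frac_int \<beta> (frac_int (2 - \<beta>) wu) t = frac_int (\<beta> + (2 - \<beta>)) wu t"
    by (rule frac_int_semigroup(1)) (use \<beta> t0 cont in simp_all)
  also have "frac_int (\<beta> + (2 - \<beta>)) wu t = u t - u 0 - u1 0 * t"
    using taylor_frac_int[OF u(1,2) t0] by simp
  finally show ?thesis using Y(1) \<beta> by simp
qed


section \<open>Consistency\<close>

lemma grid_x_mem:
  assumes "a < b" "i \<le> N" "0 < N"
  shows "grid_x a b N i \<in> {a..b}"
proof -
  have "real i * (b - a) \<le> real N * (b - a)" using assms by (intro mult_right_mono) auto
  then have "real i * (b - a) / real N \<le> b - a"
    using assms by (simp add: pos_divide_le_eq mult.commute)
  moreover have "0 \<le> real i * (b - a) / real N" using assms by simp
  ultimately show ?thesis by (simp add: grid_x_def space_step_def)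
qed

lemma delta2_grid:
  assumes "1 \<le> j"
  shows "delta2 (space_step a b N) (\<lambda>i. v (grid_x a b N i)) j =
     (v (grid_x a b N j + space_step a b N) - 2 * v (grid_x a b N j) + v (grid_x a b N j - space_step a b N))
       / (space_step a b N)\<^sup>2"
proof -
  have "grid_x a b N (j + 1) = grid_x a b N j + space_step a b N"
    "grid_x a b N (j - 1) = grid_x a b N j - space_step a b N"
    using assms by (auto simp: grid_x_def of_nat_diff algebra_simps)
  then show ?thesis by (simp only: delta2_def)
qed

lemma delta2_error:
  assumes ab: "a < b" and j: "1 \<le> j" "j < N" and v: "C4_fun a b v"
    and M: "\<And>y. y \<in> {a<..<b} \<Longrightarrow> \<bar>(deriv ^^ 4) v y\<bar> \<le> M"
  shows "\<bar>delta2 (space_step a b N) (\<lambda>i. v (grid_x a b N i)) j - (deriv ^^ 2) v (grid_x a b N j)\<bar>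
     \<le> M / 12 * (space_step a b N)\<^sup>2"
  unfolding delta2_grid[OF j(1)]
proof (rule second_difference_error[OF v M])
  have "grid_x a b N (j - 1) \<in> {a..b}" "grid_x a b N (j + 1) \<in> {a..b}"
    using ab j by (intro grid_x_mem; simp)+
  then show "a \<le> grid_x a b N j - space_step a b N" "grid_x a b N j + space_step a b N \<le> b"
    using j by (auto simp: grid_x_def of_nat_diff algebra_simps)
  show "0 < space_step a b N" using ab j by (simp add: space_step_def)
qed

lemma grid_x_interior:
  assumes "a < b" "1 \<le> j" "j < N"
  shows "grid_x a b N j \<in> {a<..<b}"
proof -
  have "0 < real j * (b - a)" "real j * (b - a) < real N * (b - a)"
    using assms by (auto intro!: mult_strict_right_mono)
  then show ?thesis using assms by (simp add: grid_x_def space_step_def field_simps)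
qed

lemma delta2_phi_low:
  "delta2 h (\<lambda>i. phi_low \<phi> \<psi> (x i) t) j = delta2 h (\<lambda>i. \<phi> (x i)) j + t * delta2 h (\<lambda>i. \<psi> (x i)) j"
  by (simp add: delta2_def phi_low_def add_divide_distrib diff_divide_distrib algebra_simps)

lemma delta2_Phi_up:
  "delta2 h (\<lambda>i. Phi_up \<beta> \<phi> \<psi> (x i) t) j =
     t powr \<beta> / Gamma (\<beta> + 1) * delta2 h (\<lambda>i. \<phi> (x i)) j + t powr (\<beta> + 1) / Gamma (\<beta> + 2) * delta2 h (\<lambda>i. \<psi> (x i)) j"
  by (simp add: delta2_def Phi_up_def add_divide_distrib diff_divide_distrib algebra_simps)

text \<open>
  At a grid point the integrated equation replaces the source term in the residual, and Taylor's
  formula in time replaces the second space derivative of the solution by the fractional integral of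
  order \<open>2\<close> of its second time derivative \<open>wy\<close>, up to a linear part that cancels. What remains is \<open>\<mu>\<close> times a quadrature error
  \<open>S1\<close> for \<open>wy\<close>, which is \<open>O(\<tau> powr (\<beta> + 2))\<close>, and weighted sums \<open>S2\<close>, \<open>S3\<close>,
  \<open>S4\<close> in which errors of second differences, each \<open>O(h\<^sup>2)\<close>, occur as entries or as
  factors.
\<close>

theorem theorem2:
  fixes \<beta> \<mu> a b T :: real
    and f U :: "real \<Rightarrow> real \<Rightarrow> real"
    and \<phi>0 \<psi>0 Ua Ub :: "real \<Rightarrow> real"
  assumes "1 < \<beta>" and "\<beta> < 2" and "\<mu> > 0" and "T > 0" and "a < b"
    and "wave_solution \<beta> \<mu> a b T f \<phi>0 \<psi>0 Ua Ub U"
    and "C2_C4 a b T U"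
  shows "scheme_consistent \<beta> \<mu> a b T f \<phi>0 \<psi>0 U"
proof -
  note \<beta> = assms(1,2) and \<mu> = assms(3) and T = assms(4) and ab = assms(5)
  obtain W1 W2 M where
    CU: "\<And>t. t \<in> {0..T} \<Longrightarrow> C4_fun a b (\<lambda>x. U x t)" and CW: "C4_fun a b (W1 0)"
    and D1: "\<And>i x t. i \<le> 4 \<Longrightarrow> x \<in> {a<..<b} \<Longrightarrow> t \<in> {0..T} \<Longrightarrow>
       ((\<lambda>s. (deriv ^^ i) (\<lambda>x. U x s) x) has_real_derivative (deriv ^^ i) (W1 t) x) (at t within {0..T})"
    and D2: "\<And>i x t. i \<le> 4 \<Longrightarrow> x \<in> {a<..<b} \<Longrightarrow> t \<in> {0..T} \<Longrightarrow>
       ((\<lambda>s. (deriv ^^ i) (W1 s) x) has_real_derivative (deriv ^^ i) (W2 t) x) (at t within {0..T})"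
    and D2c: "\<And>i x. i \<le> 4 \<Longrightarrow> x \<in> {a<..<b} \<Longrightarrow> continuous_on {0..T} (\<lambda>t. (deriv ^^ i) (W2 t) x)"
    and M2: "\<And>i x t. i \<le> 4 \<Longrightarrow> x \<in> {a<..<b} \<Longrightarrow> t \<in> {0..T} \<Longrightarrow> \<bar>(deriv ^^ i) (W2 t) x\<bar> \<le> M"
    and M4: "\<And>x t. x \<in> {a<..<b} \<Longrightarrow> t \<in> {0..T} \<Longrightarrow> \<bar>(deriv ^^ 4) (\<lambda>y. U y t) x\<bar> \<le> M"
    and M4': "\<And>x. x \<in> {a<..<b} \<Longrightarrow> \<bar>(deriv ^^ 4) (W1 0) x\<bar> \<le> M"
    using C2_C4_pointwise[OF ab T assms(7)] by blast
  have pde: "\<And>x t. x \<in> {a<..<b} \<Longrightarrow> t \<in> {0<..T} \<Longrightarrow> caputo \<beta> (U x) t = \<mu> * (deriv ^^ 2) (\<lambda>y. U y t) x + f x t"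
    and ini: "\<And>x. x \<in> {a<..<b} \<Longrightarrow> U x 0 = \<phi>0 x"
      "\<And>x. x \<in> {a<..<b} \<Longrightarrow> (U x has_real_derivative \<psi>0 x) (at 0 within {0..T})"
    and ini_cont: "continuous_on {a..b} \<phi>0" "continuous_on {a..b} \<psi>0"
    using assms(6) unfolding wave_solution_def by auto
  have T0: "0 \<in> {0..T}" using T by simp
  have nontriv: "at 0 within {0..T} \<noteq> bot" using T by (simp add: at_within_Icc_at_right)
  \<comment> \<open>The initial data at the endpoints of the interval are determined by continuity.\<close>
  have phi: "\<phi>0 x = U x 0" if "x \<in> {a..b}" for x
    using continuous_agree_on_Icc[OF ini_cont(1) C4_fun_continuous[OF CU[OF T0]] ab _ that] ini(1) by simp
  have psi: "\<psi>0 x = W1 0 x" if "x \<in> {a..b}" for x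
  proof (rule continuous_agree_on_Icc[OF ini_cont(2) C4_fun_continuous[OF CW] ab _ that])
    fix x assume x: "x \<in> {a<..<b}"
    have "(U x has_real_derivative W1 0 x) (at 0 within {0..T})"
      using D1[of 0 x 0] x T0 by simp
    then show "\<psi>0 x = W1 0 x"
      using ini(2)[OF x] tendsto_unique[OF nontriv] unfolding has_field_derivative_iff by blast
  qed
  have M0: "0 \<le> M"
    using M4'[of "(a + b) / 2"] ab by simp
  obtain C1 where C1: "0 \<le> C1" and quad: "\<And>\<tau> n M w. 0 < \<tau> \<Longrightarrow> continuous_on {0..real n * \<tau>} w \<Longrightarrow>
     (\<forall>s\<in>{0..real n * \<tau>}. \<bar>w s\<bar> \<le> M) \<Longrightarrow>
     \<bar>(\<Sum>k\<le>n. scheme_alpha \<beta> (n - k) * frac_int (\<beta> + 2) w (real k * \<tau>))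
       - \<tau> powr \<beta> * (\<Sum>k\<le>n. scheme_theta \<beta> (n - k) * frac_int 2 w (real k * \<tau>))\<bar>
     \<le> C1 * M * \<tau> powr (\<beta> + 2)"
    using quadrature_error_bound[OF \<beta>] by blast
  obtain C2 where C2: "0 \<le> C2" and pow: "\<And>\<tau> n. 0 < \<tau> \<Longrightarrow> 1 \<le> n \<Longrightarrow>
     \<bar>\<Sum>k\<le>n. scheme_alpha \<beta> (n - k) * ((real k * \<tau>) powr \<beta> / Gamma (\<beta> + 1))\<bar> \<le> C2 * \<tau> powr \<beta> \<and>
     \<bar>\<Sum>k\<le>n. scheme_alpha \<beta> (n - k) * ((real k * \<tau>) powr (\<beta> + 1) / Gamma (\<beta> + 2))\<bar>
       \<le> C2 * \<tau> powr \<beta> * (real n * \<tau> + \<tau>)"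
    using scheme_alpha_power_sum_bounds[OF \<beta>] by blast
  define E where "E = M / 12"
  have E0: "0 \<le> E" using M0 by (simp add: E_def)
  \<comment> \<open>The constants in front of \<open>\<tau>\<^sup>2\<close> and of \<open>h\<^sup>2\<close>.\<close>
  define Ct where "Ct = \<mu> * (C1 * M)"
  define Cx where "Cx = \<mu> * ((2 * \<beta> + 1) * (E * (2 + T)) + E * C2 + E * (C2 * (2 * T)))"
  have Ct0: "0 \<le> Ct" using \<mu> C1 M0 by (simp add: Ct_def)
  have Cx0: "0 \<le> Cx" using \<mu> \<beta> E0 C2 T by (simp add: Cx_def)
  have "\<bar>residual \<beta> \<mu> a b T f \<phi>0 \<psi>0 U nT N j n\<bar>
          \<le> (Ct + Cx) * time_step T nT powr \<beta> * ((time_step T nT)\<^sup>2 + (space_step a b N)\<^sup>2)"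
    if nT: "0 < nT" and j: "j \<in> {1..N - 1}" and n: "n \<in> {1..nT}" for nT N j n
  proof -
    define \<tau> where "\<tau> = time_step T nT"
    define h where "h = space_step a b N"
    define x where "x = grid_x a b N j"
    have \<tau>: "0 < \<tau>" using T nT by (simp add: \<tau>_def time_step_def)
    have TnT: "real nT * \<tau> = T" using nT by (simp add: \<tau>_def time_step_def)
    have tk: "real k * \<tau> \<in> {0..T}" if "k \<le> nT" for k
      using that \<tau> mult_right_mono[of "real k" "real nT" \<tau>] TnT by simp
    have grid: "grid_t T nT k = real k * \<tau>" for k by (simp add: grid_t_def \<tau>_def)
    have \<tau>T: "\<tau> \<le> T" using tk[of 1] nT by simp
    have jN: "1 \<le> j" "j < N" using j by auto
    have x: "x \<in> {a<..<b}" unfolding x_def by (rule grid_x_interior[OF ab jN])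
    define \<Delta> where "\<Delta> = (\<lambda>v. delta2 h (\<lambda>i. v (grid_x a b N i)) j)"
    \<comment> \<open>\<open>e v\<close> is the error of the second difference of \<open>v\<close> at the grid point.\<close>
    define e where "e = (\<lambda>v. \<Delta> v - (deriv ^^ 2) v x)"
    have e: "\<bar>e v\<bar> \<le> E * h\<^sup>2" if "C4_fun a b v" "\<And>y. y \<in> {a<..<b} \<Longrightarrow> \<bar>(deriv ^^ 4) v y\<bar> \<le> M" for v
      using delta2_error[OF ab jN that] by (simp add: e_def \<Delta>_def h_def x_def E_def)
    define p0 where "p0 = (\<lambda>y. U y 0)"
    define p1 where "p1 = W1 0"
    have mem: "grid_x a b N i \<in> {a..b}" if "i \<le> j + 1" for i
      using that jN by (intro grid_x_mem[OF ab]) auto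
    have \<Delta>phi: "\<Delta> \<phi>0 = \<Delta> p0" and \<Delta>psi: "\<Delta> \<psi>0 = \<Delta> p1"
      using phi psi mem by (simp_all add: \<Delta>_def delta2_def p0_def p1_def)
    have ep0: "\<bar>e p0\<bar> \<le> E * h\<^sup>2" unfolding p0_def by (rule e[OF CU[OF T0] M4[OF _ T0]])
    have ep1: "\<bar>e p1\<bar> \<le> E * h\<^sup>2" unfolding p1_def by (rule e[OF CW M4'])
    define y where "y = (\<lambda>t. (deriv ^^ 2) (\<lambda>z. U z t) x)"
    define wy where "wy = (\<lambda>t. (deriv ^^ 2) (W2 t) x)"
    have yder: "(y has_real_derivative (deriv ^^ 2) (W1 s) x) (at s within {0..T})"
      "((\<lambda>s. (deriv ^^ 2) (W1 s) x) has_real_derivative wy s) (at s within {0..T})" if "s \<in> {0..T}" for s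
      unfolding y_def wy_def using D1[of 2 x s] D2[of 2 x s] x that by auto
    have wyc: "continuous_on {0..T} wy" unfolding wy_def using D2c[of 2 x] x by simp
    have uder: "(U x has_real_derivative W1 s x) (at s within {0..T})"
      "((\<lambda>s. W1 s x) has_real_derivative W2 s x) (at s within {0..T})" if "s \<in> {0..T}" for s
      using D1[of 0 x s] D2[of 0 x s] x that by auto
    have wuc: "continuous_on {0..T} (\<lambda>s. W2 s x)" using D2c[of 0 x] x by simp
    define d0 where "d0 = (deriv ^^ 2) p0 x"
    define d1 where "d1 = (deriv ^^ 2) p1 x"
    have y0: "y 0 = d0" "(deriv ^^ 2) (W1 0) x = d1" by (simp_all add: y_def d0_def p0_def d1_def p1_def)
    define t where "t = (\<lambda>k. real k * \<tau>)"
    define P where "P = (\<lambda>k. t k powr \<beta> / Gamma (\<beta> + 1))"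
    define Q where "Q = (\<lambda>k. t k powr (\<beta> + 1) / Gamma (\<beta> + 2))"
    define G where "G = (\<lambda>k. frac_int (\<beta> + 2) wy (t k))"
    define H where "H = (\<lambda>k. frac_int 2 wy (t k))"
    \<comment> \<open>\<open>\<epsilon> k\<close> is the error of the second difference of the solution minus its Taylor polynomial.\<close>
    define \<epsilon> where "\<epsilon> = (\<lambda>k. e (\<lambda>z. U z (t k)) - e p0 - t k * e p1)"
    have tT: "t k \<in> {0..T}" if "k \<le> n" for k using tk[of k] that n by (simp add: t_def)
    have source: "U x (t k) - phi_low \<phi>0 \<psi>0 x (t k) - frac_int \<beta> (f x) (t k) = \<mu> * (d0 * P k + d1 * Q k + G k)"
      if "k \<le> n" for k
    proof -
      have "x \<in> {a..b}" using x by auto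
      then have "phi_low \<phi>0 \<psi>0 x (t k) = U x 0 + W1 0 x * t k" using phi psi by (simp add: phi_low_def)
      moreover have "frac_int \<beta> (f x) (t k) = U x (t k) - U x 0 - W1 0 x * t k
         - \<mu> * (y 0 * t k powr \<beta> / Gamma (\<beta> + 1) + (deriv ^^ 2) (W1 0) x * t k powr (\<beta> + 1) / Gamma (\<beta> + 2) + G k)"
        unfolding G_def
        by (rule frac_int_source[OF \<beta> tT[OF that] _ uder wuc yder wyc]) (use pde[OF x] in \<open>simp_all add: y_def\<close>)
      ultimately show ?thesis unfolding y0 by (simp add: P_def Q_def)
    qed
    have space: "\<Delta> (\<lambda>z. U z (t k)) - (\<Delta> \<phi>0 + t k * \<Delta> \<psi>0) = H k + \<epsilon> k" if "k \<le> n" for k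
    proof -
      have "y (t k) = y 0 + (deriv ^^ 2) (W1 0) x * t k + H k"
        unfolding H_def by (rule taylor_frac_int[OF yder]) (use tT[OF that] in auto)
      then show ?thesis unfolding \<Delta>phi \<Delta>psi \<epsilon>_def e_def y0
        by (simp add: y_def d0_def d1_def algebra_simps)
    qed
    have \<epsilon>: "\<bar>\<epsilon> k\<bar> \<le> E * (2 + T) * h\<^sup>2" if "k \<le> n" for k
    proof -
      have "\<bar>t k * e p1\<bar> \<le> T * (E * h\<^sup>2)"
        using tT[OF that] ep1 by (simp add: abs_mult mult_mono)
      moreover have "\<bar>e (\<lambda>z. U z (t k))\<bar> \<le> E * h\<^sup>2"
        by (rule e[OF CU[OF tT[OF that]] M4[OF _ tT[OF that]]])
      ultimately have "\<bar>\<epsilon> k\<bar> \<le> E * h\<^sup>2 + E * h\<^sup>2 + T * (E * h\<^sup>2)"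
        using ep0 unfolding \<epsilon>_def by linarith
      then show ?thesis by (simp add: algebra_simps)
    qed
    define A where "A = (\<lambda>k. scheme_alpha \<beta> (n - k))"
    define \<Theta> where "\<Theta> = (\<lambda>k. scheme_theta \<beta> (n - k))"
    define S1 where "S1 = (\<Sum>k\<le>n. A k * G k) - \<tau> powr \<beta> * (\<Sum>k\<le>n. \<Theta> k * H k)"
    define S2 where "S2 = (\<Sum>k\<le>n. \<Theta> k * \<epsilon> k)"
    define S3 where "S3 = (\<Sum>k\<le>n. A k * P k)"
    define S4 where "S4 = (\<Sum>k\<le>n. A k * Q k)"
    have "residual \<beta> \<mu> a b T f \<phi>0 \<psi>0 U nT N j n =
        (\<Sum>k\<le>n. A k * (U x (t k) - phi_low \<phi>0 \<psi>0 x (t k)))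
        - \<mu> * \<tau> powr \<beta> * (\<Sum>k\<le>n. \<Theta> k * (\<Delta> (\<lambda>z. U z (t k)) - (\<Delta> \<phi>0 + t k * \<Delta> \<psi>0)))
        - \<mu> * (\<Sum>k\<le>n. A k * (P k * \<Delta> \<phi>0 + Q k * \<Delta> \<psi>0))
        - (\<Sum>k\<le>n. A k * frac_int \<beta> (f x) (t k))"
      unfolding residual_eq delta2_phi_low delta2_Phi_up
      by (simp add: A_def \<Theta>_def \<Delta>_def P_def Q_def t_def grid h_def x_def \<tau>_def[symmetric] atLeast0AtMost)
    also have "\<dots> = (\<Sum>k\<le>n. A k * (U x (t k) - phi_low \<phi>0 \<psi>0 x (t k) - frac_int \<beta> (f x) (t k)))
        - \<mu> * \<tau> powr \<beta> * (\<Sum>k\<le>n. \<Theta> k * (\<Delta> (\<lambda>z. U z (t k)) - (\<Delta> \<phi>0 + t k * \<Delta> \<psi>0)))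
        - \<mu> * (\<Sum>k\<le>n. A k * (P k * \<Delta> \<phi>0 + Q k * \<Delta> \<psi>0))"
      by (simp add: right_diff_distrib sum_subtractf)
    also have "(\<Sum>k\<le>n. A k * (U x (t k) - phi_low \<phi>0 \<psi>0 x (t k) - frac_int \<beta> (f x) (t k)))
        = (\<Sum>k\<le>n. A k * (\<mu> * (d0 * P k + d1 * Q k + G k)))"
      by (rule sum.cong) (simp_all add: source)
    also have "\<dots> = \<mu> * (d0 * S3 + d1 * S4 + (\<Sum>k\<le>n. A k * G k))"
      unfolding S3_def S4_def by (simp add: sum_distrib_left sum.distrib distrib_left mult_ac)
    also have "(\<Sum>k\<le>n. \<Theta> k * (\<Delta> (\<lambda>z. U z (t k)) - (\<Delta> \<phi>0 + t k * \<Delta> \<psi>0))) = (\<Sum>k\<le>n. \<Theta> k * (H k + \<epsilon> k))"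
      by (rule sum.cong) (simp_all add: space)
    also have "\<dots> = (\<Sum>k\<le>n. \<Theta> k * H k) + S2"
      unfolding S2_def by (simp add: sum.distrib distrib_left)
    also have "(\<Sum>k\<le>n. A k * (P k * \<Delta> \<phi>0 + Q k * \<Delta> \<psi>0)) = \<Delta> p0 * S3 + \<Delta> p1 * S4"
      unfolding S3_def S4_def \<Delta>phi \<Delta>psi by (simp add: sum_distrib_left sum.distrib distrib_left mult_ac)
    finally have R: "residual \<beta> \<mu> a b T f \<phi>0 \<psi>0 U nT N j n
        = \<mu> * (S1 - \<tau> powr \<beta> * S2 - e p0 * S3 - e p1 * S4)"
      unfolding S1_def e_def d0_def d1_def by (simp add: algebra_simps)
    have S1: "\<bar>S1\<bar> \<le> C1 * M * (\<tau> powr \<beta> * \<tau>\<^sup>2)"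
    proof -
      have sub: "{0..real n * \<tau>} \<subseteq> {0..T}" using tk[of n] n by auto
      have "\<bar>S1\<bar> \<le> C1 * M * \<tau> powr (\<beta> + 2)"
        unfolding S1_def A_def \<Theta>_def G_def H_def t_def
      proof (rule quad[OF \<tau>])
        show "continuous_on {0..real n * \<tau>} wy" by (rule continuous_on_subset[OF wyc sub])
        show "\<forall>s\<in>{0..real n * \<tau>}. \<bar>wy s\<bar> \<le> M"
          using M2[of 2 x] x sub unfolding wy_def by (simp add: subset_iff)
      qed
      also have "\<tau> powr (\<beta> + 2) = \<tau> powr \<beta> * \<tau>\<^sup>2" using \<tau> by (simp add: powr_add)
      finally show ?thesis .
    qed
    have S2: "\<bar>S2\<bar> \<le> (2 * \<beta> + 1) * (E * (2 + T) * h\<^sup>2)"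
    proof -
      have "\<bar>S2\<bar> \<le> (\<Sum>k\<le>n. \<bar>\<Theta> k * \<epsilon> k\<bar>)" unfolding S2_def by (rule sum_abs)
      also have "\<dots> \<le> (\<Sum>k\<le>n. \<bar>\<Theta> k\<bar> * (E * (2 + T) * h\<^sup>2))"
        using \<epsilon> by (intro sum_mono) (simp add: abs_mult mult_left_mono)
      also have "\<dots> = (\<Sum>k\<le>n. \<bar>\<Theta> k\<bar>) * (E * (2 + T) * h\<^sup>2)"
        by (simp add: sum_distrib_right)
      also have "(\<Sum>k\<le>n. \<bar>\<Theta> k\<bar>) = (\<Sum>k\<le>n. \<bar>scheme_theta \<beta> k\<bar>)"
        unfolding \<Theta>_def by (rule sum.reindex_bij_witness[of _ "\<lambda>k. n - k" "\<lambda>k. n - k"]) auto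
      also have "(\<Sum>k\<le>n. \<bar>scheme_theta \<beta> k\<bar>) * (E * (2 + T) * h\<^sup>2) \<le> (2 * \<beta> + 1) * (E * (2 + T) * h\<^sup>2)"
        using scheme_theta_abs_sum[OF \<beta>] E0 T by (intro mult_right_mono) auto
      finally show ?thesis .
    qed
    have S3: "\<bar>S3\<bar> \<le> C2 * \<tau> powr \<beta>" and S4: "\<bar>S4\<bar> \<le> C2 * \<tau> powr \<beta> * (2 * T)"
    proof -
      have n1: "1 \<le> n" using n by simp
      show "\<bar>S3\<bar> \<le> C2 * \<tau> powr \<beta>" using pow[OF \<tau> n1] by (simp add: S3_def A_def P_def t_def)
      have "\<bar>S4\<bar> \<le> C2 * \<tau> powr \<beta> * (real n * \<tau> + \<tau>)" using pow[OF \<tau> n1] by (simp add: S4_def A_def Q_def t_def)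
      also have "\<dots> \<le> C2 * \<tau> powr \<beta> * (2 * T)"
        using tk[of n] n \<tau>T C2 by (intro mult_left_mono) auto
      finally show "\<bar>S4\<bar> \<le> C2 * \<tau> powr \<beta> * (2 * T)" .
    qed
    have b3: "\<bar>e p0 * S3\<bar> \<le> (E * h\<^sup>2) * (C2 * \<tau> powr \<beta>)"
      unfolding abs_mult using ep0 S3 E0 by (intro mult_mono) auto
    have b4: "\<bar>e p1 * S4\<bar> \<le> (E * h\<^sup>2) * (C2 * \<tau> powr \<beta> * (2 * T))"
      unfolding abs_mult using ep1 S4 E0 by (intro mult_mono) auto
    have b2: "\<bar>\<tau> powr \<beta> * S2\<bar> \<le> \<tau> powr \<beta> * ((2 * \<beta> + 1) * (E * (2 + T) * h\<^sup>2))"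
      unfolding abs_mult using S2 by (intro mult_mono) auto
    have "\<bar>S1 - \<tau> powr \<beta> * S2 - e p0 * S3 - e p1 * S4\<bar>
        \<le> C1 * M * (\<tau> powr \<beta> * \<tau>\<^sup>2) + \<tau> powr \<beta> * ((2 * \<beta> + 1) * (E * (2 + T) * h\<^sup>2))
          + (E * h\<^sup>2) * (C2 * \<tau> powr \<beta>) + (E * h\<^sup>2) * (C2 * \<tau> powr \<beta> * (2 * T))"
      using S1 b2 b3 b4 by linarith
    then have "\<mu> * \<bar>S1 - \<tau> powr \<beta> * S2 - e p0 * S3 - e p1 * S4\<bar>
        \<le> \<mu> * (C1 * M * (\<tau> powr \<beta> * \<tau>\<^sup>2) + \<tau> powr \<beta> * ((2 * \<beta> + 1) * (E * (2 + T) * h\<^sup>2))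
          + (E * h\<^sup>2) * (C2 * \<tau> powr \<beta>) + (E * h\<^sup>2) * (C2 * \<tau> powr \<beta> * (2 * T)))"
      using \<mu> by (intro mult_left_mono) auto
    also have "\<dots> = Ct * \<tau> powr \<beta> * \<tau>\<^sup>2 + Cx * \<tau> powr \<beta> * h\<^sup>2"
      unfolding Ct_def Cx_def by (simp add: algebra_simps)
    also have "\<dots> \<le> Ct * \<tau> powr \<beta> * (\<tau>\<^sup>2 + h\<^sup>2) + Cx * \<tau> powr \<beta> * (\<tau>\<^sup>2 + h\<^sup>2)"
      using Ct0 Cx0 by (intro add_mono mult_left_mono) auto
    also have "\<dots> = (Ct + Cx) * \<tau> powr \<beta> * (\<tau>\<^sup>2 + h\<^sup>2)" by (simp add: algebra_simps)
    finally show ?thesis using \<mu> unfolding R by (simp add: abs_mult \<tau>_def h_def)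
  qed
  then show ?thesis unfolding scheme_consistent_def by blast
qed

end
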